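(* Fix $k \ge 1$ and $k$ smooth functions $f_1, \dots, f_k:\mathbb R_{\ge 0} \to \mathbb C$ with compact supports contained in $(0,\infty)$ and such that $|\hat f_i(\xi)| = O(|\xi|^{-2})$ for all $1\le i\le k$. Let $q \ge 1$ be a squarefree integer. Then for $h \ge 3$, \[ V_k(q,h;f_1,\dots, f_k) = \sum_{\sigma \in \mathcal B_k} \prod_{(i,j) \in \sigma} V_2(q,h;f_i,f_j) + O_{f_1,\dots,f_k}\left(h^{k/2-1/(7k)}\left(\frac{q}{\phi(q)}\right)^{2^k + k/2}\right). \]
   Context: Write $e(x)=e^{2\pi i x}$; $\mu$ is the Möbius function and $\phi$ Euler's totient function. Each $f$ is extended by $0$ to negative arguments, and $\hat f(\xi) := \int_{-\infty}^\infty f(x)e^{-2\pi i x\xi}\,dx$. For $\alpha\in\mathbb R$ and $h\ge1$, $E_{f,h}(\alpha) := \sum_{m\in\mathbb Z} f(m/h)e(m\alpha)$. For an integer $q\ge1$, \[V_k(q,h;f_1, \dots, f_k) := \sum_{1 < q_1, \dots, q_k \mid q} \prod_{i=1}^k \frac{\mu(q_i)}{\phi(q_i)} \sum_{\substack{a_1, \dots, a_k \\ 1 \le a_i \le q_i \\ (a_i,q_i) = 1 \\ \sum_i a_i/q_i \in \mathbb Z}} \prod_{i=1}^k E_{f_i,h}\left(\frac{a_i}{q_i}\right).\] $\mathcal B_k$ is the set of perfect matchings of $\{1,\dots,k\}$: sets $\sigma$ of unordered pairs $(i,j)$, $i<j$, of distinct elements such that each element of $\{1,\dots,k\}$ lies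 in exactly one pair (empty if $k$ odd). *)

theory Defs
  imports
    "HOL-Analysis.Analysis"
    "HOL-Library.Landau_Symbols"
    "HOL-Computational_Algebra.Squarefree"
    "HOL-Number_Theory.Totient"
begin

definition ee :: "real \<Rightarrow> complex" where
  "ee x = exp (2 * of_real pi * \<i> * of_real x)"

definition moebius_mu :: "nat \<Rightarrow> int" where
  "moebius_mu n = (if squarefree n then (- 1) ^ card (prime_factors n) else 0)"

text \<open>A function \<open>f\<close> on \<open>[0, \<infinity>)\<close> is represented by a total function whose values at negative
  arguments are irrelevant: every notion below only looks at \<open>f\<close> on \<^term>\<open>{0::real..}\<close>.\<close>

definition zero_ext :: "(real \<Rightarrow> complex) \<Rightarrow> real \<Rightarrow> complex" where
  "zero_ext f x = (if 0 \<le> x then f x else 0)"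

text \<open>Infinitely differentiable on \<open>[0, \<infinity>)\<close>, one-sided at the end point; \<open>D n\<close> is the
  \<open>n\<close>-th derivative.\<close>

definition smooth_halfline :: "(real \<Rightarrow> complex) \<Rightarrow> bool" where
  "smooth_halfline f \<longleftrightarrow>
    (\<exists>D :: nat \<Rightarrow> real \<Rightarrow> complex.
       (\<forall>x\<ge>0. D 0 x = f x) \<and>
       (\<forall>n. \<forall>x\<ge>0. (D n has_vector_derivative D (Suc n) x) (at x within {0..})))"

definition supp_halfline :: "(real \<Rightarrow> complex) \<Rightarrow> real set" where
  "supp_halfline f = closure {x. 0 \<le> x \<and> f x \<noteq> 0}"

definition fourier :: "(real \<Rightarrow> complex) \<Rightarrow> real \<Rightarrow> complex" where
  "fourier f \<xi> = (\<integral>x. zero_ext f x * ee (- (x * \<xi>)) \<partial>lborel)"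

definition Esum :: "(real \<Rightarrow> complex) \<Rightarrow> real \<Rightarrow> real \<Rightarrow> complex" where
  "Esum f h \<alpha> = (\<Sum>\<^sub>\<infinity>m::int\<in>UNIV. zero_ext f (of_int m / h) * ee (of_int m * \<alpha>))"

text \<open>\<open>Vk k q h f\<close> is \<open>V\<^sub>k(q, h; f 1, \<dots>, f k)\<close>; the tuples \<open>(q\<^sub>1, \<dots>, q\<^sub>k)\<close> and
  \<open>(a\<^sub>1, \<dots>, a\<^sub>k)\<close> are extensional functions on \<^term>\<open>{1..k::nat}\<close>.\<close>

definition Vk :: "nat \<Rightarrow> nat \<Rightarrow> real \<Rightarrow> (nat \<Rightarrow> real \<Rightarrow> complex) \<Rightarrow> complex" where
  "Vk k q h f =
    (\<Sum>d \<in> ({1..k} \<rightarrow>\<^sub>E {d. 1 < d \<and> d dvd q}).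
       (\<Prod>i=1..k. of_int (moebius_mu (d i)) / of_nat (totient (d i))) *
       (\<Sum>a \<in> {a \<in> (\<Pi>\<^sub>E i\<in>{1..k}. {1..d i}).
                 (\<forall>i\<in>{1..k}. coprime (a i) (d i)) \<and>
                 (\<Sum>i=1..k. real (a i) / real (d i)) \<in> \<int>}.
          \<Prod>i=1..k. Esum (f i) h (real (a i) / real (d i))))"

definition V2 :: "nat \<Rightarrow> real \<Rightarrow> (real \<Rightarrow> complex) \<Rightarrow> (real \<Rightarrow> complex) \<Rightarrow> complex" where
  "V2 q h f g = Vk 2 q h (\<lambda>i. if i = 1 then f else g)"

text \<open>Perfect matchings of \<open>{1, \<dots>, k}\<close>; the unordered pair \<open>{i, j}\<close> is represented by
  \<open>(i, j)\<close> with \<open>i < j\<close>.\<close>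

definition matchings :: "nat \<Rightarrow> (nat \<times> nat) set set" where
  "matchings k =
    {\<sigma>. \<sigma> \<subseteq> {(i, j). i \<in> {1..k} \<and> j \<in> {1..k} \<and> i < j} \<and>
         (\<forall>m\<in>{1..k}. \<exists>!p. p \<in> \<sigma> \<and> (m = fst p \<or> m = snd p))}"

end

theory Submission
  imports Defs
begin

text \<open>
  Identify reduced fractions with their classes modulo 1. Then \<open>V\<^sub>k\<close> is a sum over tuples
  \<open>x\<close> of nonzero \<open>q\<close>-torsion classes with sum zero, and the main term is the same sum weighted by the
  number of perfect matchings compatible with \<open>x\<close> (pairs with \<open>x\<^sub>i + x\<^sub>j = 0\<close>). So only tuples
  without a unique compatible matching contribute to the difference.

  Since the weights are smooth, \<open>E\<^sub>f\<^sub>,\<^sub>h(x)\<close> is \<open>O(h)\<close> for \<open>|x| \<le> \<delta>\<close>, where \<open>\<delta>\<close> is about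
  \<open>1/h\<close>, and \<open>O(1)\<close> elsewhere. The fundamental lemma of Montgomery and Vaughan (a Cauchy-Schwarz bound
  for sums over zero-sum tuples, proved prime by prime) disposes of the tuples with a large entry.
  For small entries, cancelling pairs are split off one at a time until the tuple is primitive, i.e.
  no two entries cancel. In a primitive tuple two denominators have a gcd that is a power of
  \<open>h\<close>. These two entries are merged into their sum \<open>\<sigma> \<noteq> 0\<close> and the fundamental lemma is applied
  to the remaining entries. The saving comes from the second moment of the number of representations
  of \<open>\<sigma>\<close>: the denominators are \<open>ust\<close> and \<open>vst\<close> with \<open>uvs\<close> the denominator of \<open>\<sigma>\<close>; if they are well above
  \<open>h\<close>, spacing of fractions wins, and otherwise the numerators are tiny and determine \<open>t\<close>.
\<close>

section \<open>Torsion elements of the circle group and their denominators\<close>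

text \<open>Applied to all entries separately, the fundamental lemma gives about h^(k/2), the size
  of the main term itself. A power saving therefore needs an input better than the product of the
  separate norms. Merging provides it: two separate entries contribute sqrt(2\<delta>)^2 =
  2\<delta>, the merged entry only the square root of its second moment, which the final parameters
  make at most 10 \<delta> sqrt y with y a negative power of h. Two obstacles shape the argument:
  \<sigma> = 0 would collect the whole diagonal, so cancelling pairs must go first; and for a gcd of
  size 1 the second moment bound is no better than \<delta>^2, so a gcd of size at least
  \<open>D\<close> must be found. Constants: some gcd reaches \<open>D\<close> once D^(k-1) <
  1/\<delta>. With D = 1/y^3 and \<delta> close to 1/h this permits y = h^(-c), c close to 1/(3k), a
  saving sqrt y close to h^(-1/(6k)). The margin 1/6 - 1/7 = 1/42 pays for \<epsilon> = 1/(42 k^2)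
  in \<delta> = h^(\<epsilon>-1)/8; this small excess over 1/h makes the exponential sum bounded
  beyond \<delta> after 1/\<epsilon> summations by parts.\<close>

text \<open>\<open>cen x\<close> is the representative of \<open>x\<close> modulo 1 in the interval \<open>(-1/2, 1/2]\<close>.\<close>

definition cen :: "real \<Rightarrow> real" where
  "cen x = x - of_int \<lceil>x - 1/2\<rceil>"

text \<open>Elements of the circle group are kept as reals, so that equality of classes is equality
  of numbers and |x| is the distance to the nearest integer.\<close>

definition torsion :: "nat \<Rightarrow> real set" where
  "torsion q = {x. - 1/2 < x \<and> x \<le> 1/2 \<and> real q * x \<in> \<int>}"

text \<open>The order of the class of x modulo 1, that is, the reduced denominator of a rational x.
  The lemmas carry a witness \<open>q\<close> with \<open>real q * x \<in> \<int>\<close>, without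
  which \<open>LEAST\<close> says nothing.\<close>

definition den :: "real \<Rightarrow> nat" where
  "den x = (LEAST d. d > 0 \<and> real d * x \<in> \<int>)"

lemma cen_bounds: "- 1/2 < cen x" "cen x \<le> 1/2"
  unfolding cen_def by linarith+

lemma cen_diff_Ints: "x - cen x \<in> \<int>"
  by (simp add: cen_def)

lemma cen_diff_Ints': "cen x - x \<in> \<int>"
  by (simp add: cen_def)

lemma centred_eqI:
  assumes "- 1/2 < x" "x \<le> 1/2" "- 1/2 < y" "y \<le> 1/2" "x - y \<in> (\<int> :: real set)"
  shows "x = y"
proof -
  obtain n :: int where n: "x - y = of_int n" using assms(5) by (auto elim: Ints_cases)
  have "\<bar>of_int n :: real\<bar> < 1" unfolding n[symmetric] using assms(1-4) by linarith
  then have "n = 0" by linarith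
  with n show ?thesis by simp
qed

lemma cen_cong: "x - y \<in> \<int> \<Longrightarrow> cen x = cen y"
proof (rule centred_eqI)
  assume "x - y \<in> \<int>"
  then have "(cen x - x) + (x - y) + (y - cen y) \<in> \<int>"
    by (intro Ints_add cen_diff_Ints cen_diff_Ints')
  then show "cen x - cen y \<in> \<int>" by simp
qed (use cen_bounds in auto)

lemma cen_eq_self: "- 1/2 < x \<Longrightarrow> x \<le> 1/2 \<Longrightarrow> cen x = x"
  by (rule centred_eqI) (use cen_bounds cen_diff_Ints' in auto)

lemma Ints_cong: "x - y \<in> \<int> \<Longrightarrow> x \<in> \<int> \<longleftrightarrow> (y :: real) \<in> \<int>"
  using Ints_diff[of x "x - y"] Ints_add[of "x - y" y] by auto

lemma mult_nat_Ints: "x \<in> \<int> \<Longrightarrow> real n * x \<in> \<int>"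
  by (intro Ints_mult) auto

lemma torsion_mono: "d dvd q \<Longrightarrow> torsion d \<subseteq> torsion q"
  unfolding torsion_def by (auto elim!: dvdE simp: mult.assoc mult.left_commute intro: mult_nat_Ints)

lemma cen_in_torsion_iff: "cen x \<in> torsion q \<longleftrightarrow> real q * x \<in> \<int>"
proof -
  have "real q * (cen x - x) \<in> \<int>" by (intro mult_nat_Ints cen_diff_Ints')
  then have "real q * cen x - real q * x \<in> \<int>" by (simp add: algebra_simps)
  then have "real q * cen x \<in> \<int> \<longleftrightarrow> real q * x \<in> \<int>"
    by (rule Ints_cong)
  then show ?thesis using cen_bounds[of x] by (auto simp: torsion_def)
qed

lemma cen_torsion: "x \<in> torsion q \<Longrightarrow> cen x = x"
  by (auto simp: torsion_def intro: cen_eq_self)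

lemma torsion_eqI: "x \<in> torsion q \<Longrightarrow> y \<in> torsion r \<Longrightarrow> x - y \<in> \<int> \<Longrightarrow> x = y"
  by (auto simp: torsion_def intro: centred_eqI)

lemma torsion_Ints_iff: "x \<in> torsion q \<Longrightarrow> x \<in> \<int> \<longleftrightarrow> x = 0"
  using centred_eqI[of x 0] by (auto simp: torsion_def)

lemma zero_in_torsion [simp]: "0 \<in> torsion q"
  by (simp add: torsion_def)

lemma torsion_1: "torsion (Suc 0) = {0}"
proof -
  have "x = 0" if "x \<in> torsion (Suc 0)" for x
    using torsion_Ints_iff[OF that] that by (auto simp: torsion_def)
  then show ?thesis by auto
qed

text \<open>Bezout: the integers that multiply x into the integers form an ideal.\<close>

lemma gcd_mult_Ints:
  assumes "real a * x \<in> \<int>" "real b * x \<in> \<int>"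
  shows "real (gcd a b) * x \<in> \<int>"
proof -
  obtain u v where uv: "u * int a + v * int b = gcd (int a) (int b)"
    using bezout_int by blast
  have "real_of_int u * (real a * x) + real_of_int v * (real b * x) \<in> \<int>"
    by (rule Ints_add[OF Ints_mult[OF Ints_of_int assms(1)] Ints_mult[OF Ints_of_int assms(2)]])
  also have "real_of_int u * (real a * x) + real_of_int v * (real b * x)
      = real_of_int (u * int a + v * int b) * x" by (simp add: algebra_simps)
  also have "\<dots> = real (gcd a b) * x" unfolding uv by (simp add: gcd_int_int_eq)
  finally show ?thesis .
qed

lemma den_mult_Ints:
  assumes "q > 0" "real q * x \<in> \<int>"
  shows "den x > 0" "real (den x) * x \<in> \<int>"
  using LeastI[of "\<lambda>d. d > 0 \<and> real d * x \<in> \<int>" q] assms by (auto simp: den_def)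

lemma den_dvd_iff:
  assumes "q > 0" "real q * x \<in> \<int>"
  shows "den x dvd d \<longleftrightarrow> real d * x \<in> \<int>"
proof
  assume "den x dvd d"
  then show "real d * x \<in> \<int>"
    using mult_nat_Ints[OF den_mult_Ints(2)[OF assms]] by (auto elim!: dvdE simp: mult_ac)
next
  assume d: "real d * x \<in> \<int>"
  let ?g = "gcd (den x) d"
  have "real ?g * x \<in> \<int>" "?g > 0"
    using gcd_mult_Ints[OF den_mult_Ints(2)[OF assms] d] den_mult_Ints(1)[OF assms] by auto
  then have "den x \<le> ?g" unfolding den_def by (intro Least_le) auto
  with den_mult_Ints(1)[OF assms] have "?g = den x"
    by (intro antisym) (auto simp: dvd_imp_le)
  then show "den x dvd d" by (metis gcd_dvd2)
qed

lemma den_eqI: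
  assumes "d > 0" "\<And>n. real n * x \<in> \<int> \<longleftrightarrow> d dvd n"
  shows "den x = d"
proof -
  have "real d * x \<in> \<int>" using assms by simp
  from den_dvd_iff[OF assms(1) this] assms(2) have "den x dvd n \<longleftrightarrow> d dvd n" for n by simp
  then show ?thesis by (metis dvd_antisym dvd_refl)
qed

lemma den_cong:
  assumes "x - y \<in> \<int>" shows "den x = den y"
proof -
  have "real d * x \<in> \<int> \<longleftrightarrow> real d * y \<in> \<int>" for d
  proof -
    have "real d * (x - y) \<in> \<int>" using assms by (rule mult_nat_Ints)
    then have "real d * x - real d * y \<in> \<int>" by (simp add: algebra_simps)
    then show ?thesis by (rule Ints_cong)
  qed
  then show ?thesis by (simp add: den_def)
qed

lemma den_cen [simp]: "den (cen x) = den x"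
  by (rule den_cong) (rule cen_diff_Ints')

lemma torsion_Ints: "x \<in> torsion q \<Longrightarrow> real q * x \<in> \<int>"
  by (simp add: torsion_def)

lemma den_pos: "q > 0 \<Longrightarrow> x \<in> torsion q \<Longrightarrow> den x > 0"
  using den_mult_Ints torsion_Ints by blast

lemma den_dvd: "q > 0 \<Longrightarrow> x \<in> torsion q \<Longrightarrow> den x dvd q"
  using den_dvd_iff torsion_Ints by blast

lemma in_torsion_den_dvd_iff:
  assumes "q > 0" "x \<in> torsion q"
  shows "x \<in> torsion d \<longleftrightarrow> den x dvd d"
  using den_dvd_iff[of q x d] assms by (auto simp: torsion_def)

lemma den_1_iff: "q > 0 \<Longrightarrow> x \<in> torsion q \<Longrightarrow> den x = 1 \<longleftrightarrow> x = 0"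
  using in_torsion_den_dvd_iff[of q x 1] torsion_1 by auto

lemma den_0 [simp]: "den 0 = 1"
  using den_1_iff[of 1 0] by simp

lemma den_fraction:
  assumes "d > 0" "coprime a d"
  shows "den (real a / real d) = d"
proof (rule den_eqI)
  fix n :: nat
  show "real n * (real a / real d) \<in> \<int> \<longleftrightarrow> d dvd n"
  proof
    assume "real n * (real a / real d) \<in> \<int>"
    then obtain z where "real n * (real a / real d) = of_int z" by (auto elim: Ints_cases)
    then have "real_of_int (int (n * a)) = real_of_int (z * int d)" using assms(1)
      by (simp add: field_simps)
    then have "int (n * a) = z * int d" by (simp only: of_int_eq_iff)
    then have "d dvd n * a" by (metis dvd_triv_right int_dvd_int_iff)
    then show "d dvd n" using assms(2) by (simp add: coprime_commute coprime_dvd_mult_left_iff)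
  qed (use assms(1) in \<open>auto elim!: dvdE\<close>)
qed (rule assms)

text \<open>Multiplying the integral number \<open>den (y + z) * (y + z)\<close> by
  \<open>den z\<close> removes z and leaves an integral multiple of y, whence \<open>den y\<close>
  divides \<open>den z * den (y + z)\<close>; coprimality removes the factor \<open>den z\<close>,
  and the roles can be exchanged.\<close>

lemma den_add_coprime:
  assumes "a > 0" "real a * y \<in> \<int>" "b > 0" "real b * z \<in> \<int>" "coprime (den y) (den z)"
  shows "den (y + z) = den y * den z"
proof (rule dvd_antisym)
  have ab: "a * b > 0" using assms by simp
  have "real b * (real a * y) + real a * (real b * z) \<in> \<int>"
    by (rule Ints_add[OF mult_nat_Ints[OF assms(2)] mult_nat_Ints[OF assms(4)]])
  then have 0: "real (a * b) * (y + z) \<in> \<int>" by (simp add: algebra_simps)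
  note iff = den_dvd_iff[OF ab 0]
  note dy = den_mult_Ints[OF assms(1,2)] and dz = den_mult_Ints[OF assms(3,4)]
  have "real (den z) * (real (den y) * y) + real (den y) * (real (den z) * z) \<in> \<int>"
    by (rule Ints_add[OF mult_nat_Ints[OF dy(2)] mult_nat_Ints[OF dz(2)]])
  then show "den (y + z) dvd den y * den z" unfolding iff by (simp add: algebra_simps)
  let ?D = "den (y + z)"
  have D: "real ?D * (y + z) \<in> \<int>" by (rule iff[THEN iffD1, OF dvd_refl])
  have "real (den z) * (real ?D * (y + z)) - real ?D * (real (den z) * z) \<in> \<int>"
    by (rule Ints_diff[OF mult_nat_Ints[OF D] mult_nat_Ints[OF dz(2)]])
  then have "real (den z * ?D) * y \<in> \<int>" by (simp add: algebra_simps)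
  then have "den y dvd ?D" using den_dvd_iff[OF assms(1,2)] assms(5)
    by (metis coprime_dvd_mult_right_iff)
  have "real (den y) * (real ?D * (y + z)) - real ?D * (real (den y) * y) \<in> \<int>"
    by (rule Ints_diff[OF mult_nat_Ints[OF D] mult_nat_Ints[OF dy(2)]])
  then have "real (den y * ?D) * z \<in> \<int>" by (simp add: algebra_simps)
  then have "den z dvd ?D" using den_dvd_iff[OF assms(3,4)] assms(5)
    by (metis coprime_dvd_mult_right_iff coprime_commute)
  with \<open>den y dvd ?D\<close> show "den y * den z dvd ?D" using assms(5) by (simp add: divides_mult)
qed

section \<open>Counting fractions in short intervals\<close>

lemma card_ints_interval:
  assumes "a \<le> b"
  shows "finite {n::int. a \<le> of_int n \<and> of_int n \<le> b}" "card {n::int. a \<le> of_int n \<and> of_int n \<le> b} \<le> b - (a::real) + 1"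
proof -
  have eq: "{n::int. a \<le> of_int n \<and> of_int n \<le> b} = {\<lceil>a\<rceil>..\<lfloor>b\<rfloor>}"
    by (auto simp: ceiling_le_iff le_floor_iff)
  show "finite {n::int. a \<le> of_int n \<and> of_int n \<le> b}" unfolding eq by simp
  show "card {n::int. a \<le> of_int n \<and> of_int n \<le> b} \<le> b - a + 1" unfolding eq using assms by simp linarith
qed

text \<open>The set lies in a single translate of the multiples of 1/d. The \<open>+ 1\<close> is
  the price for an arbitrary translate, even when the interval is shorter than the spacing.\<close>

lemma card_coset_interval:
  fixes A :: "real set"
  assumes "d > 0" "\<And>x y. x \<in> A \<Longrightarrow> y \<in> A \<Longrightarrow> real d * (x - y) \<in> \<int>"
    "\<And>x. x \<in> A \<Longrightarrow> \<alpha> \<le> x \<and> x \<le> \<alpha> + l" "l \<ge> 0"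
  shows "finite A" "card A \<le> l * real d + 1"
proof -
  have "finite A \<and> card A \<le> l * real d + 1"
  proof (cases "A = {}")
    case False
    then obtain x0 where x0: "x0 \<in> A" by auto
    define F where "F x = \<lfloor>real d * (x - x0)\<rfloor>" for x
    let ?a = "real d * (\<alpha> - x0)" and ?b = "real d * (\<alpha> + l - x0)"
    have ab: "?a \<le> ?b" using assms by (intro mult_left_mono) auto
    have F: "of_int (F x) = real d * (x - x0)" if "x \<in> A" for x
      using assms(2)[OF that x0] unfolding F_def by (auto elim!: Ints_cases)
    have inj: "inj_on F A"
    proof (rule inj_onI)
      fix x y assume xy: "x \<in> A" "y \<in> A" "F x = F y"
      then have "real d * (x - x0) = real d * (y - x0)" using F by metis
      then show "x = y" using assms(1) by simp
    qed
    have im: "F ` A \<subseteq> {n. ?a \<le> of_int n \<and> of_int n \<le> ?b}"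
      using assms(1,3) by (auto simp: F)
    have fin: "finite A" by (rule inj_on_finite[OF inj im card_ints_interval(1)[OF ab]])
    have "card A \<le> card {n::int. ?a \<le> of_int n \<and> of_int n \<le> ?b}"
      by (rule card_inj_on_le[OF inj im card_ints_interval(1)[OF ab]])
    then have "real (card A) \<le> ?b - ?a + 1" using card_ints_interval(2)[OF ab] by linarith
    then show ?thesis using fin by (simp add: algebra_simps)
  qed (use assms in auto)
  then show "finite A" "card A \<le> l * real d + 1" by auto
qed

text \<open>Here the translate contains 0, and discarding 0 itself removes the \<open>+ 1\<close> of
  the general count: an interval too short for its spacing contributes nothing at all. The second
  moment bounds for small fractions depend on this.\<close>

lemma card_small_multiples:
  assumes "d > 0" "\<delta> \<ge> 0"
  shows "finite {y. y \<noteq> 0 \<and> \<bar>y\<bar> \<le> \<delta> \<and> real d * y \<in> \<int>}"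
    "card {y. y \<noteq> 0 \<and> \<bar>y\<bar> \<le> \<delta> \<and> real d * y \<in> \<int>} \<le> 2 * \<delta> * real d"
proof -
  let ?A = "{y. y \<noteq> 0 \<and> \<bar>y\<bar> \<le> \<delta> \<and> real d * y \<in> \<int>}"
  let ?B = "{-\<lfloor>\<delta> * d\<rfloor>..\<lfloor>\<delta> * d\<rfloor>} - {0}"
  let ?F = "\<lambda>y. \<lfloor>real d * y\<rfloor>"
  have F: "of_int (?F y) = real d * y" if "y \<in> ?A" for y
    using that by (auto elim!: Ints_cases)
  have inj: "inj_on ?F ?A"
  proof (rule inj_onI)
    fix x y assume xy: "x \<in> ?A" "y \<in> ?A" "?F x = ?F y"
    then have "real d * x = real d * y" using F by metis
    then show "x = y" using assms(1) by simp
  qed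
  have im: "?F ` ?A \<subseteq> ?B"
  proof
    fix n assume "n \<in> ?F ` ?A"
    then obtain y where y: "y \<in> ?A" "n = ?F y" by auto
    then have n: "of_int n = real d * y" using F by auto
    have "\<bar>of_int n\<bar> = real d * \<bar>y\<bar>" unfolding n by (simp add: abs_mult)
    also have "\<dots> \<le> real d * \<delta>" using y by (intro mult_left_mono) auto
    finally have "\<bar>n\<bar> \<le> \<lfloor>\<delta> * d\<rfloor>" by (simp add: le_floor_iff mult.commute)
    moreover have "n \<noteq> 0" using n y assms by auto
    ultimately show "n \<in> ?B" by auto
  qed
  show "finite ?A" by (rule inj_on_finite[OF inj im]) simp
  have "card ?A \<le> card ?B" by (rule card_inj_on_le[OF inj im]) simp
  moreover have "card ?B = nat (2 * \<lfloor>\<delta> * d\<rfloor>)"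
    using assms by (subst card_Diff_subset) (auto simp: nat_diff_distrib)
  moreover have "real_of_int \<lfloor>\<delta> * d\<rfloor> \<le> \<delta> * d" "\<lfloor>\<delta> * d\<rfloor> \<ge> 0" using assms by auto
  ultimately show "card ?A \<le> 2 * \<delta> * real d" by linarith
qed

section \<open>Finiteness and the Chinese remainder splitting of torsion\<close>

lemma torsion_diff_Ints:
  "x \<in> torsion q \<Longrightarrow> y \<in> torsion q \<Longrightarrow> real q * (x - y) \<in> \<int>"
  unfolding right_diff_distrib by (intro Ints_diff torsion_Ints)

lemma torsion_interval: "x \<in> torsion q \<Longrightarrow> - 1/2 \<le> x \<and> x \<le> - 1/2 + 1"
  by (simp add: torsion_def)

lemma finite_torsion: "q > 0 \<Longrightarrow> finite (torsion q)"
  using card_coset_interval(1)[OF _ torsion_diff_Ints torsion_interval] by simp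

lemma card_torsion_nonzero:
  assumes "q > 0" shows "card (torsion q - {0}) \<le> q"
proof -
  have "real (card (torsion q)) \<le> 1 * real q + 1"
    using card_coset_interval(2)[OF assms torsion_diff_Ints torsion_interval] by simp
  moreover have "card (torsion q - {0}) = card (torsion q) - 1"
    using finite_torsion[OF assms] by (simp add: card_Diff_singleton)
  ultimately show ?thesis by linarith
qed

lemma den_torsion_prime:
  assumes "prime p" "z \<in> torsion p" "z \<noteq> 0" shows "den z = p"
  using den_dvd[OF prime_gt_0_nat assms(2)] den_1_iff[OF prime_gt_0_nat assms(2)] assms
  by (meson prime_nat_iff)

text \<open>Chinese remainder theorem in the circle group. With u p + v q = 1 the components of x
  are u p x, killed by q, and v q x, killed by p; a class killed by both is 0, which gives
  injectivity.\<close>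

lemma torsion_coprime_bij:
  assumes "p > 0" "q > 0" "coprime p q"
  shows "bij_betw (\<lambda>(y, z). cen (y + z)) (torsion q \<times> torsion p) (torsion (p * q))"
  unfolding bij_betw_def
proof
  show "inj_on (\<lambda>(y, z). cen (y + z)) (torsion q \<times> torsion p)"
  proof (rule inj_onI, clarify)
    fix y z y' z' assume m: "y \<in> torsion q" "z \<in> torsion p" "y' \<in> torsion q" "z' \<in> torsion p"
      and eq: "cen (y + z) = cen (y' + z')"
    have "((y + z) - cen (y + z)) + (cen (y' + z') - (y' + z')) \<in> \<int>"
      by (intro Ints_add cen_diff_Ints cen_diff_Ints')
    then have I: "y - y' - (z' - z) \<in> \<int>" using eq by (simp add: algebra_simps)
    have q1: "real q * (y - y') \<in> \<int>" using m by (simp add: torsion_diff_Ints)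
    have p1: "real p * (z' - z) \<in> \<int>" using m by (simp add: torsion_diff_Ints)
    have "real p * (y - y' - (z' - z)) + real p * (z' - z) \<in> \<int>"
      using mult_nat_Ints[OF I] p1 by (rule Ints_add)
    then have "real p * (y - y') \<in> \<int>" by (simp add: algebra_simps)
    from gcd_mult_Ints[OF this q1] assms have y: "y - y' \<in> \<int>" by simp
    from Ints_diff[OF this I] have z: "z' - z \<in> \<int>" by simp
    show "y = y' \<and> z = z'" using torsion_eqI y z m by blast
  qed
  show "(\<lambda>(y, z). cen (y + z)) ` (torsion q \<times> torsion p) = torsion (p * q)"
  proof (intro equalityI subsetI)
    fix x assume "x \<in> (\<lambda>(y, z). cen (y + z)) ` (torsion q \<times> torsion p)"
    then obtain y z where yz: "x = cen (y + z)" "y \<in> torsion q" "z \<in> torsion p" by auto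
    have "real p * (real q * y) + real q * (real p * z) \<in> \<int>"
      by (rule Ints_add[OF mult_nat_Ints[OF torsion_Ints[OF yz(2)]] mult_nat_Ints[OF torsion_Ints[OF yz(3)]]])
    then show "x \<in> torsion (p * q)" unfolding yz cen_in_torsion_iff by (simp add: algebra_simps)
  next
    fix x assume x: "x \<in> torsion (p * q)"
    obtain u v where uv: "u * int p + v * int q = gcd (int p) (int q)" using bezout_int by blast
    then have uv: "u * int p + v * int q = 1" using assms(3) by (simp add: gcd_int_int_eq)
    define y where "y = real_of_int (u * int p) * x"
    define z where "z = real_of_int (v * int q) * x"
    have xpq: "real (p * q) * x \<in> \<int>" using x by (simp add: torsion_def)
    have "real_of_int u * (real (p * q) * x) \<in> \<int>" "real_of_int v * (real (p * q) * x) \<in> \<int>"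
      using xpq by (auto intro!: Ints_mult simp del: of_nat_mult)
    then have m: "cen y \<in> torsion q" "cen z \<in> torsion p"
      unfolding cen_in_torsion_iff y_def z_def by (simp_all add: algebra_simps)
    have "y + z = real_of_int (u * int p + v * int q) * x" by (simp add: y_def z_def algebra_simps)
    then have yzx: "y + z = x" unfolding uv by simp
    have "(cen y - y) + (cen z - z) \<in> \<int>" by (intro Ints_add cen_diff_Ints')
    then have "(cen y + cen z) - x \<in> \<int>" using yzx by (simp add: algebra_simps)
    then have "cen (cen y + cen z) = x" using cen_cong cen_torsion[OF x] by metis
    then show "x \<in> (\<lambda>(y, z). cen (y + z)) ` (torsion q \<times> torsion p)" using m by force
  qed
qed

section \<open>The fundamental lemma\<close>

definition zsum :: "nat set \<Rightarrow> real set \<Rightarrow> (nat \<Rightarrow> real) set" where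
  "zsum I A = {x \<in> I \<rightarrow>\<^sub>E A. (\<Sum>i\<in>I. x i) \<in> \<int>}"

lemma squarefree_induct [consumes 1, case_names one mult]:
  fixes n :: nat
  assumes "squarefree n" "P 1"
    "\<And>p q. prime p \<Longrightarrow> squarefree q \<Longrightarrow> q > 0 \<Longrightarrow> coprime p q \<Longrightarrow> P q \<Longrightarrow> P (p * q)"
  shows "P n"
  using assms(1)
proof (induction n rule: less_induct)
  case (less n)
  show ?case
  proof (cases "n = 1")
    case False
    then obtain p where p: "prime p" "p dvd n" using prime_factor_nat by blast
    then obtain q where q: "n = p * q" by auto
    have n0: "n > 0" using less.prems by (cases n) auto
    have sq: "squarefree q" using less.prems q by (meson dvd_triv_right squarefree_mono)
    have cop: "coprime p q"
    proof (rule prime_imp_coprime)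
      show "\<not> p dvd q"
      proof
        assume "p dvd q"
        then have "p ^ 2 dvd n" using q by (simp add: power2_eq_square)
        with less.prems have "p dvd 1" by (rule squarefreeD)
        with p(1) show False by simp
      qed
    qed (rule p(1))
    have "q < n" using q n0 prime_gt_1_nat[OF p(1)] by simp
    then have "P q" using less.IH sq by blast
    then show ?thesis unfolding q using assms(3) p(1) sq cop n0 q by simp
  qed (use assms(2) in simp)
qed

lemma prime_factors_mult_coprime_prime:
  fixes p q :: nat
  assumes "prime p" "q > 0" "coprime p q"
  shows "prime_factors (p * q) = insert p (prime_factors q)" "p \<notin> prime_factors q"
    "card (prime_factors (p * q)) = Suc (card (prime_factors q))"
proof -
  show 1: "prime_factors (p * q) = insert p (prime_factors q)"
    using assms prime_factorization_prime[OF assms(1)]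
    by (subst prime_factors_product) (auto dest: prime_gt_0_nat)
  show 2: "p \<notin> prime_factors q"
  proof
    assume "p \<in> prime_factors q"
    then have "p dvd q" by auto
    then have "p dvd 1" using assms(3) by (metis coprime_absorb_left dvd_refl)
    with assms(1) show False by simp
  qed
  show "card (prime_factors (p * q)) = Suc (card (prime_factors q))" unfolding 1 using 2 by simp
qed

lemma sum_PiE_insert:
  assumes "i \<notin> K"
  shows "(\<Sum>x\<in>insert i K \<rightarrow>\<^sub>E A. g x) = (\<Sum>x\<in>K \<rightarrow>\<^sub>E A. \<Sum>u\<in>A. g (x(i := u)))"
proof -
  have "(\<Sum>x\<in>insert i K \<rightarrow>\<^sub>E A. g x) = (\<Sum>(u, x)\<in>A \<times> (K \<rightarrow>\<^sub>E A). g (x(i := u)))"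
    unfolding PiE_insert_eq by (subst sum.reindex[OF inj_combinator[OF assms]]) (simp add: case_prod_beta o_def)
  also have "\<dots> = (\<Sum>u\<in>A. \<Sum>x\<in>K \<rightarrow>\<^sub>E A. g (x(i := u)))" by (simp add: sum.cartesian_product)
  also have "\<dots> = (\<Sum>x\<in>K \<rightarrow>\<^sub>E A. \<Sum>u\<in>A. g (x(i := u)))" by (rule sum.swap)
  finally show ?thesis .
qed

lemma finite_zsum: "finite I \<Longrightarrow> finite A \<Longrightarrow> finite (zsum I A)"
  unfolding zsum_def using finite_PiE[of I "\<lambda>_. A"] by simp

lemma sum_zsum:
  assumes "finite I" "finite A"
  shows "sum g (zsum I A) = (\<Sum>x\<in>I \<rightarrow>\<^sub>E A. if (\<Sum>i\<in>I. x i) \<in> \<int> then g x else 0)"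
  unfolding zsum_def using finite_PiE[OF assms(1), of "\<lambda>_. A"] assms(2)
  by (simp add: sum.inter_filter)

text \<open>Cauchy-Schwarz. Since both projections are injective on \<open>R\<close>, each of the
  two resulting sums of squares uses every element of \<open>A\<close> at most once.\<close>

lemma sum_partial_bij_le:
  fixes f g :: "real \<Rightarrow> real"
  assumes "finite A" "finite R" "R \<subseteq> A \<times> A" "inj_on fst R" "inj_on snd R"
    "\<And>x. f x \<ge> 0" "\<And>x. g x \<ge> 0"
  shows "(\<Sum>(u, v)\<in>R. f u * g v) \<le> sqrt (\<Sum>x\<in>A. (f x)\<^sup>2) * sqrt (\<Sum>x\<in>A. (g x)\<^sup>2)"
proof -
  have "(\<Sum>(u, v)\<in>R. f u * g v) = (\<Sum>r\<in>R. \<bar>f (fst r)\<bar> * \<bar>g (snd r)\<bar>)"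
    using assms(6,7) by (simp add: case_prod_beta)
  also have "\<dots> \<le> sqrt (\<Sum>r\<in>R. (f (fst r))\<^sup>2) * sqrt (\<Sum>r\<in>R. (g (snd r))\<^sup>2)"
    using L2_set_mult_ineq[of "\<lambda>r. f (fst r)" "\<lambda>r. g (snd r)" R] unfolding L2_set_def .
  also have "\<dots> \<le> sqrt (\<Sum>x\<in>A. (f x)\<^sup>2) * sqrt (\<Sum>x\<in>A. (g x)\<^sup>2)"
  proof (intro mult_mono real_sqrt_le_mono)
    have "(\<Sum>r\<in>R. (f (fst r))\<^sup>2) = (\<Sum>x\<in>fst ` R. (f x)\<^sup>2)"
      using sum.reindex[OF assms(4), of "\<lambda>x. (f x)\<^sup>2"] by simp
    also have "\<dots> \<le> (\<Sum>x\<in>A. (f x)\<^sup>2)" using assms by (intro sum_mono2) auto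
    finally show "(\<Sum>r\<in>R. (f (fst r))\<^sup>2) \<le> (\<Sum>x\<in>A. (f x)\<^sup>2)" .
    have "(\<Sum>r\<in>R. (g (snd r))\<^sup>2) = (\<Sum>x\<in>snd ` R. (g x)\<^sup>2)"
      using sum.reindex[OF assms(5), of "\<lambda>x. (g x)\<^sup>2"] by simp
    also have "\<dots> \<le> (\<Sum>x\<in>A. (g x)\<^sup>2)" using assms by (intro sum_mono2) auto
    finally show "(\<Sum>r\<in>R. (g (snd r))\<^sup>2) \<le> (\<Sum>x\<in>A. (g x)\<^sup>2)" .
  qed (auto intro!: sum_nonneg)
  finally show ?thesis .
qed

lemma sum_le_sqrt_card:
  fixes f :: "'a \<Rightarrow> real"
  assumes "finite A" "card A \<le> p" "\<And>x. f x \<ge> 0"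
  shows "(\<Sum>x\<in>A. f x) \<le> sqrt (real p * (\<Sum>x\<in>A. (f x)\<^sup>2))"
proof -
  have "(\<Sum>x\<in>A. f x) = (\<Sum>x\<in>A. \<bar>1\<bar> * \<bar>f x\<bar>)" using assms by simp
  also have "\<dots> \<le> sqrt (\<Sum>x\<in>A. 1\<^sup>2) * sqrt (\<Sum>x\<in>A. (f x)\<^sup>2)"
    using L2_set_mult_ineq[of "\<lambda>_. 1" f A] unfolding L2_set_def .
  also have "\<dots> = sqrt (real (card A) * (\<Sum>x\<in>A. (f x)\<^sup>2))" by (simp add: real_sqrt_mult)
  also have "\<dots> \<le> sqrt (real p * (\<Sum>x\<in>A. (f x)\<^sup>2))" using assms
    by (intro real_sqrt_le_mono mult_right_mono) (auto intro: sum_nonneg)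
  finally show ?thesis .
qed

text \<open>All entries but two are summed freely, each costing a factor sqrt p over its L2 norm by
  Cauchy-Schwarz. The last two determine each other through the zero-sum condition, so they cost
  their L2 norms only; the two missing factors sqrt p are the division by p.\<close>

lemma zsum_product_bound:
  fixes g :: "nat \<Rightarrow> real \<Rightarrow> real"
  assumes "finite J" "card J \<ge> 2" "p > 0" "\<And>j x. g j x \<ge> 0"
  defines "A \<equiv> torsion p - {0}"
  shows "(\<Sum>z\<in>zsum J A. \<Prod>j\<in>J. g j (z j)) \<le> (\<Prod>j\<in>J. sqrt (real p * (\<Sum>z\<in>A. (g j z)\<^sup>2))) / real p"
proof -
  have finA: "finite A" and cardA: "card A \<le> p"
    using finite_torsion card_torsion_nonzero assms(3) by (auto simp: A_def)
  define n where "n j = sqrt (\<Sum>z\<in>A. (g j z)\<^sup>2)" for j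
  have "\<exists>i j K. J = insert i (insert j K) \<and> i \<noteq> j \<and> i \<notin> K \<and> j \<notin> K"
  proof -
    obtain i where i: "i \<in> J" using assms(2) by fastforce
    then have "card (J - {i}) \<ge> 1" using assms by (simp add: card_Diff_singleton)
    then obtain j where j: "j \<in> J - {i}" by (metis card.empty ex_in_conv not_one_le_zero)
    show ?thesis using i j by (intro exI[of _ i] exI[of _ j] exI[of _ "J - {i, j}"]) auto
  qed
  then obtain i j K where J: "J = insert i (insert j K)" and ij: "i \<noteq> j" "i \<notin> K" "j \<notin> K" by blast
  have finK: "finite K" using assms(1) J by simp
  \<comment> \<open>The admissible values of the two distinguished entries once the others are
    fixed; a partial bijection, because two nonzero p-torsion elements with integral difference
    coincide.\<close>
  define R where "R x = {(u, v). u \<in> A \<and> v \<in> A \<and> u + (v + (\<Sum>m\<in>K. x m)) \<in> \<int>}" for x :: "nat \<Rightarrow> real"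
  have RA: "R x \<subseteq> A \<times> A" for x by (auto simp: R_def)
  have finR: "finite (R x)" for x using finA RA by (meson finite_SigmaI finite_subset)
  have Rinj: "inj_on fst (R x)" "inj_on snd (R x)" for x
  proof -
    have "u = u'" if "(u, v) \<in> R x" "(u', v) \<in> R x" for u u' v
    proof (rule torsion_eqI)
      have "(u + (v + (\<Sum>m\<in>K. x m))) - (u' + (v + (\<Sum>m\<in>K. x m))) \<in> \<int>"
        using that by (intro Ints_diff) (auto simp: R_def)
      then show "u - u' \<in> \<int>" by simp
    qed (use that in \<open>auto simp: R_def A_def\<close>)
    then show "inj_on snd (R x)" by (auto intro!: inj_onI)
    have "v = v'" if "(u, v) \<in> R x" "(u, v') \<in> R x" for u v v'
    proof (rule torsion_eqI)
      have "(u + (v + (\<Sum>m\<in>K. x m))) - (u + (v' + (\<Sum>m\<in>K. x m))) \<in> \<int>"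
        using that by (intro Ints_diff) (auto simp: R_def)
      then show "v - v' \<in> \<int>" by simp
    qed (use that in \<open>auto simp: R_def A_def\<close>)
    then show "inj_on fst (R x)" by (auto intro!: inj_onI)
  qed
  have "(\<Sum>z\<in>zsum J A. \<Prod>j\<in>J. g j (z j)) = (\<Sum>x\<in>K \<rightarrow>\<^sub>E A. \<Sum>v\<in>A. \<Sum>u\<in>A.
      if u + (v + (\<Sum>m\<in>K. x m)) \<in> \<int> then g i u * (g j v * (\<Prod>m\<in>K. g m (x m))) else 0)"
  proof -
    have upd: "(\<Sum>m\<in>K. ((x(j := v))(i := u)) m) = (\<Sum>m\<in>K. x m)"
       "(\<Prod>m\<in>K. g m (((x(j := v))(i := u)) m)) = (\<Prod>m\<in>K. g m (x m))" for x and u v :: real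
      using ij by (auto intro!: sum.cong prod.cong)
    show ?thesis
      unfolding sum_zsum[OF assms(1) finA] unfolding J using ij finK
      by (subst sum_PiE_insert, simp, subst sum_PiE_insert, simp)
         (intro sum.cong refl, simp add: upd del: fun_upd_apply, simp)
  qed
  also have "\<dots> = (\<Sum>x\<in>K \<rightarrow>\<^sub>E A. (\<Prod>m\<in>K. g m (x m)) * (\<Sum>(u, v)\<in>R x. g i u * g j v))"
  proof (rule sum.cong[OF refl])
    fix x
    have "(\<Prod>m\<in>K. g m (x m)) * (\<Sum>(u, v)\<in>R x. g i u * g j v)
      = (\<Sum>r\<in>{r \<in> A \<times> A. fst r + (snd r + (\<Sum>m\<in>K. x m)) \<in> \<int>}. g i (fst r) * (g j (snd r) * (\<Prod>m\<in>K. g m (x m))))"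
      unfolding sum_distrib_left by (intro sum.cong) (auto simp: R_def)
    also have "\<dots> = (\<Sum>r\<in>A \<times> A. if fst r + (snd r + (\<Sum>m\<in>K. x m)) \<in> \<int> then g i (fst r) * (g j (snd r) * (\<Prod>m\<in>K. g m (x m))) else 0)"
      using finA by (intro sum.inter_filter) auto
    also have "\<dots> = (\<Sum>u\<in>A. \<Sum>v\<in>A. if u + (v + (\<Sum>m\<in>K. x m)) \<in> \<int> then g i u * (g j v * (\<Prod>m\<in>K. g m (x m))) else 0)"
      by (simp add: sum.cartesian_product case_prod_beta)
    also have "\<dots> = (\<Sum>v\<in>A. \<Sum>u\<in>A. if u + (v + (\<Sum>m\<in>K. x m)) \<in> \<int> then g i u * (g j v * (\<Prod>m\<in>K. g m (x m))) else 0)"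
      by (rule sum.swap)
    finally show "(\<Sum>v\<in>A. \<Sum>u\<in>A. if u + (v + (\<Sum>m\<in>K. x m)) \<in> \<int> then g i u * (g j v * (\<Prod>m\<in>K. g m (x m))) else 0)
       = (\<Prod>m\<in>K. g m (x m)) * (\<Sum>(u, v)\<in>R x. g i u * g j v)" by simp
  qed
  also have "\<dots> \<le> (\<Sum>x\<in>K \<rightarrow>\<^sub>E A. (\<Prod>m\<in>K. g m (x m)) * (n i * n j))"
    unfolding n_def using assms(4) finA finR RA Rinj
    by (intro sum_mono mult_left_mono sum_partial_bij_le prod_nonneg) auto
  also have "\<dots> = (\<Prod>m\<in>K. \<Sum>z\<in>A. g m z) * (n i * n j)"
    using prod_sum_PiE[OF finK, of "\<lambda>_. A" g] finA by (simp add: sum_distrib_right)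
  also have "\<dots> \<le> (\<Prod>m\<in>K. sqrt (real p * (\<Sum>z\<in>A. (g m z)\<^sup>2))) * (n i * n j)"
    using assms(4) finA cardA
    by (intro mult_right_mono prod_mono conjI sum_le_sqrt_card sum_nonneg) (auto simp: n_def sum_nonneg)
  also have "\<dots> = (\<Prod>j\<in>J. sqrt (real p * (\<Sum>z\<in>A. (g j z)\<^sup>2))) / real p"
  proof -
    have "real p = sqrt (real p) * sqrt (real p)" "sqrt (real p) > 0" using assms(3) by auto
    then show ?thesis
      unfolding J using ij finK assms(3) by (simp add: n_def real_sqrt_mult field_simps)
  qed
  finally show ?thesis .
qed

lemma zsum_singleton_nonzero: "zsum {i} (torsion p - {0}) = {}"
  using torsion_Ints_iff by (fastforce simp: zsum_def PiE_iff)

lemma zsum_empty: "zsum {} A = {\<lambda>_. undefined}"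
  by (auto simp: zsum_def)

lemma coprime_add_Ints:
  assumes "coprime p q" "real q * y \<in> \<int>" "real p * z \<in> \<int>" "y + z \<in> \<int>"
  shows "y \<in> \<int>" "z \<in> \<int>"
proof -
  have "real p * (y + z) - real p * z \<in> \<int>" using mult_nat_Ints[OF assms(4)] assms(3) by (rule Ints_diff)
  then have "real p * y \<in> \<int>" by (simp add: algebra_simps)
  from gcd_mult_Ints[OF this assms(2)] assms(1) show "y \<in> \<int>" by simp
  from Ints_diff[OF assms(4) this] show "z \<in> \<int>" by simp
qed

lemma sum_cen_Ints: "(\<Sum>i\<in>I. cen (f i)) - (\<Sum>i\<in>I. f i) \<in> \<int>"
  unfolding sum_subtractf[symmetric] by (intro Ints_sum cen_diff_Ints')

text \<open>The splitting is applied entry by entry. The zero-sum condition splits as well: if a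
  q-torsion number and a p-torsion number add up to an integer, both are integers.\<close>

lemma sum_zsum_coprime:
  assumes "p > 0" "q > 0" "coprime p q"
  shows "(\<Sum>x\<in>zsum I (torsion (p * q)). \<Prod>i\<in>I. H i (x i))
    = (\<Sum>y\<in>zsum I (torsion q). \<Sum>z\<in>zsum I (torsion p). \<Prod>i\<in>I. H i (cen (y i + z i)))"
proof -
  define F where "F = (\<lambda>(y, z). cen (y + z))"
  define G where "G = inv_into (torsion q \<times> torsion p) F"
  note bij = torsion_coprime_bij[OF assms, folded F_def]
  have GF: "G (cen (y + z)) = (y, z)" if "y \<in> torsion q" "z \<in> torsion p" for y z
    using bij_betw_inv_into_left[OF bij, of "(y, z)"] that by (simp add: G_def F_def)
  have FG: "cen (fst (G x) + snd (G x)) = x" if "x \<in> torsion (p * q)" for x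
    using bij_betw_inv_into_right[OF bij that] by (simp add: G_def F_def case_prod_beta)
  have Gm: "fst (G x) \<in> torsion q" "snd (G x) \<in> torsion p" if "x \<in> torsion (p * q)" for x
    using bij_betw_apply[OF bij_betw_inv_into[OF bij] that] by (auto simp: G_def)
  have Fm: "cen (y + z) \<in> torsion (p * q)" if "y \<in> torsion q" "z \<in> torsion p" for y z
    using bij_betw_apply[OF bij, of "(y, z)"] that by (simp add: F_def)
  define \<phi> where "\<phi> = (\<lambda>r :: (nat \<Rightarrow> real) \<times> (nat \<Rightarrow> real). \<lambda>i\<in>I. cen (fst r i + snd r i))"
  define \<psi> where "\<psi> = (\<lambda>x :: nat \<Rightarrow> real. (\<lambda>i\<in>I. fst (G (x i)), \<lambda>i\<in>I. snd (G (x i))))"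
  have "(\<Sum>r\<in>zsum I (torsion q) \<times> zsum I (torsion p). \<Prod>i\<in>I. H i (cen (fst r i + snd r i)))
     = (\<Sum>x\<in>zsum I (torsion (p * q)). \<Prod>i\<in>I. H i (x i))"
  proof (rule sum.reindex_bij_witness[where j = \<phi> and i = \<psi>])
    fix r assume r: "r \<in> zsum I (torsion q) \<times> zsum I (torsion p)"
    obtain y z where yzr: "r = (y, z)" by (cases r)
    have yz: "y \<in> zsum I (torsion q)" "z \<in> zsum I (torsion p)" using r yzr by auto
    show "\<psi> (\<phi> r) = r"
      using yz by (auto simp: yzr \<phi>_def \<psi>_def zsum_def PiE_iff GF extensional_def)
    have "(\<Sum>i\<in>I. y i) + (\<Sum>i\<in>I. z i) \<in> \<int>" using yz by (intro Ints_add) (auto simp: zsum_def)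
    then have "(\<Sum>i\<in>I. cen (y i + z i)) \<in> \<int>"
      using Ints_cong[OF sum_cen_Ints[where f = "\<lambda>i. y i + z i"]] by (simp add: sum.distrib)
    then show "\<phi> r \<in> zsum I (torsion (p * q))"
      using yz by (auto simp: yzr \<phi>_def zsum_def PiE_iff Fm)
    show "(\<Prod>i\<in>I. H i (\<phi> r i)) = (\<Prod>i\<in>I. H i (cen (fst r i + snd r i)))" by (simp add: \<phi>_def)
  next
    fix x assume x: "x \<in> zsum I (torsion (p * q))"
    then have xm: "x i \<in> torsion (p * q)" if "i \<in> I" for i using that by (auto simp: zsum_def)
    show "\<phi> (\<psi> x) = x"
      using x by (auto simp: \<phi>_def \<psi>_def zsum_def PiE_iff FG extensional_def)
    let ?y = "\<Sum>i\<in>I. fst (G (x i))" and ?z = "\<Sum>i\<in>I. snd (G (x i))"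
    have "(\<Sum>i\<in>I. cen (fst (G (x i)) + snd (G (x i)))) = (\<Sum>i\<in>I. x i)"
      using xm by (intro sum.cong) (auto simp: FG)
    then have "?y + ?z \<in> \<int>" using x
      Ints_cong[OF sum_cen_Ints[where f = "\<lambda>i. fst (G (x i)) + snd (G (x i))" and I = I]]
      by (simp add: sum.distrib zsum_def)
    moreover have "real q * ?y \<in> \<int>" "real p * ?z \<in> \<int>"
      unfolding sum_distrib_left using Gm xm by (auto intro!: Ints_sum torsion_Ints)
    ultimately have "?y \<in> \<int>" "?z \<in> \<int>" using coprime_add_Ints[OF assms(3)] by blast+
    then show "\<psi> x \<in> zsum I (torsion q) \<times> zsum I (torsion p)"
      using Gm xm by (auto simp: \<psi>_def zsum_def)
  qed
  then show ?thesis by (simp add: sum.cartesian_product case_prod_beta)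
qed

text \<open>Tuples are grouped by the set \<open>J\<close> of indices with nonzero p-component.
  \<open>J = {}\<close> leaves the tuple unchanged, a singleton \<open>J\<close> is impossible since
  its only entry would have to vanish, and for larger \<open>J\<close> the bound for nonzero
  p-torsion applies. The numbers \<open>b i\<close> cancel; they are inserted as the normalisation
  wanted by the induction over primes.\<close>

lemma zsum_local_bound:
  fixes H :: "nat \<Rightarrow> real \<Rightarrow> real"
  assumes "p > 0" "finite I" "\<And>i x. H i x \<ge> 0" "\<And>i. i \<in> I \<Longrightarrow> b i > 0" "\<And>i. i \<in> I \<Longrightarrow> cen (y i) = y i"
  defines "A \<equiv> torsion p - {0}"
  defines "c \<equiv> \<lambda>J. if J = {} then 1 else if card J = 1 then 0 else (\<Prod>j\<in>J. b j) / real p"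
  shows "(\<Sum>z\<in>zsum I (torsion p). \<Prod>i\<in>I. H i (cen (y i + z i)))
    \<le> (\<Sum>J\<in>Pow I. c J * (\<Prod>i\<in>I. if i \<in> J then sqrt (real p * (\<Sum>z\<in>A. (H i (cen (y i + z)))\<^sup>2)) / b i else H i (y i)))"
proof -
  have fin: "finite (zsum I (torsion p))" using assms by (simp add: finite_zsum finite_torsion)
  let ?g = "\<lambda>z. \<Prod>i\<in>I. H i (cen (y i + z i))"
  let ?n = "\<lambda>i. sqrt (real p * (\<Sum>z\<in>A. (H i (cen (y i + z)))\<^sup>2))"
  have "sum ?g (zsum I (torsion p))
     = (\<Sum>J\<in>Pow I. sum ?g {z. z \<in> zsum I (torsion p) \<and> {i \<in> I. z i \<noteq> 0} = J})"
    by (rule sum.group[symmetric, OF fin]) (use assms in auto)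
  also have "\<dots> \<le> (\<Sum>J\<in>Pow I. c J * (\<Prod>i\<in>I. if i \<in> J then ?n i / b i else H i (y i)))"
  proof (rule sum_mono)
    fix J assume "J \<in> Pow I"
    then have J: "J \<subseteq> I" by simp
    have finJ: "finite J" using J assms(2) finite_subset by blast
    have split: "(\<Prod>i\<in>I. f i) = (\<Prod>i\<in>J. f i) * (\<Prod>i\<in>I - J. f i)" for f :: "nat \<Rightarrow> real"
      using prod.subset_diff[OF J assms(2)] by (simp add: mult.commute)
    have "sum ?g {z. z \<in> zsum I (torsion p) \<and> {i \<in> I. z i \<noteq> 0} = J}
      = (\<Sum>w\<in>zsum J A. (\<Prod>j\<in>J. H j (cen (y j + w j))) * (\<Prod>i\<in>I - J. H i (y i)))"
    proof (rule sum.reindex_bij_witness[where j = "\<lambda>z. restrict z J" and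
          i = "\<lambda>w. \<lambda>i\<in>I. if i \<in> J then w i else 0"])
      fix z assume "z \<in> {z. z \<in> zsum I (torsion p) \<and> {i \<in> I. z i \<noteq> 0} = J}"
      then have z: "z \<in> zsum I (torsion p)" and Jz: "J = {i \<in> I. z i \<noteq> 0}" by auto
      show "(\<lambda>i\<in>I. if i \<in> J then restrict z J i else 0) = z"
        using z by (auto simp: Jz zsum_def PiE_iff extensional_def)
      have "(\<Sum>i\<in>J. z i) = (\<Sum>i\<in>I. z i)"
        by (rule sum.mono_neutral_left) (use assms in \<open>auto simp: Jz\<close>)
      then show "restrict z J \<in> zsum J A"
        using z by (auto simp: zsum_def A_def Jz)
      have "?g z = (\<Prod>j\<in>J. H j (cen (y j + z j))) * (\<Prod>i\<in>I - J. H i (cen (y i + z i)))"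
        by (rule split)
      also have "\<dots> = (\<Prod>j\<in>J. H j (cen (y j + restrict z J j))) * (\<Prod>i\<in>I - J. H i (y i))"
        by (intro arg_cong2[where f = "(*)"] prod.cong) (auto simp: Jz assms(5))
      finally show "(\<Prod>j\<in>J. H j (cen (y j + restrict z J j))) * (\<Prod>i\<in>I - J. H i (y i)) = ?g z"
        by simp
    next
      fix w assume w: "w \<in> zsum J A"
      show "restrict (\<lambda>i\<in>I. if i \<in> J then w i else 0) J = w"
        using w J by (auto simp: zsum_def PiE_iff extensional_def fun_eq_iff)
      have "(\<Sum>i\<in>I. (\<lambda>i\<in>I. if i \<in> J then w i else 0) i) = (\<Sum>i\<in>J. w i)"
        using J assms(2) by (simp add: sum.If_cases Int_absorb1)
      then have 1: "(\<lambda>i\<in>I. if i \<in> J then w i else 0) \<in> zsum I (torsion p)"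
        using w by (auto simp: zsum_def A_def)
      have 2: "{i \<in> I. (\<lambda>i\<in>I. if i \<in> J then w i else 0) i \<noteq> 0} = J"
        using w J by (auto simp: zsum_def A_def PiE_iff subset_iff)
      show "(\<lambda>i\<in>I. if i \<in> J then w i else 0) \<in> {z. z \<in> zsum I (torsion p) \<and> {i \<in> I. z i \<noteq> 0} = J}"
        using 1 2 by blast
    qed
    also have "\<dots> = (\<Sum>w\<in>zsum J A. \<Prod>j\<in>J. H j (cen (y j + w j))) * (\<Prod>i\<in>I - J. H i (y i))"
      by (simp add: sum_distrib_right)
    also have "\<dots> \<le> (c J * (\<Prod>j\<in>J. ?n j / b j)) * (\<Prod>i\<in>I - J. H i (y i))"
    proof (rule mult_right_mono)
      consider "J = {}" | "card J = 1" | "card J \<ge> 2"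
        using finJ by (cases "card J") (auto simp: Suc_le_eq)
      then show "(\<Sum>w\<in>zsum J A. \<Prod>j\<in>J. H j (cen (y j + w j))) \<le> c J * (\<Prod>j\<in>J. ?n j / b j)"
      proof cases
        case 1 then show ?thesis by (simp add: zsum_empty c_def)
      next
        case 2 then obtain i where "J = {i}" by (auto simp: card_1_singleton_iff)
        then show ?thesis by (simp add: A_def zsum_singleton_nonzero c_def)
      next
        case 3
        have b0: "(\<Prod>j\<in>J. b j) > 0" using assms(4) J by (intro prod_pos) auto
        have "(\<Sum>w\<in>zsum J A. \<Prod>j\<in>J. H j (cen (y j + w j))) \<le> (\<Prod>j\<in>J. ?n j) / real p"
          unfolding A_def using zsum_product_bound[OF finJ 3 assms(1), of "\<lambda>j w. H j (cen (y j + w))"] assms(3) by simp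
        also have "\<dots> = c J * (\<Prod>j\<in>J. ?n j / b j)"
          using 3 b0 by (auto simp: c_def prod_dividef)
        finally show ?thesis .
      qed
    qed (use assms(3) in \<open>auto intro: prod_nonneg\<close>)
    also have "\<dots> = c J * (\<Prod>i\<in>I. if i \<in> J then ?n i / b i else H i (y i))"
      unfolding split mult.assoc by (intro arg_cong2[where f = "(*)"] prod.cong refl) auto
    finally show "sum ?g {z. z \<in> zsum I (torsion p) \<and> {i \<in> I. z i \<noteq> 0} = J}
      \<le> c J * (\<Prod>i\<in>I. if i \<in> J then ?n i / b i else H i (y i))" .
  qed
  finally show ?thesis .
qed

lemma sum_Pow_card_split:
  fixes w :: "nat set \<Rightarrow> real"
  assumes "finite I"
  shows "(\<Sum>J\<in>Pow I. if J = {} then 1 else if card J = 1 then 0 else w J)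
     = 1 + (\<Sum>J\<in>{J. J \<subseteq> I \<and> card J \<ge> 2}. w J)"
proof -
  have "(\<Sum>J\<in>Pow I. if J = {} then 1 else if card J = 1 then 0 else w J)
     = 1 + (\<Sum>J\<in>Pow I - {{}}. if J = {} then 1 else if card J = 1 then 0 else w J)"
    using assms by (subst sum.remove[of _ "{}"]) auto
  also have "(\<Sum>J\<in>Pow I - {{}}. if J = {} then 1 else if card J = 1 then 0 else w J)
     = (\<Sum>J\<in>{J. J \<subseteq> I \<and> card J \<ge> 2}. w J)"
  proof (rule sum.mono_neutral_cong_right)
    show "\<forall>J\<in>Pow I - {{}} - {J. J \<subseteq> I \<and> 2 \<le> card J}. (if J = {} then 1 else if card J = 1 then 0 else w J) = 0"
    proof
      fix J assume J: "J \<in> Pow I - {{}} - {J. J \<subseteq> I \<and> 2 \<le> card J}"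
      then have "finite J" "J \<noteq> {}" "\<not> card J \<ge> 2" using assms by (auto intro: finite_subset)
      then have "card J = 1" using card_gt_0_iff[of J] by linarith
      then show "(if J = {} then 1 else if card J = 1 then 0 else w J) = 0" using J by simp
    qed
  qed (use assms in auto)
  finally show ?thesis .
qed

text \<open>In the induction, an index \<open>i\<close> whose \<open>p\<close>-component does not vanish has its function replaced by
  the \<open>L\<^sup>2\<close>-norm over that component, normalised so that the hypothesis carries over to \<open>q\<close>;
  a zero sum needs no such index or at least two of them.\<close>

theorem fundamental_lemma:
  fixes H :: "nat \<Rightarrow> real \<Rightarrow> real" and N b :: "nat \<Rightarrow> real"
  assumes "squarefree q" "finite I" and b: "\<And>i. i \<in> I \<Longrightarrow> b i > 0" and N: "\<And>i. i \<in> I \<Longrightarrow> N i \<ge> 0"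
    and "\<And>i x. H i x \<ge> 0"
    and "\<And>i d. i \<in> I \<Longrightarrow> d dvd q \<Longrightarrow>
      real d * (\<Sum>x\<in>{x \<in> torsion q. den x = d}. (H i x)\<^sup>2) \<le> (N i)\<^sup>2 * (b i) ^ (2 * card (prime_factors d))"
  shows "(\<Sum>x\<in>zsum I (torsion q). \<Prod>i\<in>I. H i (x i))
    \<le> (\<Prod>i\<in>I. N i) * (\<Prod>p\<in>prime_factors q. 1 + (\<Sum>J\<in>{J. J \<subseteq> I \<and> card J \<ge> 2}. \<Prod>j\<in>J. b j) / real p)"
  using assms(1,5,6)
proof (induction q arbitrary: H rule: squarefree_induct)
  case (one H)
  have eq: "zsum I (torsion 1) = {\<lambda>i\<in>I. 0}"
    by (auto simp: zsum_def torsion_1 PiE_iff extensional_def)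
  have "(\<Prod>i\<in>I. H i 0) \<le> (\<Prod>i\<in>I. N i)"
  proof (rule prod_mono, safe)
    fix i assume i: "i \<in> I"
    have "{x \<in> torsion 1. den x = 1} = {0}" by (auto simp: torsion_1)
    then have "(H i 0)\<^sup>2 \<le> (N i)\<^sup>2" using one(2)[OF i, of 1] by simp
    then show "H i 0 \<le> N i" by (rule power2_le_imp_le) (rule N[OF i])
  qed (use one in auto)
  then show ?case unfolding eq by simp
next
  case (mult p q H)
  have p0: "p > 0" using mult.hyps prime_gt_0_nat by blast
  note pf = prime_factors_mult_coprime_prime[OF mult.hyps(1,3,4)]
  define A where "A = torsion p - {0}"
  define m where "m = (\<Sum>J\<in>{J. J \<subseteq> I \<and> card J \<ge> 2}. \<Prod>j\<in>J. b j)"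
  define c where "c = (\<lambda>J. if J = {} then 1 else if card J = 1 then 0 else (\<Prod>j\<in>J. b j) / real p)"
  \<comment> \<open>The guard \<open>i \<in> I\<close> keeps \<open>H'\<close> nonnegative for every
    index, since the sign of \<open>b i\<close> is known only on \<open>I\<close>.\<close>
  define H' where "H' = (\<lambda>J i y. if i \<in> J \<and> i \<in> I then sqrt (real p * (\<Sum>z\<in>A. (H i (cen (y + z)))\<^sup>2)) / b i else H i y)"
  define M where "M = (\<Prod>i\<in>I. N i) * (\<Prod>p\<in>prime_factors q. 1 + m / real p)"
  note bij = torsion_coprime_bij[OF p0 mult.hyps(3,4)]
  have c0: "c J \<ge> 0" if "J \<subseteq> I" for J
    unfolding c_def using b that by (auto intro!: divide_nonneg_nonneg prod_nonneg simp: less_imp_le subset_iff)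
  have den_yz: "den (cen (y + z)) = den y * p" if "y \<in> torsion q" "z \<in> A" for y z
  proof -
    have z: "z \<in> torsion p" "den z = p" using that den_torsion_prime[OF mult.hyps(1)] by (auto simp: A_def)
    have "den y dvd q" using den_dvd mult.hyps that by blast
    then have "coprime (den y) (den z)" using mult.hyps(4) z
      by (metis coprime_commute coprime_divisors dvd_refl)
    then show ?thesis using den_add_coprime[OF mult.hyps(3) torsion_Ints[OF that(1)] p0 torsion_Ints[OF z(1)]] z
      by simp
  qed
  have IH: "(\<Sum>y\<in>zsum I (torsion q). \<Prod>i\<in>I. H' J i (y i)) \<le> M" if J: "J \<subseteq> I" for J
    unfolding M_def m_def
  proof (rule mult.IH)
    show "H' J i x \<ge> 0" for i x
      using mult.prems(1) b[of i] by (auto simp: H'_def less_imp_le intro!: divide_nonneg_nonneg mult_nonneg_nonneg sum_nonneg)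
  next
    fix i d assume i: "i \<in> I" and d: "d dvd q"
    have d0: "d > 0" using d mult.hyps by (meson dvd_pos_nat)
    show "real d * (\<Sum>x\<in>{x \<in> torsion q. den x = d}. (H' J i x)\<^sup>2) \<le> (N i)\<^sup>2 * b i ^ (2 * card (prime_factors d))"
    proof (cases "i \<in> J")
      case True
      have cop: "coprime p d" using mult.hyps(4) d by (metis coprime_divisors dvd_refl)
      \<comment> \<open>Level d of \<open>H' J i\<close> collects level p d of \<open>H i\<close>.
        The hypothesis at p d has one more factor \<open>(b i)^2\<close> and one more factor p on
        the left, exactly what the normalisation by \<open>sqrt p / b i\<close> consumes.\<close>
      have "bij_betw (\<lambda>(y, z). cen (y + z)) ({x \<in> torsion q. den x = d} \<times> A) {x \<in> torsion (p * q). den x = p * d}"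
      proof (rule bij_betw_subset[OF bij])
        show "{x \<in> torsion q. den x = d} \<times> A \<subseteq> torsion q \<times> torsion p" by (auto simp: A_def)
        show "(\<lambda>(y, z). cen (y + z)) ` ({x \<in> torsion q. den x = d} \<times> A) = {x \<in> torsion (p * q). den x = p * d}"
        proof (intro equalityI subsetI)
          fix x assume "x \<in> (\<lambda>(y, z). cen (y + z)) ` ({x \<in> torsion q. den x = d} \<times> A)"
          then obtain y z where yz: "y \<in> torsion q" "den y = d" "z \<in> A" "x = cen (y + z)" by auto
          then show "x \<in> {x \<in> torsion (p * q). den x = p * d}"
            using den_yz[of y z] bij_betw_apply[OF bij, of "(y, z)"] by (auto simp: A_def)
        next
          fix x assume x: "x \<in> {x \<in> torsion (p * q). den x = p * d}"
          then have "x \<in> (\<lambda>(y, z). cen (y + z)) ` (torsion q \<times> torsion p)"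
            unfolding bij_betw_imp_surj_on[OF bij] by simp
          then obtain y z where yz: "y \<in> torsion q" "z \<in> torsion p" "x = cen (y + z)" by auto
          have "z \<noteq> 0"
          proof
            assume "z = 0"
            then have "den y = p * d" using x yz by simp
            moreover have "den y dvd q" using den_dvd mult.hyps yz by blast
            ultimately have "p dvd q" by (metis dvd_mult_left)
            then have "p dvd 1" using mult.hyps(4) by (metis coprime_absorb_left dvd_refl)
            then show False using mult.hyps(1) by simp
          qed
          then have zA: "z \<in> A" using yz by (simp add: A_def)
          then have "den y * p = p * d" using den_yz[OF yz(1) zA] x yz by simp
          then have "den y = d" using p0 by simp
          then show "x \<in> (\<lambda>(y, z). cen (y + z)) ` ({x \<in> torsion q. den x = d} \<times> A)"
            using yz zA by (intro image_eqI[of _ _ "(y, z)"]) auto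
        qed
      qed
      then have "(\<Sum>r\<in>{x \<in> torsion q. den x = d} \<times> A. (H i ((\<lambda>(y, z). cen (y + z)) r))\<^sup>2)
           = (\<Sum>x\<in>{x \<in> torsion (p * q). den x = p * d}. (H i x)\<^sup>2)"
        by (rule sum.reindex_bij_betw)
      then have eq: "(\<Sum>y\<in>{x \<in> torsion q. den x = d}. \<Sum>z\<in>A. (H i (cen (y + z)))\<^sup>2)
           = (\<Sum>x\<in>{x \<in> torsion (p * q). den x = p * d}. (H i x)\<^sup>2)"
        by (simp add: sum.cartesian_product case_prod_beta)
      have "(\<Sum>x\<in>{x \<in> torsion q. den x = d}. (H' J i x)\<^sup>2)
          = (\<Sum>x\<in>{x \<in> torsion q. den x = d}. real p / (b i)\<^sup>2 * (\<Sum>z\<in>A. (H i (cen (x + z)))\<^sup>2))"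
        using True i by (intro sum.cong refl) (simp add: H'_def power_divide sum_nonneg)
      also have "\<dots> = real p / (b i)\<^sup>2 * (\<Sum>x\<in>{x \<in> torsion (p * q). den x = p * d}. (H i x)\<^sup>2)"
        unfolding sum_distrib_left[symmetric] eq ..
      finally have "real d * (\<Sum>x\<in>{x \<in> torsion q. den x = d}. (H' J i x)\<^sup>2)
          = real (p * d) * (\<Sum>x\<in>{x \<in> torsion (p * q). den x = p * d}. (H i x)\<^sup>2) / (b i)\<^sup>2"
        by (simp add: field_simps)
      also have "\<dots> \<le> (N i)\<^sup>2 * b i ^ (2 * card (prime_factors (p * d))) / (b i)\<^sup>2"
        using mult.prems(2)[OF i, of "p * d"] d by (intro divide_right_mono) auto
      also have "\<dots> = (N i)\<^sup>2 * b i ^ (2 * card (prime_factors d))"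
        using prime_factors_mult_coprime_prime(3)[OF mult.hyps(1) d0 cop] b[OF i]
        by (simp add: power_add power2_eq_square)
      finally show ?thesis .
    next
      case False
      have "{x \<in> torsion q. den x = d} = {x \<in> torsion (p * q). den x = d}"
        using torsion_mono[of q "p * q"] in_torsion_den_dvd_iff[of "p * q" _ q] mult.hyps(3) p0 d by auto
      then show ?thesis using mult.prems(2)[OF i, of d] d False by (simp add: H'_def)
    qed
  qed
  have "(\<Sum>x\<in>zsum I (torsion (p * q)). \<Prod>i\<in>I. H i (x i))
     = (\<Sum>y\<in>zsum I (torsion q). \<Sum>z\<in>zsum I (torsion p). \<Prod>i\<in>I. H i (cen (y i + z i)))"
    by (rule sum_zsum_coprime[OF p0 mult.hyps(3,4)])
  also have "\<dots> \<le> (\<Sum>y\<in>zsum I (torsion q). \<Sum>J\<in>Pow I. c J * (\<Prod>i\<in>I. H' J i (y i)))"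
  proof (rule sum_mono)
    fix y assume y: "y \<in> zsum I (torsion q)"
    then have cy: "cen (y i) = y i" if "i \<in> I" for i using that by (auto simp: zsum_def intro: cen_torsion)
    have "(\<Sum>z\<in>zsum I (torsion p). \<Prod>i\<in>I. H i (cen (y i + z i)))
      \<le> (\<Sum>J\<in>Pow I. c J * (\<Prod>i\<in>I. if i \<in> J then sqrt (real p * (\<Sum>z\<in>A. (H i (cen (y i + z)))\<^sup>2)) / b i else H i (y i)))"
      unfolding c_def A_def by (rule zsum_local_bound[OF p0 assms(2)]) (use mult.prems(1) b cy in auto)
    also have "\<dots> = (\<Sum>J\<in>Pow I. c J * (\<Prod>i\<in>I. H' J i (y i)))"
      by (intro sum.cong refl arg_cong2[where f = "(*)"] prod.cong) (auto simp: H'_def)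
    finally show "(\<Sum>z\<in>zsum I (torsion p). \<Prod>i\<in>I. H i (cen (y i + z i))) \<le> \<dots>" .
  qed
  also have "\<dots> = (\<Sum>J\<in>Pow I. c J * (\<Sum>y\<in>zsum I (torsion q). \<Prod>i\<in>I. H' J i (y i)))"
    by (subst sum.swap) (simp add: sum_distrib_left)
  also have "\<dots> \<le> (\<Sum>J\<in>Pow I. c J * M)"
    using IH c0 by (intro sum_mono mult_left_mono) auto
  \<comment> \<open>Summing \<open>c J\<close> over all \<open>J\<close> produces precisely the
    Euler factor at p.\<close>
  also have "\<dots> = (1 + m / real p) * M"
    using sum_Pow_card_split[OF assms(2), of "\<lambda>J. (\<Prod>j\<in>J. b j) / real p"]
    by (simp add: sum_distrib_right[symmetric] c_def m_def sum_divide_distrib)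
  also have "\<dots> = (\<Prod>i\<in>I. N i) * (\<Prod>p\<in>prime_factors (p * q). 1 + m / real p)"
    unfolding pf(1) M_def using pf(2) by simp
  finally show ?case by (simp add: m_def)
qed

section \<open>Arithmetic of squarefree numbers\<close>

definition Phi :: "nat \<Rightarrow> real" where
  "Phi q = real q / real (totient q)"

lemma Phi_1 [simp]: "Phi (Suc 0) = 1"
  by (simp add: Phi_def)

lemma Phi_mult_coprime_prime:
  assumes "prime p" "coprime p q"
  shows "Phi (p * q) = (1 + 1 / (real p - 1)) * Phi q"
proof -
  have 1: "real p > 1" using prime_gt_1_nat[OF assms(1)] by simp
  have "Phi (p * q) = (real p / real (totient p)) * Phi q"
    unfolding Phi_def totient_mult_coprime[OF assms(2)] by simp
  also have "real (totient p) = real p - 1"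
    using totient_prime[OF assms(1)] prime_ge_1_nat[OF assms(1)] by (simp add: of_nat_diff)
  also have "real p / (real p - 1) = 1 + 1 / (real p - 1)" using 1 by (simp add: field_simps)
  finally show ?thesis .
qed

lemma Phi_ge_1:
  assumes "q > 0" shows "Phi q \<ge> 1"
  using assms totient_le[of q] totient_gt_0_iff[of q] by (simp add: Phi_def)

text \<open>Prime by prime this is Bernoulli's inequality: 1 + m/p \<le> 1 + m/(p-1) \<le> (1 +
  1/(p-1))^m, and the product of the brackets is \<open>Phi q\<close>.\<close>

lemma prod_prime_factors_le_Phi_power:
  assumes "squarefree q"
  shows "(\<Prod>p\<in>prime_factors q. 1 + real m / real p) \<le> Phi q ^ m"
  using assms
proof (induction q rule: squarefree_induct)
  case (mult p q)
  note pf = prime_factors_mult_coprime_prime[OF mult.hyps(1,3,4)]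
  have p1: "real p > 1" using prime_gt_1_nat[OF mult.hyps(1)] by simp
  have "1 + real m / real p \<le> 1 + real m * (1 / (real p - 1))"
    using p1 by (simp add: frac_le)
  also have "\<dots> \<le> (1 + 1 / (real p - 1)) ^ m"
  proof -
    have "0 \<le> 1 / (real p - 1)" using p1 by simp
    then show ?thesis by (intro Bernoulli_inequality) linarith
  qed
  finally have "(1 + real m / real p) * (\<Prod>p\<in>prime_factors q. 1 + real m / real p)
      \<le> (1 + 1 / (real p - 1)) ^ m * Phi q ^ m"
    using mult.IH p1 by (intro mult_mono prod_nonneg) auto
  then show ?case unfolding pf(1) using pf(2)
    by (simp add: Phi_mult_coprime_prime[OF mult.hyps(1,4)] power_mult_distrib)
qed simp

lemma divisors_mult_coprime_prime:
  fixes p q :: nat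
  assumes "prime p" "q > 0" "coprime p q"
  shows "{t. t dvd p * q} = {t. t dvd q} \<union> (*) p ` {t. t dvd q}"
    "{t. t dvd q} \<inter> (*) p ` {t. t dvd q} = {}"
proof -
  have npq: "\<not> p dvd q" using assms(1,3) by (metis coprime_absorb_left not_prime_unit)
  show "{t. t dvd q} \<inter> (*) p ` {t. t dvd q} = {}" using npq by (auto dest: dvd_mult_left)
  show "{t. t dvd p * q} = {t. t dvd q} \<union> (*) p ` {t. t dvd q}"
  proof (intro equalityI subsetI)
    fix t assume t: "t \<in> {t. t dvd p * q}"
    show "t \<in> {t. t dvd q} \<union> (*) p ` {t. t dvd q}"
    proof (cases "p dvd t")
      case True
      then obtain t' where "t = p * t'" by auto
      then show ?thesis using t prime_gt_0_nat[OF assms(1)] by auto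
    next
      case False
      then have "coprime t p" using assms(1) by (metis coprime_commute prime_imp_coprime)
      then show ?thesis using t by (simp add: coprime_dvd_mult_right_iff)
    qed
  qed (auto intro: dvd_mult)
qed

text \<open>For squarefree q the left side is the product of 1 + 1/p over the primes of q, while
  \<open>Phi q\<close> is the product of 1 + 1/(p-1).\<close>

lemma sum_divisors_inverse_le_Phi:
  assumes "squarefree q"
  shows "(\<Sum>t\<in>{t. t dvd q}. 1 / real t) \<le> Phi q"
  using assms
proof (induction q rule: squarefree_induct)
  case one
  have "{t::nat. t dvd 1} = {1}" by auto
  then show ?case by simp
next
  case (mult p q)
  note dv = divisors_mult_coprime_prime[OF mult.hyps(1,3,4)]
  have fin: "finite {t. t dvd q}" using mult.hyps by simp
  have p1: "real p > 1" using prime_gt_1_nat[OF mult.hyps(1)] by simp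
  have "(\<Sum>t\<in>{t. t dvd p * q}. 1 / real t)
      = (\<Sum>t\<in>{t. t dvd q}. 1 / real t) + (\<Sum>t\<in>(*) p ` {t. t dvd q}. 1 / real t)"
    unfolding dv(1) using fin dv(2) by (intro sum.union_disjoint) auto
  also have "(\<Sum>t\<in>(*) p ` {t. t dvd q}. 1 / real t) = (\<Sum>t\<in>{t. t dvd q}. 1 / real p * (1 / real t))"
    using p1 by (subst sum.reindex) (auto simp: inj_on_def)
  also have "\<dots> = 1 / real p * (\<Sum>t\<in>{t. t dvd q}. 1 / real t)" by (rule sum_distrib_left[symmetric])
  also have "(\<Sum>t\<in>{t. t dvd q}. 1 / real t) + \<dots> = (1 + 1 / real p) * (\<Sum>t\<in>{t. t dvd q}. 1 / real t)"
    by (simp add: algebra_simps)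
  also have "\<dots> \<le> (1 + 1 / (real p - 1)) * Phi q"
    using mult.IH p1 by (intro mult_mono) (auto simp: frac_le intro!: sum_nonneg)
  finally show ?case by (simp add: Phi_mult_coprime_prime[OF mult.hyps(1,4)])
qed

text \<open>A squarefree q = d e has coprime factors, so \<open>Phi\<close> splits multiplicatively,
  and \<open>Phi e\<close> is at least 1.\<close>

lemma Phi_mono_dvd:
  assumes "squarefree q" "d dvd q"
  shows "Phi d \<le> Phi q"
proof -
  obtain e where e: "q = d * e" using assms by auto
  have q0: "q > 0" using assms by (cases q) auto
  have "coprime d e"
  proof (rule coprimeI)
    fix c assume "c dvd d" "c dvd e"
    then have "c ^ 2 dvd q" unfolding e power2_eq_square by (rule mult_dvd_mono)
    then show "is_unit c" by (rule squarefreeD[OF assms(1)])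
  qed
  then have "Phi q = Phi d * Phi e" unfolding e by (simp add: Phi_def totient_mult_coprime)
  moreover have "Phi e \<ge> 1" "Phi d \<ge> 1" using q0 e by (auto intro!: Phi_ge_1)
  ultimately show ?thesis using mult_left_mono[of 1 "Phi e" "Phi d"] by simp
qed

text \<open>Each prime of the squarefree e goes to u, to v or to neither.\<close>

lemma card_coprime_splittings:
  fixes e :: nat
  assumes "squarefree e"
  shows "finite {(u, v). u * v dvd e}" "card {(u, v). u * v dvd e} \<le> 3 ^ card (prime_factors e)"
proof -
  have "finite {(u, v). u * v dvd e} \<and> card {(u, v). u * v dvd e} \<le> 3 ^ card (prime_factors e)"
    using assms
  proof (induction e rule: squarefree_induct)
    case one
    have "{(u, v). u * v dvd (1::nat)} = {(1, 1)}" by auto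
    then show ?case by simp
  next
    case (mult p q)
    let ?D = "{(u, v). u * v dvd q}"
    let ?f = "\<lambda>(u, v). (p * u, v)" and ?g = "\<lambda>(u, v). (u, p * v)"
    have p0: "p > 0" using mult.hyps prime_gt_0_nat by blast
    have sub: "{(u, v). u * v dvd p * q} \<subseteq> ?D \<union> (?f ` ?D \<union> ?g ` ?D)"
    proof clarify
      fix u v assume uv: "u * v dvd p * q" "(u, v) \<notin> ?g ` ?D" "(u, v) \<notin> ?f ` ?D"
      show "u * v dvd q"
      proof (cases "p dvd u * v")
        case True
        then have "p dvd u \<or> p dvd v" using mult.hyps(1) by (simp add: prime_dvd_mult_iff)
        then show ?thesis
        proof
          assume "p dvd u"
          then obtain u' where u': "u = p * u'" by auto
          then have "u' * v dvd q" using uv(1) p0 by (simp add: mult.assoc)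
          then have "(u, v) \<in> ?f ` ?D" using u' by force
          with uv show ?thesis by blast
        next
          assume "p dvd v"
          then obtain v' where v': "v = p * v'" by auto
          then have "u * v' dvd q" using uv(1) p0 by (simp add: mult.left_commute)
          then have "(u, v) \<in> ?g ` ?D" using v' by force
          with uv show ?thesis by blast
        qed
      next
        case False
        then have "coprime (u * v) p" using mult.hyps(1) by (metis coprime_commute prime_imp_coprime)
        then show ?thesis using uv(1) by (metis coprime_dvd_mult_right_iff)
      qed
    qed
    have fin: "finite ?D" using mult.IH by blast
    have "card {(u, v). u * v dvd p * q} \<le> card (?D \<union> (?f ` ?D \<union> ?g ` ?D))"
      by (rule card_mono[OF _ sub]) (use fin in auto)
    also have "\<dots> \<le> card ?D + card (?f ` ?D \<union> ?g ` ?D)" by (rule card_Un_le)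
    also have "\<dots> \<le> card ?D + (card (?f ` ?D) + card (?g ` ?D))" by (intro add_left_mono card_Un_le)
    also have "\<dots> \<le> card ?D + (card ?D + card ?D)" by (intro add_mono card_image_le fin order_refl)
    also have "\<dots> \<le> 3 * 3 ^ card (prime_factors q)" using mult.IH by simp
    also have "\<dots> = 3 ^ card (prime_factors (p * q))"
      unfolding prime_factors_mult_coprime_prime(3)[OF mult.hyps(1,3,4)] by simp
    finally show ?case using finite_subset[OF sub] fin by auto
  qed
  then show "finite {(u, v). u * v dvd e}" "card {(u, v). u * v dvd e} \<le> 3 ^ card (prime_factors e)" by auto
qed

text \<open>A prime dividing exactly one of the two denominators survives in the denominator of the
  sum; these primes make up u and v. A common prime either survives, and belongs to s, or cancels,
  and belongs to t. Squarefreeness makes u, v, s, t coprime to one another wherever this is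
  needed.\<close>

lemma den_add_structure:
  assumes "squarefree q" "real q * x \<in> \<int>" "real q * y \<in> \<int>"
  defines "g \<equiv> gcd (den x) (den y)"
  defines "u \<equiv> den x div g" and "v \<equiv> den y div g" and "s \<equiv> gcd g (den (x + y))"
  defines "t \<equiv> g div s"
  shows "den x = u * s * t" "den y = v * s * t" "den (x + y) = u * v * s" "coprime t (den (x + y))"
    "coprime u v" "g = s * t" "t dvd q" "u > 0" "v > 0" "s > 0" "t > 0"
proof -
  have q0: "q > 0" using assms(1) by (cases q) auto
  have "real q * x + real q * y \<in> \<int>" using assms(2,3) by (rule Ints_add)
  then have qs: "real q * (x + y) \<in> \<int>" by (simp add: algebra_simps)
  note X = den_mult_Ints[OF q0 assms(2)] and Y = den_mult_Ints[OF q0 assms(3)] and E = den_mult_Ints[OF q0 qs]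
  have sfx: "squarefree (den x)" and sfy: "squarefree (den y)"
    using den_dvd_iff[OF q0 assms(2), of q] den_dvd_iff[OF q0 assms(3), of q] assms(1-3)
    by (auto intro: squarefree_mono)
  have g0: "g > 0" using X by (simp add: g_def)
  have xg: "den x = u * g" and yg: "den y = v * g" by (simp_all add: u_def v_def g_def)
  have g: "g = s * t" by (simp add: t_def s_def)
  show "g = s * t" by (rule g)
  show s0: "s > 0" using g0 by (simp add: s_def)
  show t0: "t > 0" using g0 g by (cases t) auto
  show u0: "u > 0" using X(1) xg by (cases u) auto
  show v0: "v > 0" using Y(1) yg by (cases v) auto
  show dx: "den x = u * s * t" and dy: "den y = v * s * t" using xg yg g by auto
  show uv: "coprime u v" unfolding u_def v_def g_def using X(1) by (intro div_gcd_coprime) auto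
  have "t dvd den x" using dx by simp
  then show "t dvd q" using den_dvd_iff[OF q0 assms(2), of q] assms(2) dvd_trans by blast
  have ug: "coprime u g"
  proof (rule coprimeI)
    fix c assume "c dvd u" "c dvd g"
    then have "c ^ 2 dvd den x" unfolding xg power2_eq_square by (rule mult_dvd_mono)
    then show "is_unit c" by (rule squarefreeD[OF sfx])
  qed
  have vg: "coprime v g"
  proof (rule coprimeI)
    fix c assume "c dvd v" "c dvd g"
    then have "c ^ 2 dvd den y" unfolding yg power2_eq_square by (rule mult_dvd_mono)
    then show "is_unit c" by (rule squarefreeD[OF sfy])
  qed
  let ?e = "den (x + y)"
  have "coprime (g div gcd g ?e) (?e div gcd g ?e)" using g0 by (intro div_gcd_coprime) auto
  then have te: "coprime t (?e div s)" by (simp add: t_def s_def)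
  have ts: "coprime t s"
  proof (rule coprimeI)
    fix c assume "c dvd t" "c dvd s"
    then have "c ^ 2 dvd g" unfolding g power2_eq_square mult.commute[of s] by (rule mult_dvd_mono)
    then have "c ^ 2 dvd den x" unfolding xg by simp
    then show "is_unit c" by (rule squarefreeD[OF sfx])
  qed
  have "?e = s * (?e div s)" by (simp add: s_def)
  then show cte: "coprime t ?e" using te ts by (metis coprime_mult_right_iff)
  have ue: "u dvd ?e"
  proof -
    have "real (den y) * (real ?e * (x + y)) - real ?e * (real (den y) * y) \<in> \<int>"
      by (rule Ints_diff[OF mult_nat_Ints[OF E(2)] mult_nat_Ints[OF Y(2)]])
    then have "real (den y * ?e) * x \<in> \<int>" by (simp add: algebra_simps)
    then have "den x dvd den y * ?e" using den_dvd_iff[OF q0 assms(2)] by blast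
    then have "u dvd den y * ?e" using xg by (metis dvd_mult_left)
    moreover have "coprime u (den y)" unfolding yg using uv ug by simp
    ultimately show ?thesis by (metis coprime_dvd_mult_right_iff)
  qed
  have ve: "v dvd ?e"
  proof -
    have "real (den x) * (real ?e * (x + y)) - real ?e * (real (den x) * x) \<in> \<int>"
      by (rule Ints_diff[OF mult_nat_Ints[OF E(2)] mult_nat_Ints[OF X(2)]])
    then have "real (den x * ?e) * y \<in> \<int>" by (simp add: algebra_simps)
    then have "den y dvd den x * ?e" using den_dvd_iff[OF q0 assms(3)] by blast
    then have "v dvd den x * ?e" using yg by (metis dvd_mult_left)
    moreover have "coprime v (den x)" unfolding xg using uv vg by (simp add: coprime_commute)
    ultimately show ?thesis by (metis coprime_dvd_mult_right_iff)
  qed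
  have se: "s dvd ?e" by (simp add: s_def)
  have "coprime u s" "coprime v s" using ug vg g by auto
  then have "u * v * s dvd ?e" using ue ve se uv by (simp add: divides_mult)
  moreover have "?e dvd u * v * s"
  proof -
    have "real v * (real (den x) * x) + real u * (real (den y) * y) \<in> \<int>"
      by (rule Ints_add[OF mult_nat_Ints[OF X(2)] mult_nat_Ints[OF Y(2)]])
    then have "real ((u * v * s) * t) * (x + y) \<in> \<int>" unfolding dx dy by (simp add: algebra_simps)
    then have "?e dvd (u * v * s) * t" using den_dvd_iff[OF q0 qs] by blast
    then show ?thesis using cte by (metis coprime_commute coprime_dvd_mult_left_iff)
  qed
  ultimately show "?e = u * v * s" by (intro dvd_antisym)
qed

section \<open>Convolution of two small fractions\<close>

text \<open>The bound 1/4 keeps the sum of two elements of \<open>S\<close> inside the representing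
  interval, so that no reduction modulo 1 interferes with x + y.\<close>

locale small_torsion =
  fixes q :: nat and \<delta> :: real
  assumes sqf: "squarefree q" and d0: "0 < \<delta>" and d4: "\<delta> < 1 / 4"
begin

definition S :: "real set" where
  "S = {y \<in> torsion q. y \<noteq> 0 \<and> \<bar>y\<bar> \<le> \<delta>}"

lemma q0: "q > 0"
  using sqf by (cases q) auto

lemma finite_S: "finite S"
  unfolding S_def using finite_torsion[OF q0] by auto

lemma S_torsion: "y \<in> S \<Longrightarrow> real q * y \<in> \<int>"
  by (simp add: S_def torsion_def)

lemma S_den: "y \<in> S \<Longrightarrow> real (den y) * y \<in> \<int>" "y \<in> S \<Longrightarrow> den y > 0"
  using den_mult_Ints[OF q0] S_torsion by auto

lemma one_le_mult_Ints:
  assumes "real d * y \<in> \<int>" "d > 0" "y \<noteq> 0" shows "1 \<le> real d * \<bar>y\<bar>"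
proof -
  obtain n where n: "real d * y = of_int n" using assms(1) by (auto elim: Ints_cases)
  have "n \<noteq> 0" using n assms by auto
  then have "1 \<le> \<bar>real_of_int n\<bar>" by linarith
  also have "\<dots> = real d * \<bar>y\<bar>" unfolding n[symmetric] by (simp add: abs_mult)
  finally show ?thesis .
qed

text \<open>A nonzero fraction with denominator d is at least 1/d in absolute value.\<close>

lemma S_den_ge: "y \<in> S \<Longrightarrow> 1 \<le> real (den y) * \<delta>"
proof -
  assume y: "y \<in> S"
  have "1 \<le> real (den y) * \<bar>y\<bar>" using S_den[OF y] y by (intro one_le_mult_Ints) (auto simp: S_def)
  also have "\<dots> \<le> real (den y) * \<delta>" using y by (intro mult_left_mono) (auto simp: S_def)
  finally show ?thesis .
qed

definition gd :: "real \<times> real \<Rightarrow> nat" where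
  "gd r = gcd (den (fst r)) (den (snd r))"

text \<open>For \<open>(x, y)\<close> in \<open>pairs e u v D\<close> the denominators are \<open>ust\<close> and \<open>vst\<close>, where
  \<open>e = uvs\<close> is the denominator of \<open>x + y\<close>, \<open>s\<close> is \<open>sc e u v\<close> and \<open>t\<close> is \<open>cof e (x, y)\<close>.\<close>

definition pairs :: "nat \<Rightarrow> nat \<Rightarrow> nat \<Rightarrow> real \<Rightarrow> (real \<times> real) set" where
  "pairs e u v D = {r \<in> S \<times> S. fst r + snd r \<noteq> 0 \<and> den (fst r + snd r) = e \<and>
     den (fst r) div gd r = u \<and> den (snd r) div gd r = v \<and> D \<le> real (gd r)}"

definition wt :: "real \<times> real \<Rightarrow> real" where
  "wt r = 1 / (real (den (fst r)) * real (den (snd r)))"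

definition cof :: "nat \<Rightarrow> real \<times> real \<Rightarrow> nat" where
  "cof e r = gd r div gcd (gd r) e"

lemma wt_nonneg: "wt r \<ge> 0"
  by (simp add: wt_def)

lemma finite_pairs: "finite (pairs e u v D)"
  by (rule finite_subset[of _ "S \<times> S"]) (use finite_S in \<open>auto simp: pairs_def\<close>)

lemma pairs_structure:
  assumes "r \<in> pairs e u v D"
  obtains s where "s > 0" "u > 0" "v > 0" "e = u * v * s" "cof e r > 0" "cof e r dvd q"
    "den (fst r) = u * s * cof e r" "den (snd r) = v * s * cof e r" "gd r = s * cof e r"
    "coprime u v" "coprime (cof e r) e"
proof -
  have r: "real q * fst r \<in> \<int>" "real q * snd r \<in> \<int>"
    using assms S_torsion by (auto simp: pairs_def)
  have e: "den (fst r + snd r) = e" "den (fst r) div gd r = u" "den (snd r) div gd r = v"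
    using assms by (auto simp: pairs_def)
  note st = den_add_structure[OF sqf r, folded gd_def[of r]]
  note st = st[unfolded e, folded cof_def[of e r]]
  from that[OF st(10,8,9,3,11,7,1,2,6,5,4)] show ?thesis .
qed

definition sc :: "nat \<Rightarrow> nat \<Rightarrow> nat \<Rightarrow> nat" where "sc e u v = e div (u * v)"

lemma pairs_facts:
  assumes "r \<in> pairs e u v D"
  shows "sc e u v > 0" "u > 0" "v > 0" "e = u * v * sc e u v" "cof e r > 0" "cof e r dvd q"
    "den (fst r) = u * sc e u v * cof e r" "den (snd r) = v * sc e u v * cof e r"
    "gd r = sc e u v * cof e r" "coprime u v" "coprime (cof e r) e"
proof -
  from pairs_structure[OF assms] obtain s where s: "s > 0" "u > 0" "v > 0" "e = u * v * s" "cof e r > 0" "cof e r dvd q"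
    "den (fst r) = u * s * cof e r" "den (snd r) = v * s * cof e r" "gd r = s * cof e r"
    "coprime u v" "coprime (cof e r) e" by metis
  have "sc e u v = s" unfolding sc_def s(4) using s(2,3) by simp
  then show "sc e u v > 0" "u > 0" "v > 0" "e = u * v * sc e u v" "cof e r > 0" "cof e r dvd q"
    "den (fst r) = u * sc e u v * cof e r" "den (snd r) = v * sc e u v * cof e r"
    "gd r = sc e u v * cof e r" "coprime u v" "coprime (cof e r) e" using s by simp_all
qed

lemma pairs_S: "r \<in> pairs e u v D \<Longrightarrow> fst r \<in> S \<and> snd r \<in> S"
  by (auto simp: pairs_def)

lemma pairs_sum: "r \<in> pairs e u v D \<Longrightarrow> real e * (fst r + snd r) \<in> \<int>"
proof -
  assume r: "r \<in> pairs e u v D"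
  then have "real q * fst r + real q * snd r \<in> \<int>" using S_torsion pairs_S by (intro Ints_add) auto
  then have "real q * (fst r + snd r) \<in> \<int>" by (simp add: algebra_simps)
  from den_mult_Ints(2)[OF q0 this] r show ?thesis by (simp add: pairs_def)
qed

text \<open>The nonzero sum of two elements of \<open>S\<close> is a fraction with denominator e of
  absolute value at most 2 \<delta>.\<close>

lemma pairs_e_ge:
  assumes r: "r \<in> pairs e u v D" shows "1 \<le> 2 * \<delta> * real e"
proof -
  have "1 \<le> real e * \<bar>fst r + snd r\<bar>"
  proof (rule one_le_mult_Ints[OF pairs_sum[OF r]])
    have "u * v * sc e u v > 0" using pairs_facts(1-3)[OF r] by simp
    then show "e > 0" using pairs_facts(4)[OF r] by simp
    show "fst r + snd r \<noteq> 0" using r by (simp add: pairs_def)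
  qed
  also have "\<dots> \<le> real e * (2 * \<delta>)" using pairs_S[OF r] by (intro mult_left_mono) (auto simp: S_def)
  finally show ?thesis by (simp add: mult_ac)
qed

lemma card_le_fibres:
  fixes M L :: real
  assumes "finite \<Omega>" "finite A" "fst ` \<Omega> \<subseteq> A" "\<And>y. card {z. (y, z) \<in> \<Omega>} \<le> M" "card A \<le> L" "M \<ge> 0"
  shows "card \<Omega> \<le> L * M"
proof -
  have "\<Omega> \<subseteq> Sigma A (\<lambda>y. {z. (y, z) \<in> \<Omega>})" using assms(3) by force
  moreover have fin: "finite {z. (y, z) \<in> \<Omega>}" for y
    by (rule finite_subset[of _ "snd ` \<Omega>"]) (use assms(1) in force)+
  ultimately have "card \<Omega> \<le> card (Sigma A (\<lambda>y. {z. (y, z) \<in> \<Omega>}))"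
    using assms(2) by (intro card_mono) auto
  also have "\<dots> = (\<Sum>y\<in>A. card {z. (y, z) \<in> \<Omega>})" using assms(2) fin by simp
  finally have "real (card \<Omega>) \<le> (\<Sum>y\<in>A. real (card {z. (y, z) \<in> \<Omega>}))"
    unfolding of_nat_sum[symmetric] of_nat_le_iff .
  also have "\<dots> \<le> (\<Sum>y\<in>A. M)" using assms(4) by (intro sum_mono) auto
  also have "\<dots> = real (card A) * M" by simp
  also have "\<dots> \<le> L * M" using assms by (intro mult_right_mono) auto
  finally show ?thesis .
qed

text \<open>The first factor counts the nonzero multiples of 1/(ust) within \<delta> of 0. Once the
  first entry is fixed, differences of second entries are cleared by e = uvs and by vst, hence by
  their gcd, which is vs since t is coprime to u; the second factor counts one coset of spacing
  1/(vs).\<close>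

lemma card_pairs_cof:
  assumes "u > 0" "v > 0" "sc e u v > 0" "t > 0"
  shows "card {r \<in> pairs e u v D. cof e r = t}
     \<le> (2 * \<delta> * (real u * real (sc e u v) * real t)) * (2 * \<delta> * (real v * real (sc e u v)) + 1)"
proof (cases "{r \<in> pairs e u v D. cof e r = t} = {}")
  case True
  have "0 \<le> (2 * \<delta> * (real u * real (sc e u v) * real t)) * (2 * \<delta> * (real v * real (sc e u v)) + 1)"
    using d0 by auto
  then show ?thesis using True by (simp only: card.empty)
next
  case False
  then obtain r0 where r0: "r0 \<in> pairs e u v D" "cof e r0 = t" by auto
  define s where "s = sc e u v"
  have e: "e = u * v * s" and cte: "coprime t e" using pairs_facts[OF r0(1)] r0(2) by (auto simp: s_def)
  let ?\<Omega> = "{r \<in> pairs e u v D. cof e r = t}"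
  let ?A = "{y. y \<noteq> 0 \<and> \<bar>y\<bar> \<le> \<delta> \<and> real (u * s * t) * y \<in> \<int>}"
  have ust: "u * s * t > 0" using assms by (simp add: s_def)
  show ?thesis unfolding s_def[symmetric]
  proof (rule card_le_fibres[where A = ?A])
    show "finite ?\<Omega>" using finite_pairs by simp
    show "finite ?A" using card_small_multiples(1)[OF ust, of \<delta>] d0 by simp
    show "card ?A \<le> 2 * \<delta> * (real u * real s * real t)"
      using card_small_multiples(2)[OF ust, of \<delta>] d0 by simp
    show "fst ` ?\<Omega> \<subseteq> ?A"
    proof
      fix y assume "y \<in> fst ` ?\<Omega>"
      then obtain r where r: "r \<in> ?\<Omega>" "y = fst r" by auto
      then have "y \<in> S" "den y = u * s * t" using pairs_S[of r] pairs_facts(7)[of r] by (auto simp: s_def)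
      then show "y \<in> ?A" using S_den[of y] by (auto simp: S_def)
    qed
    show "real (card {z. (y, z) \<in> ?\<Omega>}) \<le> 2 * \<delta> * (real v * real s) + 1" for y
    proof -
      have "real (card {z. (y, z) \<in> ?\<Omega>}) \<le> 2 * \<delta> * real (v * s) + 1"
      proof (rule card_coset_interval(2))
        show "v * s > 0" using assms by (simp add: s_def)
        fix z z' assume z: "z \<in> {z. (y, z) \<in> ?\<Omega>}" and z': "z' \<in> {z. (y, z) \<in> ?\<Omega>}"
        have 1: "real e * (z - z') \<in> \<int>"
        proof -
          have "real e * (y + z) - real e * (y + z') \<in> \<int>"
            using pairs_sum[of "(y, z)"] pairs_sum[of "(y, z')"] z z' by (intro Ints_diff) auto
          then show ?thesis by (simp add: algebra_simps)
        qed
        have 2: "real (v * s * t) * (z - z') \<in> \<int>"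
        proof -
          have "den z = v * s * t" "den z' = v * s * t" "z \<in> S" "z' \<in> S"
            using z z' pairs_facts(8)[of "(y, z)"] pairs_facts(8)[of "(y, z')"] pairs_S[of "(y, z)"] pairs_S[of "(y, z')"]
            by (auto simp: s_def)
          then have "real (v * s * t) * z \<in> \<int>" "real (v * s * t) * z' \<in> \<int>" using S_den by metis+
          then have "real (v * s * t) * z - real (v * s * t) * z' \<in> \<int>" by (rule Ints_diff)
          then show ?thesis by (simp only: right_diff_distrib)
        qed
        have "coprime u t" using cte e by (simp add: coprime_commute)
        then have "v * s * gcd u t = v * s" by simp
        then have "gcd (v * s * u) (v * s * t) = v * s" by (simp only: gcd_mult_distrib_nat)
        moreover have "v * s * u = e" by (simp add: e)
        ultimately have "gcd e (v * s * t) = v * s" by simp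
        with gcd_mult_Ints[OF 1 2] show "real (v * s) * (z - z') \<in> \<int>" by simp
      next
        show "- \<delta> \<le> z \<and> z \<le> - \<delta> + 2 * \<delta>" if "z \<in> {z. (y, z) \<in> ?\<Omega>}" for z
          using pairs_S[of "(y, z)" e u v D] that by (auto simp: S_def abs_le_iff)
      qed (use d0 in auto)
      then show ?thesis by simp
    qed
  qed (use d0 in auto)
qed

lemma sum_by_cof:
  assumes \<Omega>: "\<Omega> \<subseteq> pairs e u v D"
  shows "sum wt \<Omega> = (\<Sum>t\<in>{t. t dvd q}. real (card {r \<in> \<Omega>. cof e r = t}) / (real (u * v * sc e u v * sc e u v) * (real t)\<^sup>2))"
proof -
  have fin: "finite \<Omega>" using \<Omega> finite_pairs finite_subset by blast
  have "sum wt \<Omega> = (\<Sum>t\<in>{t. t dvd q}. sum wt {r. r \<in> \<Omega> \<and> cof e r = t})"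
    by (rule sum.group[symmetric, OF fin]) (use q0 \<Omega> pairs_facts(6) in auto)
  also have "\<dots> = (\<Sum>t\<in>{t. t dvd q}. real (card {r \<in> \<Omega>. cof e r = t}) / (real (u * v * sc e u v * sc e u v) * (real t)\<^sup>2))"
  proof (rule sum.cong[OF refl])
    fix t
    have "sum wt {r. r \<in> \<Omega> \<and> cof e r = t} = (\<Sum>r\<in>{r \<in> \<Omega>. cof e r = t}. 1 / (real (u * v * sc e u v * sc e u v) * (real t)\<^sup>2))"
    proof (rule sum.cong)
      fix r assume "r \<in> {r \<in> \<Omega>. cof e r = t}"
      then have "den (fst r) = u * sc e u v * t" "den (snd r) = v * sc e u v * t" using \<Omega> pairs_facts(7,8)[of r] by auto
      then show "wt r = 1 / (real (u * v * sc e u v * sc e u v) * (real t)\<^sup>2)"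
        by (simp add: wt_def power2_eq_square mult_ac)
    qed auto
    then show "sum wt {r. r \<in> \<Omega> \<and> cof e r = t} = real (card {r \<in> \<Omega>. cof e r = t}) / (real (u * v * sc e u v * sc e u v) * (real t)\<^sup>2)"
      by simp
  qed
  finally show ?thesis .
qed

text \<open>Dividing the count for a fixed cofactor t by the common inverse weight u v s^2 t^2
  leaves a constant times 1/t, and the reciprocals of the divisors of q add up to at most
  \<open>Phi q\<close>.\<close>

lemma sum_wt_le:
  assumes uvs: "u > 0" "v > 0" "sc e u v > 0"
  shows "sum wt (pairs e u v D) \<le> Phi q * (2 * \<delta> * (2 * \<delta> + 1 / (real v * real (sc e u v))))"
proof -
  define s where "s = real (sc e u v)"
  have s0: "s > 0" using uvs by (simp add: s_def)
  have "sum wt (pairs e u v D) \<le> (\<Sum>t\<in>{t. t dvd q}. 1 / real t * (2 * \<delta> * (2 * \<delta> + 1 / (real v * s))))"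
    unfolding sum_by_cof[OF order_refl]
  proof (rule sum_mono)
    fix t assume "t \<in> {t. t dvd q}"
    then have t0: "t > 0" using q0 by (auto intro: dvd_pos_nat)
    have "real (card {r \<in> pairs e u v D. cof e r = t}) / (real (u * v * sc e u v * sc e u v) * (real t)\<^sup>2)
      \<le> (2 * \<delta> * (real u * s * real t)) * (2 * \<delta> * (real v * s) + 1) / (real (u * v * sc e u v * sc e u v) * (real t)\<^sup>2)"
      using card_pairs_cof[OF uvs t0] by (intro divide_right_mono) (auto simp: s_def)
    also have "\<dots> = 1 / real t * (2 * \<delta> * (2 * \<delta> + 1 / (real v * s)))"
      using uvs s0 t0 by (simp add: s_def field_simps power2_eq_square)
    finally show "real (card {r \<in> pairs e u v D. cof e r = t}) / (real (u * v * sc e u v * sc e u v) * (real t)\<^sup>2)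
      \<le> 1 / real t * (2 * \<delta> * (2 * \<delta> + 1 / (real v * s)))" .
  qed
  also have "\<dots> = (\<Sum>t\<in>{t. t dvd q}. 1 / real t) * (2 * \<delta> * (2 * \<delta> + 1 / (real v * s)))"
    by (rule sum_distrib_right[symmetric])
  also have "\<dots> \<le> Phi q * (2 * \<delta> * (2 * \<delta> + 1 / (real v * s)))"
    using sum_divisors_inverse_le_Phi[OF sqf] d0 s0 by (intro mult_right_mono) auto
  finally show ?thesis by (simp add: s_def)
qed

text \<open>With the sum fixed, both entries move by the same amount up to sign. This amount is
  cleared by ust and by vst, hence by st, as u and v are coprime: first entries are 1/(st)
  apart.\<close>

lemma card_pairs_sum_cof:
  assumes uvs: "u > 0" "v > 0" "sc e u v > 0" "t > 0"
  shows "card {r \<in> pairs e u v D. fst r + snd r = \<sigma> \<and> cof e r = t} \<le> 2 * \<delta> * (real (sc e u v) * real t) + 1"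
proof -
  define s where "s = sc e u v"
  let ?\<Omega> = "{r \<in> pairs e u v D. fst r + snd r = \<sigma> \<and> cof e r = t}"
  have inj: "inj_on fst ?\<Omega>" by (rule inj_onI) (auto simp: prod_eq_iff)
  have "real (card (fst ` ?\<Omega>)) \<le> 2 * \<delta> * real (s * t) + 1"
  proof (rule card_coset_interval(2))
    show "s * t > 0" using assms by (simp add: s_def)
    fix y y' assume "y \<in> fst ` ?\<Omega>" "y' \<in> fst ` ?\<Omega>"
    then obtain z z' where z: "(y, z) \<in> ?\<Omega>" "(y', z') \<in> ?\<Omega>" by auto
    then have uv: "coprime u v" using pairs_facts(10) by blast
    have den: "den y = u * s * t" "den y' = u * s * t" "den z = v * s * t" "den z' = v * s * t"
      and m: "y \<in> S" "y' \<in> S" "z \<in> S" "z' \<in> S"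
      using z pairs_facts(7,8)[of "(y, z)"] pairs_facts(7,8)[of "(y', z')"] pairs_S[of "(y, z)"] pairs_S[of "(y', z')"]
      by (auto simp: s_def)
    have I: "real (u * s * t) * y \<in> \<int>" "real (u * s * t) * y' \<in> \<int>" "real (v * s * t) * z \<in> \<int>" "real (v * s * t) * z' \<in> \<int>"
      using S_den(1)[OF m(1)] S_den(1)[OF m(2)] S_den(1)[OF m(3)] S_den(1)[OF m(4)] den by simp_all
    have 1: "real (u * s * t) * (y - y') \<in> \<int>" using Ints_diff[OF I(1,2)] by (simp only: right_diff_distrib)
    have "real (v * s * t) * (z' - z) \<in> \<int>" using Ints_diff[OF I(4,3)] by (simp only: right_diff_distrib)
    moreover have "z' - z = y - y'" using z by auto
    ultimately have 2: "real (v * s * t) * (y - y') \<in> \<int>" by simp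
    have "s * t * gcd u v = s * t" using uv by simp
    then have "gcd (s * t * u) (s * t * v) = s * t" by (simp only: gcd_mult_distrib_nat)
    moreover have "s * t * u = u * s * t" "s * t * v = v * s * t" by simp_all
    ultimately have "gcd (u * s * t) (v * s * t) = s * t" by simp
    with gcd_mult_Ints[OF 1 2] show "real (s * t) * (y - y') \<in> \<int>" by simp
  next
    show "- \<delta> \<le> y \<and> y \<le> - \<delta> + 2 * \<delta>" if "y \<in> fst ` ?\<Omega>" for y
      using pairs_S[of _ e u v D] that by (fastforce simp: S_def abs_le_iff)
  qed (use d0 in auto)
  then show ?thesis using card_image[OF inj] by (simp add: s_def)
qed

text \<open>The count for fixed \<sigma> and t, divided by u v s^2 t^2, is 1/t times (2 \<delta> +
  1/(st)) / (uvs); \<kappa> absorbs the term 1/(st), which stems from the \<open>+ 1\<close> in the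
  count.\<close>

lemma sup_wt_large:
  assumes uvs: "u > 0" "v > 0" "sc e u v > 0"
    and \<kappa>: "\<And>r. r \<in> \<Omega> \<Longrightarrow> 1 / (real (sc e u v) * real (cof e r)) \<le> \<kappa>" and \<kappa>0: "\<kappa> \<ge> 0"
    and \<Omega>: "\<Omega> \<subseteq> pairs e u v D"
  shows "sum wt {r \<in> \<Omega>. fst r + snd r = \<sigma>} \<le> Phi q * (2 * \<delta> + \<kappa>) / real (u * v * sc e u v)"
proof -
  define s where "s = real (sc e u v)"
  have s0: "s > 0" using uvs by (simp add: s_def)
  let ?\<Omega> = "{r \<in> \<Omega>. fst r + snd r = \<sigma>}"
  have sub: "?\<Omega> \<subseteq> pairs e u v D" using \<Omega> by auto
  have "sum wt ?\<Omega> \<le> (\<Sum>t\<in>{t. t dvd q}. 1 / real t * ((2 * \<delta> + \<kappa>) / (real u * real v * s)))"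
    unfolding sum_by_cof[OF sub]
  proof (rule sum_mono)
    fix t assume "t \<in> {t. t dvd q}"
    then have t0: "t > 0" using q0 by (auto intro: dvd_pos_nat)
    have uvt: "real (u * v * sc e u v * sc e u v) * (real t)\<^sup>2 > 0" using uvs t0 by simp
    show "real (card {r \<in> ?\<Omega>. cof e r = t}) / (real (u * v * sc e u v * sc e u v) * (real t)\<^sup>2)
      \<le> 1 / real t * ((2 * \<delta> + \<kappa>) / (real u * real v * s))"
    proof (cases "{r \<in> ?\<Omega>. cof e r = t} = {}")
      case True
      then show ?thesis using d0 \<kappa>0 s0 by (simp only: card.empty) simp
    next
      case False
      then have k: "1 / (s * real t) \<le> \<kappa>" using \<kappa> by (auto simp: s_def)
      have "card {r \<in> ?\<Omega>. cof e r = t} \<le> card {r \<in> pairs e u v D. fst r + snd r = \<sigma> \<and> cof e r = t}"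
        using finite_pairs sub by (intro card_mono) auto
      then have "real (card {r \<in> ?\<Omega>. cof e r = t}) \<le> 2 * \<delta> * (s * real t) + 1"
        using card_pairs_sum_cof[OF uvs t0, of D \<sigma>] unfolding s_def by linarith
      then have "real (card {r \<in> ?\<Omega>. cof e r = t}) / (real (u * v * sc e u v * sc e u v) * (real t)\<^sup>2)
        \<le> (2 * \<delta> * (s * real t) + 1) / (real (u * v * sc e u v * sc e u v) * (real t)\<^sup>2)"
        using uvt by (intro divide_right_mono) auto
      also have "\<dots> = 1 / real t * ((2 * \<delta> + 1 / (s * real t)) / (real u * real v * s))"
        using uvs s0 t0 by (simp add: s_def field_simps power2_eq_square)
      also have "\<dots> \<le> 1 / real t * ((2 * \<delta> + \<kappa>) / (real u * real v * s))"
        using k s0 by (intro mult_left_mono divide_right_mono) auto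
      finally show ?thesis .
    qed
  qed
  also have "\<dots> = (\<Sum>t\<in>{t. t dvd q}. 1 / real t) * ((2 * \<delta> + \<kappa>) / (real u * real v * s))"
    by (rule sum_distrib_right[symmetric])
  also have "\<dots> \<le> Phi q * ((2 * \<delta> + \<kappa>) / (real u * real v * s))"
    using sum_divisors_inverse_le_Phi[OF sqf] d0 s0 \<kappa>0 by (intro mult_right_mono) auto
  finally show ?thesis by (simp add: s_def)
qed

text \<open>The numerators and \<open>\<sigma> \<noteq> 0\<close> determine the cofactor \<open>t\<close>, hence the pair.\<close>

lemma sup_wt_small:
  assumes uvs: "u > 0" "v > 0" "sc e u v > 0" and Q: "Q > 0"
    and small: "\<And>r. r \<in> \<Omega> \<Longrightarrow> real (den (fst r)) \<le> Q \<and> real (den (snd r)) \<le> Q"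
    and \<tau>: "\<And>r. r \<in> \<Omega> \<Longrightarrow> \<tau> \<le> real (cof e r)" and \<tau>0: "\<tau> > 0"
    and \<Omega>: "\<Omega> \<subseteq> pairs e u v D" and \<sigma>: "\<sigma> \<noteq> 0"
  shows "sum wt {r \<in> \<Omega>. fst r + snd r = \<sigma>} \<le> (2 * \<delta> * Q)\<^sup>2 / (real (u * v * sc e u v * sc e u v) * \<tau>\<^sup>2)"
proof -
  define s where "s = sc e u v"
  have s0: "s > 0" using uvs by (simp add: s_def)
  let ?\<Omega> = "{r \<in> \<Omega>. fst r + snd r = \<sigma>}"
  let ?B = "{n::int. n \<noteq> 0 \<and> \<bar>real_of_int n\<bar> \<le> \<delta> * Q}"
  define num where "num y = \<lfloor>real (den y) * y\<rfloor>" for y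
  have num: "real_of_int (num y) = real (den y) * y" if "y \<in> S" for y
    unfolding num_def using S_den(1)[OF that] by (auto elim!: Ints_cases)
  have B: "finite ?B" "real (card ?B) \<le> 2 * \<delta> * Q"
  proof -
    have eq: "?B = {- \<lfloor>\<delta> * Q\<rfloor>..\<lfloor>\<delta> * Q\<rfloor>} - {0}"
    proof (intro set_eqI)
      fix n :: int
      have "\<bar>real_of_int n\<bar> \<le> \<delta> * Q \<longleftrightarrow> \<bar>n\<bar> \<le> \<lfloor>\<delta> * Q\<rfloor>" by (simp add: le_floor_iff)
      then show "n \<in> ?B \<longleftrightarrow> n \<in> {- \<lfloor>\<delta> * Q\<rfloor>..\<lfloor>\<delta> * Q\<rfloor>} - {0}" by auto
    qed
    show "finite ?B" unfolding eq by simp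
    have f0: "\<lfloor>\<delta> * Q\<rfloor> \<ge> 0" using d0 Q by simp
    then have "card ?B = nat (2 * \<lfloor>\<delta> * Q\<rfloor>)" unfolding eq
      by (subst card_Diff_subset) (auto simp: nat_diff_distrib)
    then show "real (card ?B) \<le> 2 * \<delta> * Q" using f0 of_int_floor_le[of "\<delta> * Q"] by linarith
  qed
  have numB: "num y \<in> ?B" if "y \<in> S" "real (den y) \<le> Q" for y
  proof -
    have "\<bar>real_of_int (num y)\<bar> = real (den y) * \<bar>y\<bar>" unfolding num[OF that(1)] by (simp add: abs_mult)
    also have "\<dots> \<le> Q * \<delta>" using that Q d0 by (intro mult_mono) (auto simp: S_def)
    finally have 1: "\<bar>real_of_int (num y)\<bar> \<le> \<delta> * Q" by (simp add: mult.commute)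
    have "real_of_int (num y) \<noteq> 0" unfolding num[OF that(1)] using that S_den(2)[OF that(1)] by (auto simp: S_def)
    then show ?thesis using 1 by auto
  qed
  let ?F = "\<lambda>r. (num (fst r), num (snd r))"
  have fm: "r \<in> ?\<Omega> \<Longrightarrow> fst r \<in> S \<and> snd r \<in> S" for r using \<Omega> pairs_S[of r] by auto
  have inj: "inj_on ?F ?\<Omega>"
  proof (rule inj_onI)
    fix r r' assume r: "r \<in> ?\<Omega>" "r' \<in> ?\<Omega>" and eq: "?F r = ?F r'"
    have P: "r \<in> pairs e u v D" "r' \<in> pairs e u v D" using r \<Omega> by auto
    define t t' where "t = cof e r" and "t' = cof e r'"
    have t0: "t > 0" "t' > 0" using pairs_facts(5)[OF P(1)] pairs_facts(5)[OF P(2)] by (auto simp: t_def t'_def)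
    have n: "real (u * s * t) * fst r = real (u * s * t') * fst r'" "real (v * s * t) * snd r = real (v * s * t') * snd r'"
      using eq num[of "fst r"] num[of "fst r'"] num[of "snd r"] num[of "snd r'"] fm[OF r(1)] fm[OF r(2)]
        pairs_facts(7,8)[OF P(1)] pairs_facts(7,8)[OF P(2)] by (auto simp: s_def t_def t'_def)
    then have n': "real t * fst r = real t' * fst r'" "real t * snd r = real t' * snd r'"
      using uvs s0 by (simp_all add: mult.assoc)
    \<comment> \<open>Both sums equal \<sigma>, so this reads t \<sigma> = t' \<sigma>.\<close>
    then have "real t * (fst r + snd r) = real t' * (fst r' + snd r')" by (simp add: algebra_simps)
    then have "real t = real t'" using r \<sigma> by simp
    then show "r = r'" using n' t0 by (simp add: prod_eq_iff)
  qed
  have "card ?\<Omega> \<le> card (?B \<times> ?B)"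
    by (rule card_inj_on_le[OF inj]) (use B(1) numB small fm in auto)
  then have "real (card ?\<Omega>) \<le> real (card ?B) * real (card ?B)"
    unfolding card_cartesian_product of_nat_mult[symmetric] of_nat_le_iff .
  also have "\<dots> \<le> (2 * \<delta> * Q) * (2 * \<delta> * Q)" using B(2) by (intro mult_mono) (use d0 Q in auto)
  finally have card: "real (card ?\<Omega>) \<le> (2 * \<delta> * Q)\<^sup>2" by (simp add: power2_eq_square)
  have "sum wt ?\<Omega> \<le> (\<Sum>r\<in>?\<Omega>. 1 / (real (u * v * s * s) * \<tau>\<^sup>2))"
  proof (rule sum_mono)
    fix r assume r: "r \<in> ?\<Omega>"
    then have P: "r \<in> pairs e u v D" using \<Omega> by auto
    have "wt r = 1 / (real (u * v * s * s) * (real (cof e r))\<^sup>2)"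
      using pairs_facts(7,8)[OF P] by (simp add: wt_def s_def power2_eq_square mult_ac)
    also have "\<dots> \<le> 1 / (real (u * v * s * s) * \<tau>\<^sup>2)"
      using \<tau>[of r] r \<tau>0 uvs s0 by (intro divide_left_mono mult_left_mono power_mono mult_pos_pos) auto
    finally show "wt r \<le> 1 / (real (u * v * s * s) * \<tau>\<^sup>2)" .
  qed
  also have "\<dots> = real (card ?\<Omega>) / (real (u * v * s * s) * \<tau>\<^sup>2)" by simp
  also have "\<dots> \<le> (2 * \<delta> * Q)\<^sup>2 / (real (u * v * s * s) * \<tau>\<^sup>2)"
    using card by (intro divide_right_mono) auto
  finally show ?thesis by (simp add: s_def)
qed

lemma sum_squares_fibres_le:
  assumes "finite \<Omega>" "finite T" "\<And>\<sigma>. \<sigma> \<in> T \<Longrightarrow> sum wt {r \<in> \<Omega>. fst r + snd r = \<sigma>} \<le> M" "M \<ge> 0"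
  shows "(\<Sum>\<sigma>\<in>T. (sum wt {r \<in> \<Omega>. fst r + snd r = \<sigma>})\<^sup>2) \<le> M * sum wt \<Omega>"
proof -
  let ?f = "\<lambda>\<sigma>. sum wt {r \<in> \<Omega>. fst r + snd r = \<sigma>}"
  have f0: "?f \<sigma> \<ge> 0" for \<sigma> by (intro sum_nonneg wt_nonneg)
  have "(\<Sum>\<sigma>\<in>T. (?f \<sigma>)\<^sup>2) \<le> (\<Sum>\<sigma>\<in>T. M * ?f \<sigma>)"
    unfolding power2_eq_square using assms f0 by (intro sum_mono mult_right_mono) auto
  also have "\<dots> = M * (\<Sum>\<sigma>\<in>T. ?f \<sigma>)" by (rule sum_distrib_left[symmetric])
  also have "(\<Sum>\<sigma>\<in>T. ?f \<sigma>) = sum wt (\<Union>\<sigma>\<in>T. {r \<in> \<Omega>. fst r + snd r = \<sigma>})"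
    using assms by (intro sum.UNION_disjoint[symmetric]) auto
  also have "M * \<dots> \<le> M * sum wt \<Omega>"
    using assms wt_nonneg by (intro mult_left_mono sum_mono2) auto
  finally show ?thesis .
qed

text \<open>The bracket with four terms bounds the pairs with second denominator above
  \<open>Q\<close> and arises from expanding (2\<delta> + \<kappa>)(2\<delta> + 1/(vs)); the term
  with \<delta>^4 bounds the remaining pairs; the outer 2 comes from (a + b)^2 \<le> 2 a^2 + 2
  b^2.\<close>

definition gain :: "real \<Rightarrow> real \<Rightarrow> real" where
  "gain D Q = 2 * (2 * \<delta> * (4 * \<delta>\<^sup>2 + 2 * \<delta> / D + 2 * \<delta> * sqrt (2 * \<delta>) + 1 / Q) + 24 * \<delta> ^ 4 * Q\<^sup>2 / D)"

lemma gain_nonneg: "D \<ge> 1 \<Longrightarrow> Q > 0 \<Longrightarrow> gain D Q \<ge> 0"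
  unfolding gain_def using d0 by simp

text \<open>The pairs with \<open>vst > Q\<close> and those with \<open>vst \<le> Q\<close> are treated separately, each by bounding the
  maximum over \<open>\<sigma>\<close> times the total.\<close>

lemma second_moment_pairs:
  assumes uv: "u \<le> v" and D: "D \<ge> 1" and Q: "Q > 0" and T: "finite T" "0 \<notin> T"
  shows "real e * (\<Sum>\<sigma>\<in>T. (sum wt {r \<in> pairs e u v D. fst r + snd r = \<sigma>})\<^sup>2) \<le> (Phi q)\<^sup>2 * gain D Q"
proof (cases "pairs e u v D = {}")
  case True
  then show ?thesis using gain_nonneg[OF D Q] by simp
next
  case False
  then obtain r0 where r0: "r0 \<in> pairs e u v D" by auto
  define s where "s = sc e u v"
  have uvs: "u > 0" "v > 0" "sc e u v > 0" and e: "e = u * v * s"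
    and e': "u * v * sc e u v = e"
    using pairs_facts(1-4)[OF r0] unfolding s_def by simp_all
  have s0: "real s \<ge> 1" "real u \<ge> 1" "real v \<ge> 1" using uvs by (auto simp: s_def)
  have "u * v * sc e u v > 0" using uvs by simp
  then have e0: "real e > 0" unfolding e' by simp
  have P1: "Phi q \<ge> 1" by (rule Phi_ge_1[OF q0])
  define A where "A = {r \<in> pairs e u v D. Q < real (den (snd r))}"
  define B where "B = {r \<in> pairs e u v D. real (den (snd r)) \<le> Q}"
  have AB: "A \<subseteq> pairs e u v D" "B \<subseteq> pairs e u v D" by (auto simp: A_def B_def)
  have fin: "finite A" "finite B" using AB finite_pairs finite_subset by blast+
  let ?f = "\<lambda>\<Omega> \<sigma>. sum wt {r \<in> \<Omega>. fst r + snd r = \<sigma>}"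
  have split: "?f (pairs e u v D) \<sigma> = ?f A \<sigma> + ?f B \<sigma>" for \<sigma>
  proof -
    have "{r \<in> pairs e u v D. fst r + snd r = \<sigma>} = {r \<in> A. fst r + snd r = \<sigma>} \<union> {r \<in> B. fst r + snd r = \<sigma>}"
      by (auto simp: A_def B_def)
    moreover have "{r \<in> A. fst r + snd r = \<sigma>} \<inter> {r \<in> B. fst r + snd r = \<sigma>} = {}"
      by (auto simp: A_def B_def)
    moreover have "finite {r \<in> A. fst r + snd r = \<sigma>}" "finite {r \<in> B. fst r + snd r = \<sigma>}" using fin by simp_all
    ultimately show ?thesis by (simp only: sum.union_disjoint)
  qed
  define W where "W = Phi q * (2 * \<delta> * (2 * \<delta> + 1 / (real v * real s)))"
  have W: "sum wt (pairs e u v D) \<le> W" unfolding W_def s_def by (rule sum_wt_le[OF uvs])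
  have WAB: "sum wt A \<le> W" "sum wt B \<le> W"
    using sum_mono2[OF finite_pairs AB(1), of wt] sum_mono2[OF finite_pairs AB(2), of wt] wt_nonneg W by auto
  \<comment> \<open>From u \<le> v and s \<ge> 1 follows e = uvs \<le> (vs)^2, while e is at least
    1/(2\<delta>).\<close>
  have vs: "1 / (real v * real s) \<le> sqrt (2 * \<delta>)"
  proof -
    have "1 \<le> 2 * \<delta> * real e" by (rule pairs_e_ge[OF r0])
    also have "real e \<le> (real v * real s)\<^sup>2"
    proof -
      have "real u * (real v * real s) * 1 \<le> real v * (real v * real s) * real s"
        using uv s0 by (intro mult_mono) auto
      then show ?thesis unfolding e by (simp add: power2_eq_square mult_ac)
    qed
    finally have "1 \<le> 2 * \<delta> * (real v * real s)\<^sup>2" using d0 by simp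
    then have "1 / (real v * real s)\<^sup>2 \<le> 2 * \<delta>" using s0 uvs by (simp add: field_simps)
    then have "(1 / (real v * real s))\<^sup>2 \<le> 2 * \<delta>" by (simp add: power_divide)
    then show ?thesis by (rule real_le_rsqrt)
  qed
  have SA: "real e * (\<Sum>\<sigma>\<in>T. (?f A \<sigma>)\<^sup>2) \<le> (Phi q)\<^sup>2 * (2 * \<delta> * (4 * \<delta>\<^sup>2 + 2 * \<delta> / D + 2 * \<delta> * sqrt (2 * \<delta>) + 1 / Q))"
  proof -
    \<comment> \<open>Two bounds for 1/(st): st is the gcd of the denominators, hence at least
      \<open>D\<close>; and vst > Q. The first is good for the cross term with 2\<delta>; the second
      cancels the v in 1/(vs) and leaves 1/Q.\<close>
    define \<kappa> where "\<kappa> = min (1 / D) (real v / Q)"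
    have \<kappa>0: "\<kappa> \<ge> 0" using D Q by (simp add: \<kappa>_def)
    have \<kappa>: "1 / (real (sc e u v) * real (cof e r)) \<le> \<kappa>" if "r \<in> A" for r
    proof -
      have r: "r \<in> pairs e u v D" "Q < real (den (snd r))" using that by (auto simp: A_def)
      have st: "real (sc e u v) * real (cof e r) > 0" using pairs_facts(1,5)[OF r(1)] by simp
      have "D \<le> real (gd r)" using r(1) by (simp add: pairs_def)
      then have 1: "D \<le> real (sc e u v) * real (cof e r)" using pairs_facts(9)[OF r(1)] by simp
      have "Q < real v * (real (sc e u v) * real (cof e r))" using r(2) pairs_facts(8)[OF r(1)] by (simp add: mult_ac)
      then have 2: "1 / (real (sc e u v) * real (cof e r)) \<le> real v / Q" using st Q by (simp add: field_simps)
      have "1 / (real (sc e u v) * real (cof e r)) \<le> 1 / D" by (rule divide_left_mono[OF 1]) (use st D in auto)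
      then show ?thesis using 2 by (simp add: \<kappa>_def)
    qed
    have sup: "?f A \<sigma> \<le> Phi q * (2 * \<delta> + \<kappa>) / real e" for \<sigma>
      using sup_wt_large[OF uvs \<kappa> \<kappa>0 AB(1)] unfolding e' .
    have M0: "Phi q * (2 * \<delta> + \<kappa>) / real e \<ge> 0" using P1 d0 \<kappa>0 e0 by simp
    have "(\<Sum>\<sigma>\<in>T. (?f A \<sigma>)\<^sup>2) \<le> Phi q * (2 * \<delta> + \<kappa>) / real e * sum wt A"
      by (rule sum_squares_fibres_le[OF fin(1) T(1) sup M0])
    also have "\<dots> \<le> Phi q * (2 * \<delta> + \<kappa>) / real e * W" using WAB M0 by (intro mult_left_mono)
    finally have "real e * (\<Sum>\<sigma>\<in>T. (?f A \<sigma>)\<^sup>2) \<le> Phi q * (2 * \<delta> + \<kappa>) * W"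
      using e0 by (simp add: field_simps)
    also have "\<dots> = (Phi q)\<^sup>2 * (2 * \<delta> * ((2 * \<delta> + \<kappa>) * (2 * \<delta> + 1 / (real v * real s))))"
      by (simp add: W_def power2_eq_square)
    also have "\<dots> \<le> (Phi q)\<^sup>2 * (2 * \<delta> * (4 * \<delta>\<^sup>2 + 2 * \<delta> / D + 2 * \<delta> * sqrt (2 * \<delta>) + 1 / Q))"
    proof (intro mult_left_mono)
      have "(2 * \<delta> + \<kappa>) * (2 * \<delta> + 1 / (real v * real s))
         = 4 * \<delta>\<^sup>2 + 2 * \<delta> * \<kappa> + 2 * \<delta> * (1 / (real v * real s)) + \<kappa> * (1 / (real v * real s))"
        by (simp add: algebra_simps power2_eq_square add_divide_distrib)
      moreover have "2 * \<delta> * \<kappa> \<le> 2 * \<delta> * (1 / D)" using d0 by (intro mult_left_mono) (auto simp: \<kappa>_def)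
      moreover have "2 * \<delta> * (1 / (real v * real s)) \<le> 2 * \<delta> * sqrt (2 * \<delta>)" using vs d0 by (intro mult_left_mono) auto
      moreover have "\<kappa> * (1 / (real v * real s)) \<le> 1 / Q"
      proof -
        have "\<kappa> * (1 / (real v * real s)) \<le> real v / Q * (1 / (real v * real s))"
          by (intro mult_right_mono) (auto simp: \<kappa>_def)
        also have "\<dots> = 1 / Q / real s" using s0 by (simp add: field_simps)
        also have "\<dots> \<le> 1 / Q" using s0 Q by (simp add: field_simps)
        finally show ?thesis .
      qed
      ultimately show "(2 * \<delta> + \<kappa>) * (2 * \<delta> + 1 / (real v * real s)) \<le> 4 * \<delta>\<^sup>2 + 2 * \<delta> / D + 2 * \<delta> * sqrt (2 * \<delta>) + 1 / Q"
        by simp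
    qed (use d0 in auto)
    finally show ?thesis .
  qed
  have SB: "real e * (\<Sum>\<sigma>\<in>T. (?f B \<sigma>)\<^sup>2) \<le> (Phi q)\<^sup>2 * (24 * \<delta> ^ 4 * Q\<^sup>2 / D)"
  proof -
    \<comment> \<open>The three lower bounds available for the cofactor t: it is positive, st is at
      least \<open>D\<close>, and vst is a denominator of an element of \<open>S\<close>, hence at
      least 1/\<delta>.\<close>
    define \<tau> where "\<tau> = max 1 (max (D / real s) (1 / (\<delta> * (real v * real s))))"
    have \<tau>0: "\<tau> \<ge> 1" by (simp add: \<tau>_def)
    have \<tau>1: "real s * \<tau> \<ge> D"
    proof -
      have "D / real s \<le> \<tau>" by (simp add: \<tau>_def)
      then show ?thesis using s0 by (simp add: field_simps)
    qed
    have \<tau>2: "\<delta> * (real v * real s * \<tau>) \<ge> 1"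
    proof -
      have "1 / (\<delta> * (real v * real s)) \<le> \<tau>" by (simp add: \<tau>_def)
      then show ?thesis using s0 d0 by (simp add: field_simps)
    qed
    have \<tau>: "\<tau> \<le> real (cof e r)" if "r \<in> B" for r
    proof -
      have r: "r \<in> pairs e u v D" using that by (auto simp: B_def)
      have "D \<le> real (gd r)" using r(1) by (simp add: pairs_def)
      then have "D \<le> real s * real (cof e r)" using pairs_facts(9)[OF r(1)] by (simp add: s_def)
      then have 1: "D / real s \<le> real (cof e r)" using s0 by (simp add: field_simps)
      have "1 \<le> real (den (snd r)) * \<delta>" using S_den_ge pairs_S[OF r] by blast
      then have "1 \<le> real (cof e r) * (\<delta> * (real v * real s))" using pairs_facts(8)[OF r] by (simp add: s_def mult_ac)
      then have 2: "1 / (\<delta> * (real v * real s)) \<le> real (cof e r)"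
        using s0 d0 by (subst pos_divide_le_eq) auto
      have "real (cof e r) \<ge> 1" using pairs_facts(5)[OF r] by simp
      with 1 2 show ?thesis by (simp add: \<tau>_def)
    qed
    \<comment> \<open>Because u \<le> v, the first denominator never exceeds the second, so the
      bound \<open>Q\<close> on the second controls both numerators.\<close>
    have small: "real (den (fst r)) \<le> Q \<and> real (den (snd r)) \<le> Q" if "r \<in> B" for r
    proof -
      have r: "r \<in> pairs e u v D" "real (den (snd r)) \<le> Q" using that by (auto simp: B_def)
      have "den (fst r) \<le> den (snd r)" unfolding pairs_facts(7,8)[OF r(1)] using uv by (intro mult_right_mono) auto
      then show ?thesis using r(2) by linarith
    qed
    define M where "M = (2 * \<delta> * Q)\<^sup>2 / (real (u * v * s * s) * \<tau>\<^sup>2)"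
    have sup: "?f B \<sigma> \<le> M" if "\<sigma> \<in> T" for \<sigma>
      unfolding M_def s_def using that T(2) \<tau>0
      by (intro sup_wt_small[OF uvs Q small _ _ AB(2)]) (use \<tau> in auto)
    have M0: "M \<ge> 0" by (simp add: M_def)
    have "(\<Sum>\<sigma>\<in>T. (?f B \<sigma>)\<^sup>2) \<le> M * sum wt B"
      by (rule sum_squares_fibres_le[OF fin(2) T(1) sup M0])
    also have "\<dots> \<le> M * W" using WAB M0 by (intro mult_left_mono)
    finally have "real e * (\<Sum>\<sigma>\<in>T. (?f B \<sigma>)\<^sup>2) \<le> real e * (M * W)" using e0 by simp
    also have "\<dots> = Phi q * (8 * \<delta> ^ 3 * Q\<^sup>2) * (2 * \<delta> / (real s * \<tau> * \<tau>) + 1 / ((real s * \<tau>) * (real v * real s * \<tau>)))"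
      unfolding e M_def W_def using s0 \<tau>0 by (simp add: field_simps power2_eq_square power3_eq_cube)
    \<comment> \<open>The three properties of \<tau> give s \<tau>^2 \<ge> D and (s \<tau>)(v s
      \<tau>) \<ge> D/\<delta>. The bracket is thus at most 3 \<delta>/D, and 8 times 3 is the 24 in
      \<open>gain\<close>.\<close>
    also have "\<dots> \<le> Phi q * (8 * \<delta> ^ 3 * Q\<^sup>2) * (2 * \<delta> / D + \<delta> / D)"
    proof (intro mult_left_mono add_mono)
      have "D * 1 \<le> real s * \<tau> * \<tau>" using \<tau>0 \<tau>1 D by (intro mult_mono) auto
      then show "2 * \<delta> / (real s * \<tau> * \<tau>) \<le> 2 * \<delta> / D" using d0 D
        by (intro divide_left_mono) (auto intro!: mult_pos_pos simp: s0 \<tau>0 less_le_trans[OF zero_less_one])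
      have "D * 1 \<le> (real s * \<tau>) * (\<delta> * (real v * real s * \<tau>))" using \<tau>2 \<tau>1 D by (intro mult_mono) auto
      then have "D \<le> \<delta> * ((real s * \<tau>) * (real v * real s * \<tau>))" by (simp add: mult_ac)
      moreover have "(real s * \<tau>) * (real v * real s * \<tau>) > 0" using s0 \<tau>0 by (auto intro!: mult_pos_pos)
      ultimately show "1 / ((real s * \<tau>) * (real v * real s * \<tau>)) \<le> \<delta> / D"
        using D by (simp add: pos_divide_le_eq pos_le_divide_eq field_simps)
    qed (use P1 d0 Q in auto)
    also have "\<dots> = Phi q * (24 * \<delta> ^ 4 * Q\<^sup>2 / D)"
      using D by (simp add: field_simps power3_eq_cube power4_eq_xxxx)
    also have "\<dots> \<le> (Phi q)\<^sup>2 * (24 * \<delta> ^ 4 * Q\<^sup>2 / D)"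
      using P1 D by (intro mult_right_mono) (auto simp: power2_eq_square)
    finally show ?thesis .
  qed
  have "(\<Sum>\<sigma>\<in>T. (?f (pairs e u v D) \<sigma>)\<^sup>2) \<le> (\<Sum>\<sigma>\<in>T. 2 * (?f A \<sigma>)\<^sup>2 + 2 * (?f B \<sigma>)\<^sup>2)"
  proof (rule sum_mono)
    fix \<sigma>
    show "(?f (pairs e u v D) \<sigma>)\<^sup>2 \<le> 2 * (?f A \<sigma>)\<^sup>2 + 2 * (?f B \<sigma>)\<^sup>2"
      unfolding split using sum_squares_bound[of "?f A \<sigma>" "?f B \<sigma>"] by (simp add: power2_sum)
  qed
  also have "\<dots> = 2 * (\<Sum>\<sigma>\<in>T. (?f A \<sigma>)\<^sup>2) + 2 * (\<Sum>\<sigma>\<in>T. (?f B \<sigma>)\<^sup>2)"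
    by (simp add: sum.distrib sum_distrib_left)
  finally have "real e * (\<Sum>\<sigma>\<in>T. (?f (pairs e u v D) \<sigma>)\<^sup>2)
     \<le> real e * (2 * (\<Sum>\<sigma>\<in>T. (?f A \<sigma>)\<^sup>2) + 2 * (\<Sum>\<sigma>\<in>T. (?f B \<sigma>)\<^sup>2))"
    using e0 by simp
  also have "\<dots> = 2 * (real e * (\<Sum>\<sigma>\<in>T. (?f A \<sigma>)\<^sup>2)) + 2 * (real e * (\<Sum>\<sigma>\<in>T. (?f B \<sigma>)\<^sup>2))"
    by (simp add: algebra_simps)
  also have "\<dots> \<le> (Phi q)\<^sup>2 * gain D Q"
  proof -
    have "(Phi q)\<^sup>2 * (2 * (x + y)) = 2 * ((Phi q)\<^sup>2 * x) + 2 * ((Phi q)\<^sup>2 * y)" for x y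
      by (simp add: algebra_simps)
    then show ?thesis unfolding gain_def using SA SB by (simp only:)
  qed
  finally show ?thesis .
qed

text \<open>Exchanging the two entries preserves weight, gcd and sum; this removes the restriction u
  \<le> v from the second moment bound.\<close>

lemma pairs_swap: "sum wt {r \<in> pairs e u v D. fst r + snd r = \<sigma>} = sum wt {r \<in> pairs e v u D. fst r + snd r = \<sigma>}"
  by (rule sum.reindex_bij_witness[where i = prod.swap and j = prod.swap])
     (auto simp: pairs_def gd_def gcd.commute add.commute wt_def mult.commute)

text \<open>The value at 0 is set to 0: cancelling pairs are split off beforehand.\<close>

definition corr :: "real \<Rightarrow> real \<Rightarrow> real" where
  "corr D \<sigma> = (if \<sigma> = 0 then 0 else sum wt {r \<in> S \<times> S. fst r + snd r = \<sigma> \<and> D \<le> real (gd r)})"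

lemma corr_nonneg: "corr D \<sigma> \<ge> 0"
  by (auto simp: corr_def intro!: sum_nonneg wt_nonneg)

text \<open>Each pair with sum \<sigma> determines u and v with u v dividing e, so
  \<open>corr\<close> is a sum over at most 3^\<omega>(e) splittings, \<omega>(e) being the number
  of primes of e. Cauchy-Schwarz moves the square inside at the cost of that number.\<close>

lemma corr_square_le:
  assumes "\<sigma> \<noteq> 0" "den \<sigma> = e" "e dvd q"
  shows "(corr D \<sigma>)\<^sup>2 \<le> 3 ^ card (prime_factors e) *
    (\<Sum>(u, v)\<in>{(u, v). u * v dvd e}. (sum wt {r \<in> pairs e u v D. fst r + snd r = \<sigma>})\<^sup>2)"
proof -
  have sqe: "squarefree e" using assms sqf squarefree_mono by blast
  let ?P = "{(u, v). u * v dvd e}"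
  let ?\<Omega> = "{r \<in> S \<times> S. fst r + snd r = \<sigma> \<and> D \<le> real (gd r)}"
  let ?g = "\<lambda>r. (den (fst r) div gd r, den (snd r) div gd r)"
  let ?f = "\<lambda>p. sum wt {r \<in> pairs e (fst p) (snd p) D. fst r + snd r = \<sigma>}"
  note P = card_coprime_splittings[OF sqe]
  have "sum wt ?\<Omega> = (\<Sum>p\<in>?P. sum wt {r. r \<in> ?\<Omega> \<and> ?g r = p})"
  proof (rule sum.group[symmetric])
    show "finite ?\<Omega>" by (rule finite_subset[of _ "S \<times> S"]) (use finite_S in auto)
    show "?g ` ?\<Omega> \<subseteq> ?P"
    proof clarify
      fix a b assume ab: "a \<in> S" "b \<in> S" "D \<le> real (gd (a, b))" "\<sigma> = fst (a, b) + snd (a, b)"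
      then have "(a, b) \<in> pairs e (den a div gd (a, b)) (den b div gd (a, b)) D"
        using assms by (auto simp: pairs_def)
      from pairs_facts(4)[OF this]
      show "den (fst (a, b)) div gd (a, b) * (den (snd (a, b)) div gd (a, b)) dvd e" by (metis dvd_triv_left fst_conv snd_conv)
    qed
  qed (rule P(1))
  also have "\<dots> = (\<Sum>p\<in>?P. ?f p)"
    using assms by (intro sum.cong refl arg_cong[where f = "sum wt"]) (auto simp: pairs_def)
  finally have "(corr D \<sigma>)\<^sup>2 = (\<Sum>p\<in>?P. ?f p)\<^sup>2" using assms by (simp add: corr_def)
  also have "\<dots> \<le> (sqrt (real (3 ^ card (prime_factors e)) * (\<Sum>p\<in>?P. (?f p)\<^sup>2)))\<^sup>2"
    by (intro power_mono sum_le_sqrt_card P sum_nonneg wt_nonneg)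
  also have "\<dots> = 3 ^ card (prime_factors e) * (\<Sum>p\<in>?P. (?f p)\<^sup>2)"
    by (simp add: sum_nonneg)
  finally show ?thesis by (simp add: case_prod_beta)
qed

text \<open>One factor 3^\<omega>(e) is the cost of Cauchy-Schwarz over the splittings, the other is
  the number of splittings, each bounded uniformly. Together they have the form
  \<open>b ^ (2 * card (prime_factors e))\<close> with b = 3 that the fundamental lemma
  admits.\<close>

theorem corr_second_moment:
  assumes D: "D \<ge> 1" and Q: "Q > 0" and e: "e dvd q"
  shows "real e * (\<Sum>\<sigma>\<in>{x \<in> torsion q. den x = e}. (corr D \<sigma>)\<^sup>2)
    \<le> (Phi q)\<^sup>2 * gain D Q * 3 ^ (2 * card (prime_factors e))"
proof -
  have sqe: "squarefree e" using e sqf squarefree_mono by blast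
  let ?P = "{(u, v). u * v dvd e}" and ?w = "3 ^ card (prime_factors e) :: real"
  let ?T = "{x \<in> torsion q. den x = e} - {0}"
  let ?f = "\<lambda>p \<sigma>. sum wt {r \<in> pairs e (fst p) (snd p) D. fst r + snd r = \<sigma>}"
  note P = card_coprime_splittings[OF sqe]
  have finT: "finite ?T" using finite_torsion[OF q0] by simp
  have "(\<Sum>\<sigma>\<in>{x \<in> torsion q. den x = e}. (corr D \<sigma>)\<^sup>2) = (\<Sum>\<sigma>\<in>?T. (corr D \<sigma>)\<^sup>2)"
    by (rule sum.mono_neutral_right) (use finite_torsion[OF q0] in \<open>auto simp: corr_def\<close>)
  also have "\<dots> \<le> (\<Sum>\<sigma>\<in>?T. ?w * (\<Sum>p\<in>?P. (?f p \<sigma>)\<^sup>2))"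
    using corr_square_le[OF _ _ e, of _ D] by (intro sum_mono) (auto simp: case_prod_beta)
  also have "\<dots> = ?w * (\<Sum>p\<in>?P. \<Sum>\<sigma>\<in>?T. (?f p \<sigma>)\<^sup>2)"
    by (subst sum.swap) (simp add: sum_distrib_left)
  finally have "real e * (\<Sum>\<sigma>\<in>{x \<in> torsion q. den x = e}. (corr D \<sigma>)\<^sup>2)
     \<le> real e * (?w * (\<Sum>p\<in>?P. \<Sum>\<sigma>\<in>?T. (?f p \<sigma>)\<^sup>2))" by (intro mult_left_mono) auto
  also have "\<dots> = ?w * (\<Sum>p\<in>?P. real e * (\<Sum>\<sigma>\<in>?T. (?f p \<sigma>)\<^sup>2))"
    by (simp add: sum_distrib_left mult_ac)
  also have "\<dots> \<le> ?w * (\<Sum>p\<in>?P. (Phi q)\<^sup>2 * gain D Q)"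
  proof (intro mult_left_mono sum_mono)
    fix p assume "p \<in> ?P"
    show "real e * (\<Sum>\<sigma>\<in>?T. (?f p \<sigma>)\<^sup>2) \<le> (Phi q)\<^sup>2 * gain D Q"
    proof (cases "fst p \<le> snd p")
      case True
      then show ?thesis using second_moment_pairs[OF _ D Q finT] by simp
    next
      case False
      then have "snd p \<le> fst p" by simp
      then show ?thesis using second_moment_pairs[OF _ D Q finT] pairs_swap[of e "fst p" "snd p"] by simp
    qed
  qed auto
  also have "\<dots> = ?w * (real (card ?P) * ((Phi q)\<^sup>2 * gain D Q))" by simp
  also have "\<dots> \<le> ?w * (?w * ((Phi q)\<^sup>2 * gain D Q))"
  proof (intro mult_left_mono mult_right_mono)
    show "real (card ?P) \<le> ?w" using P(2) by (metis of_nat_le_iff of_nat_numeral of_nat_power)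
  qed (use gain_nonneg[OF D Q] in auto)
  also have "\<dots> = (Phi q)\<^sup>2 * gain D Q * 3 ^ (2 * card (prime_factors e))"
    by (simp add: mult_2 power_add mult_ac)
  finally show ?thesis .
qed

end

section \<open>Matchings\<close>

text \<open>Matchings of an arbitrary index set, because the induction deletes matched pairs and the
  remaining indices no longer form an initial segment.\<close>

definition matchings_on :: "nat set \<Rightarrow> (nat \<times> nat) set set" where
  "matchings_on I =
    {\<sigma>. \<sigma> \<subseteq> {(i, j). i \<in> I \<and> j \<in> I \<and> i < j} \<and>
         (\<forall>m\<in>I. \<exists>!p. p \<in> \<sigma> \<and> (m = fst p \<or> m = snd p))}"

definition compatible :: "nat set \<Rightarrow> (nat \<Rightarrow> real) \<Rightarrow> (nat \<times> nat) set set" where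
  "compatible I x = {\<sigma> \<in> matchings_on I. \<forall>p\<in>\<sigma>. x (fst p) + x (snd p) \<in> \<int>}"

lemma finite_matchings_on: "finite I \<Longrightarrow> finite (matchings_on I)"
  by (rule finite_subset[of _ "Pow (I \<times> I)"]) (auto simp: matchings_on_def)

lemma matchings_on_D:
  assumes "\<sigma> \<in> matchings_on I" "p \<in> \<sigma>"
  shows "fst p \<in> I" "snd p \<in> I" "fst p < snd p"
  using assms by (auto simp: matchings_on_def)

lemma matchings_on_unique:
  assumes "\<sigma> \<in> matchings_on I" "p \<in> \<sigma>" "p' \<in> \<sigma>" "m = fst p \<or> m = snd p" "m = fst p' \<or> m = snd p'"
  shows "p = p'"
proof -
  have "m \<in> I" using matchings_on_D[OF assms(1,2)] assms(4) by auto
  then have "\<exists>!p. p \<in> \<sigma> \<and> (m = fst p \<or> m = snd p)" using assms(1) by (auto simp: matchings_on_def)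
  then show ?thesis using assms(2-5) by metis
qed

lemma matchings_on_partner:
  assumes "\<sigma> \<in> matchings_on I" "m \<in> I"
  obtains p where "p \<in> \<sigma>" "m = fst p \<or> m = snd p"
proof -
  have "\<exists>!p. p \<in> \<sigma> \<and> (m = fst p \<or> m = snd p)" using assms unfolding matchings_on_def by blast
  then show ?thesis using that by (elim ex1E) blast
qed

lemma matchings_on_remove:
  assumes \<sigma>: "\<sigma> \<in> matchings_on I" and p: "(i, j) \<in> \<sigma>"
  shows "\<sigma> - {(i, j)} \<in> matchings_on (I - {i, j})"
proof -
  have "p \<in> {(a, b). a \<in> I - {i, j} \<and> b \<in> I - {i, j} \<and> a < b}" if p': "p \<in> \<sigma> - {(i, j)}" for p
  proof -
    have pm: "p \<in> \<sigma>" "p \<noteq> (i, j)" using p' by auto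
    have "m \<notin> {i, j}" if "m = fst p \<or> m = snd p" for m
    proof
      assume "m \<in> {i, j}"
      then have "m = fst (i, j) \<or> m = snd (i, j)" by simp
      from matchings_on_unique[OF \<sigma> pm(1) p that this] pm(2) show False by simp
    qed
    then have "fst p \<notin> {i, j}" "snd p \<notin> {i, j}" by simp_all
    then show ?thesis using matchings_on_D[OF \<sigma> pm(1)] by (simp add: case_prod_beta)
  qed
  then have "\<sigma> - {(i, j)} \<subseteq> {(a, b). a \<in> I - {i, j} \<and> b \<in> I - {i, j} \<and> a < b}" by (rule subsetI)
  moreover have "\<exists>!p. p \<in> \<sigma> - {(i, j)} \<and> (m = fst p \<or> m = snd p)" if m: "m \<in> I - {i, j}" for m
  proof -
    obtain p where p': "p \<in> \<sigma>" "m = fst p \<or> m = snd p" using matchings_on_partner[OF \<sigma>] m by blast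
    then have "p \<noteq> (i, j)" using m by auto
    show ?thesis
    proof (rule ex1I[of _ p])
      fix p'' assume "p'' \<in> \<sigma> - {(i, j)} \<and> (m = fst p'' \<or> m = snd p'')"
      then have "p'' \<in> \<sigma>" "m = fst p'' \<or> m = snd p''" by simp_all
      then show "p'' = p" using matchings_on_unique[OF \<sigma> _ p'(1) _ p'(2)] by blast
    qed (use p' \<open>p \<noteq> (i, j)\<close> in simp)
  qed
  ultimately show ?thesis unfolding matchings_on_def by simp
qed

lemma matchings_on_insert:
  assumes \<sigma>: "\<sigma> \<in> matchings_on (I - {i, j})" and ij: "i \<in> I" "j \<in> I" "i < j"
  shows "insert (i, j) \<sigma> \<in> matchings_on I"
proof -
  have "insert (i, j) \<sigma> \<subseteq> {(a, b). a \<in> I \<and> b \<in> I \<and> a < b}"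
    using matchings_on_D[OF \<sigma>] ij by auto
  moreover have "\<exists>!p. p \<in> insert (i, j) \<sigma> \<and> (m = fst p \<or> m = snd p)" if m: "m \<in> I" for m
  proof (cases "m \<in> {i, j}")
    case True
    then show ?thesis using matchings_on_D[OF \<sigma>] by (intro ex1I[of _ "(i, j)"]) auto
  next
    case False
    then obtain p where p': "p \<in> \<sigma>" "m = fst p \<or> m = snd p" using matchings_on_partner[OF \<sigma>] m by blast
    show ?thesis
    proof (rule ex1I[of _ p])
      fix p' assume "p' \<in> insert (i, j) \<sigma> \<and> (m = fst p' \<or> m = snd p')"
      then have "p' \<in> \<sigma>" "m = fst p' \<or> m = snd p'" using False by auto
      then show "p' = p" using matchings_on_unique[OF \<sigma> _ p'(1) _ p'(2)] by blast
    qed (use p' in simp)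
  qed
  ultimately show ?thesis unfolding matchings_on_def by simp
qed

lemma compatible_cong:
  assumes "\<And>m. m \<in> I \<Longrightarrow> x m = y m"
  shows "compatible I x = compatible I y"
  using assms matchings_on_D by (fastforce simp: compatible_def)

lemma compatible_empty: "compatible {} x = {{}}"
  by (auto simp: compatible_def matchings_on_def)

text \<open>In a compatible matching a partner l of i satisfies x_l = -x_i = x_j modulo 1. If no
  third index carries the value x_j, then i can only be matched with j, so adding (i, j) identifies
  the compatible matchings of the remaining indices with those of \<open>I\<close>.\<close>

lemma not_unique_matching_cases:
  assumes I: "finite I" and x: "\<And>m. m \<in> I \<Longrightarrow> x m \<in> torsion q"
    and ij: "i \<in> I" "j \<in> I" "i < j" "x i + x j \<in> \<int>" and bad: "card (compatible I x) \<noteq> 1"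
  shows "card (compatible (I - {i, j}) x) \<noteq> 1 \<or> (\<exists>l\<in>I - {i, j}. x l = x j)"
proof (rule ccontr)
  assume neg: "\<not> ?thesis"
  then obtain \<sigma> where \<sigma>: "compatible (I - {i, j}) x = {\<sigma>}" by (auto simp: card_1_singleton_iff)
  then have \<sigma>m: "\<sigma> \<in> matchings_on (I - {i, j})" and \<sigma>c: "\<forall>p\<in>\<sigma>. x (fst p) + x (snd p) \<in> \<int>"
    by (auto simp: compatible_def)
  have "compatible I x = {insert (i, j) \<sigma>}"
  proof (intro equalityI subsetI)
    fix \<rho> assume "\<rho> \<in> {insert (i, j) \<sigma>}"
    then show "\<rho> \<in> compatible I x"
      using matchings_on_insert[OF \<sigma>m ij(1-3)] \<sigma>c ij(4) by (auto simp: compatible_def)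
  next
    fix \<rho> assume \<rho>: "\<rho> \<in> compatible I x"
    then have \<rho>m: "\<rho> \<in> matchings_on I" and \<rho>c: "\<forall>p\<in>\<rho>. x (fst p) + x (snd p) \<in> \<int>"
      by (auto simp: compatible_def)
    have "(i, j) \<in> \<rho>"
    proof (rule ccontr)
      assume nij: "(i, j) \<notin> \<rho>"
      obtain p where p: "p \<in> \<rho>" "i = fst p \<or> i = snd p" using matchings_on_partner[OF \<rho>m ij(1)] by blast
      define l where "l = (if i = fst p then snd p else fst p)"
      have pl: "p = (i, l) \<or> p = (l, i)" using p(2) by (auto simp: l_def prod_eq_iff)
      have l: "l \<in> I" "l \<noteq> i" "x i + x l \<in> \<int>"
        using matchings_on_D[OF \<rho>m p(1)] pl \<rho>c p(1) by (auto simp: add.commute)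
      have "l \<noteq> j" using pl nij p(1) matchings_on_D(3)[OF \<rho>m p(1)] ij(3) by auto
      have "x l - x j \<in> \<int>" using Ints_diff[OF l(3) ij(4)] by simp
      then have "x l = x j" using torsion_eqI[OF x[OF l(1)] x[OF ij(2)]] by blast
      then show False using neg l \<open>l \<noteq> j\<close> by blast
    qed
    then have "\<rho> - {(i, j)} \<in> compatible (I - {i, j}) x"
      using matchings_on_remove[OF \<rho>m] \<rho>c by (auto simp: compatible_def)
    then have "\<rho> - {(i, j)} = \<sigma>" using \<sigma> by simp
    then show "\<rho> \<in> {insert (i, j) \<sigma>}" using \<open>(i, j) \<in> \<rho>\<close> by auto
  qed
  then show False using bad by simp
qed

text \<open>When the pair sums to an integer by itself, the other entries again form a zero-sum
  tuple, so the pair and the rest vary independently up to the side condition \<open>P\<close>. The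
  condition \<open>P\<close> serves non-uniqueness of matchings, coincidences of entries and the
  other pairs of a matching alike.\<close>

lemma sum_zsum_pair:
  fixes c :: "nat \<Rightarrow> real \<Rightarrow> 'a :: comm_semiring_1"
  assumes "finite K" "finite X" and ij: "i \<noteq> j" "i \<notin> K" "j \<notin> K"
  shows "(\<Sum>x\<in>{x \<in> zsum (insert i (insert j K)) X. x i + x j \<in> \<int> \<and> P x}. \<Prod>m\<in>insert i (insert j K). c m (x m))
    = (\<Sum>x\<in>zsum K X. \<Sum>r\<in>{r \<in> X \<times> X. fst r + snd r \<in> \<int> \<and> P (x(j := snd r, i := fst r))}.
         c i (fst r) * c j (snd r) * (\<Prod>m\<in>K. c m (x m)))"
proof -
  let ?R = "\<lambda>x. {r \<in> X \<times> X. fst r + snd r \<in> \<int> \<and> P (x(j := snd r, i := fst r))}"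
  have sumK: "(\<Sum>m\<in>K. (x(j := v, i := u)) m) = (\<Sum>m\<in>K. x m)" for x and u v :: real
    using ij by (intro sum.cong) auto
  have "(\<Sum>x\<in>{x \<in> zsum (insert i (insert j K)) X. x i + x j \<in> \<int> \<and> P x}. \<Prod>m\<in>insert i (insert j K). c m (x m))
    = (\<Sum>(x, r)\<in>Sigma (zsum K X) ?R. c i (fst r) * c j (snd r) * (\<Prod>m\<in>K. c m (x m)))"
  proof (rule sum.reindex_bij_witness[where i = "\<lambda>(x, r). x(j := snd r, i := fst r)" and j = "\<lambda>x. (restrict x K, (x i, x j))"])
    fix x assume x: "x \<in> {x \<in> zsum (insert i (insert j K)) X. x i + x j \<in> \<int> \<and> P x}"
    then have xP: "x \<in> insert i (insert j K) \<rightarrow>\<^sub>E X" and xs: "x i + x j + (\<Sum>m\<in>K. x m) \<in> \<int>" and xij: "x i + x j \<in> \<int>" and Px: "P x"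
      using assms by (auto simp: zsum_def algebra_simps)
    have eq: "(restrict x K)(j := x j, i := x i) = x"
      using xP by (auto simp: fun_eq_iff PiE_iff extensional_def)
    show "(case (restrict x K, x i, x j) of (x, r) \<Rightarrow> x(j := snd r, i := fst r)) = x" using eq by simp
    have "(\<Sum>m\<in>K. x m) \<in> \<int>" using Ints_diff[OF xs xij] by simp
    then show "(restrict x K, x i, x j) \<in> Sigma (zsum K X) ?R"
      using xP xij Px eq by (auto simp: zsum_def PiE_iff)
    show "(case (restrict x K, x i, x j) of (x, r) \<Rightarrow> c i (fst r) * c j (snd r) * (\<Prod>m\<in>K. c m (x m))) = (\<Prod>m\<in>insert i (insert j K). c m (x m))"
      using assms by (simp add: mult.assoc)
  next
    fix b assume "b \<in> Sigma (zsum K X) ?R"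
    then obtain x u v where b: "b = (x, (u, v))" "x \<in> zsum K X" "u \<in> X" "v \<in> X" "u + v \<in> \<int>" "P (x(j := v, i := u))" by auto
    let ?y = "x(j := v, i := u)"
    have y: "?y i = u" "?y j = v" using ij by auto
    have xK: "x \<in> K \<rightarrow>\<^sub>E X" "(\<Sum>m\<in>K. x m) \<in> \<int>" using b by (auto simp: zsum_def)
    have res: "restrict ?y K = x" using xK(1) ij by (auto simp: fun_eq_iff PiE_iff extensional_def)
    show "(\<lambda>x. (restrict x K, x i, x j)) (case b of (x, r) \<Rightarrow> x(j := snd r, i := fst r)) = b"
      using res y b(1) by simp
    have "(\<Sum>m\<in>insert i (insert j K). ?y m) = (u + v) + (\<Sum>m\<in>K. x m)"
      using assms sumK[of x v u] y by (simp add: algebra_simps del: fun_upd_apply)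
    also have "\<dots> \<in> \<int>" using b(5) xK(2) by (rule Ints_add)
    finally have "(\<Sum>m\<in>insert i (insert j K). ?y m) \<in> \<int>" .
    moreover have "?y \<in> insert i (insert j K) \<rightarrow>\<^sub>E X" using xK(1) b by (auto simp: PiE_iff extensional_def)
    ultimately show "(case b of (x, r) \<Rightarrow> x(j := snd r, i := fst r)) \<in> {x \<in> zsum (insert i (insert j K)) X. x i + x j \<in> \<int> \<and> P x}"
      using b y unfolding zsum_def by (simp del: fun_upd_apply)
  qed
  also have "\<dots> = (\<Sum>x\<in>zsum K X. \<Sum>r\<in>?R x. c i (fst r) * c j (snd r) * (\<Prod>m\<in>K. c m (x m)))"
    using assms by (intro sum.Sigma[symmetric]) (auto simp: finite_zsum)
  finally show ?thesis .
qed

lemma sum_UN_le: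
  fixes f :: "'a \<Rightarrow> real"
  assumes "finite P" "\<And>p. p \<in> P \<Longrightarrow> finite (A p)" "\<And>x. f x \<ge> 0"
  shows "sum f (\<Union>p\<in>P. A p) \<le> (\<Sum>p\<in>P. sum f (A p))"
  using assms(1,2)
proof (induction P rule: finite_induct)
  case (insert p P)
  have "sum f (\<Union>p\<in>insert p P. A p) = sum f (A p \<union> (\<Union>p\<in>P. A p))" by simp
  also have "\<dots> \<le> sum f (A p) + sum f (\<Union>p\<in>P. A p)"
    using insert.prems insert.hyps assms(3) by (subst sum_Un) (auto intro!: sum_nonneg)
  also have "\<dots> \<le> sum f (A p) + (\<Sum>p\<in>P. sum f (A p))" using insert by auto
  finally show ?case using insert.hyps by simp
qed simp

section \<open>The exponents of Phi\<close>

text \<open>Expanding the product of 1 + b_i gives the sum over all subsets; the empty set and the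
  singletons are removed.\<close>

lemma sum_prod_card_ge2:
  fixes b :: "nat \<Rightarrow> real"
  assumes "finite I"
  shows "(\<Sum>J\<in>{J. J \<subseteq> I \<and> card J \<ge> 2}. \<Prod>j\<in>J. b j) = (\<Prod>i\<in>I. 1 + b i) - 1 - (\<Sum>i\<in>I. b i)"
proof -
  have fin: "finite (Pow I)" using assms by simp
  have "(\<Prod>i\<in>I. 1 + b i) = (\<Sum>J\<in>Pow I. \<Prod>j\<in>J. b j)"
    using prod_add[OF assms, of b "\<lambda>_. 1"] by (simp add: add.commute)
  also have "Pow I = {J. J \<subseteq> I \<and> card J \<ge> 2} \<union> ((\<lambda>i. {i}) ` I \<union> {{}})"
  proof -
    have "J \<in> {J. J \<subseteq> I \<and> card J \<ge> 2} \<union> ((\<lambda>i. {i}) ` I \<union> {{}})" if J: "J \<subseteq> I" for J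
    proof -
      have "finite J" using J assms finite_subset by blast
      then consider "J = {}" | "card J = 1" | "card J \<ge> 2" by (cases "card J") (auto simp: Suc_le_eq)
      then show ?thesis using J by cases (auto simp: card_1_singleton_iff)
    qed
    then show ?thesis by auto
  qed
  also have "(\<Sum>J\<in>{J. J \<subseteq> I \<and> card J \<ge> 2} \<union> ((\<lambda>i. {i}) ` I \<union> {{}}). \<Prod>j\<in>J. b j)
     = (\<Sum>J\<in>{J. J \<subseteq> I \<and> card J \<ge> 2}. \<Prod>j\<in>J. b j) + ((\<Sum>J\<in>(\<lambda>i. {i}) ` I. \<Prod>j\<in>J. b j) + 1)"
    using assms by (subst sum.union_disjoint, simp, simp, force, subst sum.union_disjoint) auto
  also have "(\<Sum>J\<in>(\<lambda>i. {i}) ` I. \<Prod>j\<in>J. b j) = (\<Sum>i\<in>I. b i)"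
    by (subst sum.reindex) auto
  finally show ?thesis by simp
qed

text \<open>The number of subsets of an \<open>n\<close>-element set with at least two elements.\<close>

definition ex2 :: "nat \<Rightarrow> nat" where
  "ex2 n = 2 ^ n - (n + 1)"

lemma Suc_le_power2: "n + 1 \<le> 2 ^ n"
  by (induction n) auto

lemma real_ex2: "real (ex2 n) = 2 ^ n - 1 - real n"
  unfolding ex2_def using Suc_le_power2[of n] by (simp add: of_nat_diff)

text \<open>Pays for the extra factor \<open>Phi q\<close> lost whenever a cancelling pair is split
  off.\<close>

lemma ex2_step:
  assumes "n \<ge> 2" shows "ex2 (n - 2) + 1 \<le> ex2 n"
proof -
  obtain m where n: "n = m + 2" using assms by (metis add.commute le_Suc_ex)
  have "1 \<le> (2::nat) ^ m" by simp
  moreover have "m + 1 \<le> 2 ^ m" by (rule Suc_le_power2)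
  ultimately show ?thesis unfolding n ex2_def by simp
qed

lemma gcd_mult_dvd_mult_gcd:
  fixes a b c :: nat
  shows "gcd a (b * c) dvd gcd a b * gcd a c"
proof -
  have "gcd a (b * c) dvd gcd (c * a) (c * b)" by (simp add: mult.commute)
  then have "gcd a (b * c) dvd gcd a b * c" unfolding gcd_mult_distrib_nat[symmetric] by (simp add: mult.commute)
  then have "gcd a (b * c) dvd gcd (gcd a b * a) (gcd a b * c)" by simp
  then show ?thesis unfolding gcd_mult_distrib_nat[symmetric] .
qed

lemma gcd_prod_dvd:
  fixes a :: nat
  assumes "finite J"
  shows "gcd a (\<Prod>j\<in>J. f j) dvd (\<Prod>j\<in>J. gcd a (f j))"
  using assms
proof (induction J rule: finite_induct)
  case (insert j J)
  have "gcd a (f j * (\<Prod>j\<in>J. f j)) dvd gcd a (f j) * gcd a (\<Prod>j\<in>J. f j)"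
    by (rule gcd_mult_dvd_mult_gcd)
  also have "\<dots> dvd gcd a (f j) * (\<Prod>j\<in>J. gcd a (f j))"
    by (intro mult_dvd_mono dvd_refl insert.IH)
  finally show ?case using insert.hyps by simp
qed simp

section \<open>Primitive tuples\<close>

context small_torsion
begin

text \<open>Models the coefficient of a small class, up to the size h of the exponential sum; 1/den
  replaces 1/totient, at the cost of one factor \<open>Phi q\<close> restored at the end.\<close>

definition rc :: "real \<Rightarrow> real" where
  "rc x = (if x \<in> S then 1 / real (den x) else 0)"

lemma rc_nonneg: "rc x \<ge> 0"
  by (simp add: rc_def)

lemma rc_le: "rc x \<le> \<delta>"
proof (cases "x \<in> S")
  case True
  then have "1 \<le> real (den x) * \<delta>" "real (den x) > 0" using S_den_ge S_den(2) by auto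
  then show ?thesis using True by (simp add: rc_def field_simps)
qed (use d0 in \<open>simp add: rc_def\<close>)

lemma sum_const_on_den:
  assumes "d > 0" "\<And>x. x \<in> A \<Longrightarrow> f x = c / real d" "finite A" "card A \<le> L * real d"
  shows "real d * (\<Sum>x\<in>A. (f x)\<^sup>2) \<le> L * c\<^sup>2"
proof -
  have "(\<Sum>x\<in>A. (f x)\<^sup>2) = real (card A) * (c / real d)\<^sup>2" using assms(2) by simp
  also have "\<dots> \<le> (L * real d) * (c / real d)\<^sup>2" using assms by (intro mult_right_mono) auto
  finally have "real d * (\<Sum>x\<in>A. (f x)\<^sup>2) \<le> real d * ((L * real d) * (c / real d)\<^sup>2)"
    by (intro mult_left_mono) auto
  also have "\<dots> = L * c\<^sup>2" using assms(1) by (simp add: field_simps power2_eq_square)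
  finally show ?thesis .
qed

text \<open>At most 2 \<delta> d elements of \<open>S\<close> have denominator d, and each
  contributes 1/d^2. The absence of a \<open>+ 1\<close> in the count makes the bound uniform in
  d.\<close>

lemma rc_second_moment:
  assumes "d dvd q"
  shows "real d * (\<Sum>x\<in>{x \<in> torsion q. den x = d}. (rc x)\<^sup>2) \<le> 2 * \<delta>"
proof -
  have d: "d > 0" using assms q0 by (meson dvd_pos_nat)
  let ?A = "{x \<in> S. den x = d}"
  have "(\<Sum>x\<in>{x \<in> torsion q. den x = d}. (rc x)\<^sup>2) = (\<Sum>x\<in>?A. (rc x)\<^sup>2)"
    by (rule sum.mono_neutral_right) (use finite_torsion[OF q0] in \<open>auto simp: rc_def S_def\<close>)
  moreover have "real d * (\<Sum>x\<in>?A. (rc x)\<^sup>2) \<le> 2 * \<delta> * 1\<^sup>2"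
  proof (rule sum_const_on_den[OF d])
    show "finite ?A" using finite_S by simp
    have "?A \<subseteq> {y. y \<noteq> 0 \<and> \<bar>y\<bar> \<le> \<delta> \<and> real d * y \<in> \<int>}" using S_den(1) by (auto simp: S_def)
    then have "card ?A \<le> card {y. y \<noteq> 0 \<and> \<bar>y\<bar> \<le> \<delta> \<and> real d * y \<in> \<int>}"
      using card_small_multiples(1)[OF d, of \<delta>] d0 by (intro card_mono) auto
    then show "real (card ?A) \<le> 2 * \<delta> * real d" using card_small_multiples(2)[OF d, of \<delta>] d0 by linarith
  qed (auto simp: rc_def)
  ultimately show ?thesis by simp
qed

text \<open>With all b equal to 1 the numerator in the Euler factor is the number of subsets with at
  least two elements.\<close>

lemma zsum_bound_unweighted:
  assumes "finite I" and N: "\<And>i. i \<in> I \<Longrightarrow> N i \<ge> 0" and H: "\<And>i x. H i x \<ge> 0"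
    and "\<And>i d. i \<in> I \<Longrightarrow> d dvd q \<Longrightarrow>
      real d * (\<Sum>x\<in>{x \<in> torsion q. den x = d}. (H i x)\<^sup>2) \<le> (N i)\<^sup>2"
  shows "(\<Sum>x\<in>zsum I (torsion q). \<Prod>i\<in>I. H i (x i)) \<le> (\<Prod>i\<in>I. N i) * Phi q ^ ex2 (card I)"
proof -
  have m: "(\<Sum>J\<in>{J. J \<subseteq> I \<and> card J \<ge> 2}. \<Prod>j\<in>J. 1) = real (ex2 (card I))"
    unfolding sum_prod_card_ge2[OF assms(1)] real_ex2 by simp
  have "(\<Sum>x\<in>zsum I (torsion q). \<Prod>i\<in>I. H i (x i)) \<le> (\<Prod>i\<in>I. N i) * (\<Prod>p\<in>prime_factors q. 1 + real (ex2 (card I)) / real p)"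
    using fundamental_lemma[OF sqf assms(1), of "\<lambda>_. 1" N H] assms unfolding m by simp
  also have "\<dots> \<le> (\<Prod>i\<in>I. N i) * Phi q ^ ex2 (card I)"
    using N by (intro mult_left_mono prod_prime_factors_le_Phi_power[OF sqf] prod_nonneg) auto
  finally show ?thesis .
qed

definition Z :: "nat set \<Rightarrow> real" where
  "Z I = (\<Sum>x\<in>zsum I (torsion q). \<Prod>i\<in>I. rc (x i))"

lemma Z_le:
  assumes "finite I" shows "Z I \<le> sqrt (2 * \<delta>) ^ card I * Phi q ^ ex2 (card I)"
  unfolding Z_def using zsum_bound_unweighted[OF assms, of "\<lambda>_. sqrt (2 * \<delta>)" "\<lambda>_. rc"] rc_second_moment rc_nonneg d0
  by simp

definition prim :: "nat set \<Rightarrow> (nat \<Rightarrow> real) \<Rightarrow> bool" where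
  "prim I x \<longleftrightarrow> (\<forall>i\<in>I. \<forall>j\<in>I. i \<noteq> j \<longrightarrow> x i + x j \<notin> \<int>)"

text \<open>In a zero-sum tuple the denominator of one entry divides the product of the others,
  hence the product of its gcds with them. If all these gcds were below \<open>D\<close>, the
  denominator would be at most D^(n-1) < 1/\<delta>, n being the number of entries, too small for an
  element of \<open>S\<close>.\<close>

lemma exists_large_gcd:
  assumes I: "finite I" and x: "x \<in> zsum I (torsion q)" and S: "\<And>i. i \<in> I \<Longrightarrow> x i \<in> S" and i0: "i0 \<in> I"
    and D: "D ^ (card I - 1) * \<delta> < 1" "D \<ge> 1"
  shows "\<exists>j\<in>I - {i0}. D \<le> real (gcd (den (x i0)) (den (x j)))"
proof (rule ccontr)
  assume neg: "\<not> ?thesis"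
  let ?J = "I - {i0}" and ?a = "den (x i0)"
  let ?P = "\<Prod>j\<in>?J. den (x j)"
  have sJ: "real ?P * (\<Sum>j\<in>?J. x j) \<in> \<int>"
    unfolding sum_distrib_left
  proof (rule Ints_sum)
    fix j assume j: "j \<in> ?J"
    then have "?P = (\<Prod>j\<in>?J - {j}. den (x j)) * den (x j)"
      using I by (subst prod.remove[of _ j]) auto
    then show "real ?P * x j \<in> \<int>"
      using mult_nat_Ints[OF S_den(1)[OF S], of j "\<Prod>j\<in>?J - {j}. den (x j)"] j by (simp add: mult.assoc)
  qed
  have "real ?P * (\<Sum>j\<in>I. x j) \<in> \<int>" using x by (intro mult_nat_Ints) (simp add: zsum_def)
  moreover have "(\<Sum>j\<in>I. x j) = x i0 + (\<Sum>j\<in>?J. x j)" using I i0 by (simp add: sum.remove)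
  ultimately have "real ?P * x i0 + real ?P * (\<Sum>j\<in>?J. x j) \<in> \<int>" by (simp add: algebra_simps)
  from Ints_diff[OF this sJ] have "real ?P * x i0 \<in> \<int>" by simp
  then have "?a dvd ?P" using den_dvd_iff[OF q0 S_torsion[OF S[OF i0]]] by blast
  then have "?a = gcd ?a ?P" by (simp add: gcd_proj1_iff)
  also have "\<dots> \<le> (\<Prod>j\<in>?J. gcd ?a (den (x j)))"
  proof (rule dvd_imp_le)
    show "gcd ?a ?P dvd (\<Prod>j\<in>?J. gcd ?a (den (x j)))" using I by (intro gcd_prod_dvd) auto
    show "0 < (\<Prod>j\<in>?J. gcd ?a (den (x j)))" using S_den(2)[OF S[OF i0]] by (intro prod_pos) auto
  qed
  finally have "real ?a \<le> (\<Prod>j\<in>?J. real (gcd ?a (den (x j))))" by (metis of_nat_le_iff of_nat_prod)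
  also have "\<dots> \<le> (\<Prod>j\<in>?J. D)" using neg by (intro prod_mono) force
  also have "\<dots> = D ^ (card I - 1)" using I i0 by (simp add: card_Diff_singleton)
  finally have "real ?a * \<delta> \<le> D ^ (card I - 1) * \<delta>" using d0 by (intro mult_right_mono) auto
  then show False using D S_den_ge[OF S[OF i0]] by linarith
qed

text \<open>Tuples are grouped by \<sigma> = x_i0 + x_j, which takes over the place i0 in a tuple
  shorter by one. No reduction modulo 1 is needed, since two elements of \<open>S\<close> add up to
  a representative in \<open>torsion q\<close>.\<close>

lemma merged_sum_eq:
  assumes K: "finite K" and ij: "i0 \<noteq> j" "i0 \<notin> K" "j \<notin> K"
  shows "(\<Sum>x\<in>{x \<in> zsum (insert i0 (insert j K)) (torsion q). x i0 + x j \<noteq> 0 \<and> D \<le> real (gcd (den (x i0)) (den (x j)))}.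
      \<Prod>m\<in>insert i0 (insert j K). rc (x m))
    = (\<Sum>x\<in>zsum (insert i0 K) (torsion q). \<Prod>m\<in>insert i0 K. (if m = i0 then corr D else rc) (x m))"
    (is "?L = ?R")
proof -
  let ?X = "torsion q"
  have finX: "finite ?X" by (rule finite_torsion[OF q0])
  let ?P = "\<lambda>u v. u + v \<noteq> 0 \<and> D \<le> real (gcd (den u) (den v))"
  have finP: "finite (insert i0 (insert j K) \<rightarrow>\<^sub>E ?X)" "finite (insert i0 K \<rightarrow>\<^sub>E ?X)" "finite (K \<rightarrow>\<^sub>E ?X)"
    using K finX by (auto intro: finite_PiE)
  have upd: "(\<Sum>m\<in>K. (x(j := v, i0 := u)) m) = (\<Sum>m\<in>K. x m)"
     "(\<Prod>m\<in>K. rc ((x(j := v, i0 := u)) m)) = (\<Prod>m\<in>K. rc (x m))"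
     "(x(j := v, i0 := u)) i0 = u" "(x(j := v, i0 := u)) j = v" for x and u v :: real
    using ij by (auto intro!: sum.cong prod.cong)
  have "?L = (\<Sum>x\<in>insert i0 (insert j K) \<rightarrow>\<^sub>E ?X. if (\<Sum>m\<in>insert i0 (insert j K). x m) \<in> \<int> \<and> ?P (x i0) (x j)
      then \<Prod>m\<in>insert i0 (insert j K). rc (x m) else 0)"
    using finP(1) by (subst sum.inter_filter[symmetric]) (auto simp: zsum_def intro!: sum.cong)
  also have "\<dots> = (\<Sum>x\<in>K \<rightarrow>\<^sub>E ?X. \<Sum>v\<in>?X. \<Sum>u\<in>?X. if u + (v + (\<Sum>m\<in>K. x m)) \<in> \<int> \<and> ?P u v
      then rc u * (rc v * (\<Prod>m\<in>K. rc (x m))) else 0)"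
    using ij K by (subst sum_PiE_insert, simp, subst sum_PiE_insert, simp)
      (intro sum.cong refl, simp add: upd del: fun_upd_apply)
  also have "\<dots> = (\<Sum>x\<in>K \<rightarrow>\<^sub>E ?X. \<Sum>\<sigma>\<in>?X. if \<sigma> + (\<Sum>m\<in>K. x m) \<in> \<int> then corr D \<sigma> * (\<Prod>m\<in>K. rc (x m)) else 0)"
  proof (rule sum.cong[OF refl])
    fix x
    let ?c = "\<Sum>m\<in>K. x m" and ?p = "\<Prod>m\<in>K. rc (x m)"
    have "(\<Sum>v\<in>?X. \<Sum>u\<in>?X. if u + (v + ?c) \<in> \<int> \<and> ?P u v then rc u * (rc v * ?p) else 0)
      = (\<Sum>u\<in>?X. \<Sum>v\<in>?X. if u + (v + ?c) \<in> \<int> \<and> ?P u v then rc u * (rc v * ?p) else 0)"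
      by (rule sum.swap)
    also have "\<dots> = (\<Sum>r\<in>?X \<times> ?X. if fst r + (snd r + ?c) \<in> \<int> \<and> ?P (fst r) (snd r) then rc (fst r) * (rc (snd r) * ?p) else 0)"
      by (simp add: sum.cartesian_product case_prod_beta)
    also have "\<dots> = (\<Sum>r\<in>S \<times> S. if fst r + (snd r + ?c) \<in> \<int> \<and> ?P (fst r) (snd r) then rc (fst r) * (rc (snd r) * ?p) else 0)"
      by (rule sum.mono_neutral_right) (use finX in \<open>auto simp: S_def rc_def\<close>)
    also have "\<dots> = (\<Sum>r\<in>S \<times> S. if fst r + (snd r + ?c) \<in> \<int> \<and> ?P (fst r) (snd r) then wt r * ?p else 0)"
      by (intro sum.cong refl) (auto simp: rc_def wt_def)
    also have "\<dots> = (\<Sum>\<sigma>\<in>?X. \<Sum>r\<in>{r. r \<in> S \<times> S \<and> fst r + snd r = \<sigma>}. if fst r + (snd r + ?c) \<in> \<int> \<and> ?P (fst r) (snd r) then wt r * ?p else 0)"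
    proof (rule sum.group[symmetric])
      show "(\<lambda>r. fst r + snd r) ` (S \<times> S) \<subseteq> ?X"
      proof clarify
        fix a b assume ab: "a \<in> S" "b \<in> S"
        have "real q * a + real q * b \<in> \<int>" using S_torsion ab by (intro Ints_add) auto
        then have "real q * (a + b) \<in> \<int>" by (simp add: algebra_simps)
        moreover have "\<bar>a\<bar> \<le> \<delta>" "\<bar>b\<bar> \<le> \<delta>" using ab by (auto simp: S_def)
        ultimately show "fst (a, b) + snd (a, b) \<in> ?X" using d4 by (auto simp: torsion_def)
      qed
    qed (use finX finite_S in auto)
    also have "\<dots> = (\<Sum>\<sigma>\<in>?X. if \<sigma> + ?c \<in> \<int> then corr D \<sigma> * ?p else 0)"
    proof (rule sum.cong[OF refl])
      fix \<sigma>
      have "(\<Sum>r\<in>{r. r \<in> S \<times> S \<and> fst r + snd r = \<sigma>}. if fst r + (snd r + ?c) \<in> \<int> \<and> ?P (fst r) (snd r) then wt r * ?p else 0)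
        = (\<Sum>r\<in>{r. r \<in> S \<times> S \<and> fst r + snd r = \<sigma>}. if D \<le> real (gd r) then if \<sigma> + ?c \<in> \<int> \<and> \<sigma> \<noteq> 0 then wt r * ?p else 0 else 0)"
        by (intro sum.cong refl) (auto simp: gd_def add.assoc)
      also have "\<dots> = (\<Sum>r\<in>{r \<in> {r. r \<in> S \<times> S \<and> fst r + snd r = \<sigma>}. D \<le> real (gd r)}. if \<sigma> + ?c \<in> \<int> \<and> \<sigma> \<noteq> 0 then wt r * ?p else 0)"
      proof (rule sum.inter_filter[symmetric])
        show "finite {r. r \<in> S \<times> S \<and> fst r + snd r = \<sigma>}"
          by (rule finite_subset[of _ "S \<times> S"]) (use finite_S in auto)
      qed
      also have "{r \<in> {r. r \<in> S \<times> S \<and> fst r + snd r = \<sigma>}. D \<le> real (gd r)} = {r \<in> S \<times> S. fst r + snd r = \<sigma> \<and> D \<le> real (gd r)}"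
        by auto
      also have "(\<Sum>r\<in>\<dots>. if \<sigma> + ?c \<in> \<int> \<and> \<sigma> \<noteq> 0 then wt r * ?p else 0) = (if \<sigma> + ?c \<in> \<int> then corr D \<sigma> * ?p else 0)"
        by (simp add: corr_def sum_distrib_right)
      finally show "(\<Sum>r\<in>{r. r \<in> S \<times> S \<and> fst r + snd r = \<sigma>}. if fst r + (snd r + ?c) \<in> \<int> \<and> ?P (fst r) (snd r) then wt r * ?p else 0)
        = (if \<sigma> + ?c \<in> \<int> then corr D \<sigma> * ?p else 0)" .
    qed
    finally show "(\<Sum>v\<in>?X. \<Sum>u\<in>?X. if u + (v + ?c) \<in> \<int> \<and> ?P u v then rc u * (rc v * ?p) else 0)
      = (\<Sum>\<sigma>\<in>?X. if \<sigma> + ?c \<in> \<int> then corr D \<sigma> * ?p else 0)" .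
  qed
  also have "\<dots> = ?R"
  proof -
    have upd': "(\<Sum>m\<in>K. (x(i0 := u)) m) = (\<Sum>m\<in>K. x m)"
       "(\<Prod>m\<in>K. (if m = i0 then corr D else rc) ((x(i0 := u)) m)) = (\<Prod>m\<in>K. rc (x m))" "(x(i0 := u)) i0 = u" for x and u :: real
      using ij by (auto intro!: sum.cong prod.cong)
    have "?R = (\<Sum>x\<in>insert i0 K \<rightarrow>\<^sub>E ?X. if (\<Sum>m\<in>insert i0 K. x m) \<in> \<int> then \<Prod>m\<in>insert i0 K. (if m = i0 then corr D else rc) (x m) else 0)"
      using K finX by (intro sum_zsum) auto
    also have "\<dots> = (\<Sum>x\<in>K \<rightarrow>\<^sub>E ?X. \<Sum>u\<in>?X. if (\<Sum>m\<in>insert i0 K. (x(i0 := u)) m) \<in> \<int> then \<Prod>m\<in>insert i0 K. (if m = i0 then corr D else rc) ((x(i0 := u)) m) else 0)"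
      by (rule sum_PiE_insert[OF ij(2)])
    also have "\<dots> = (\<Sum>x\<in>K \<rightarrow>\<^sub>E ?X. \<Sum>u\<in>?X. if u + (\<Sum>m\<in>K. x m) \<in> \<int> then corr D u * (\<Prod>m\<in>K. rc (x m)) else 0)"
      unfolding sum.insert[OF K ij(2)] prod.insert[OF K ij(2)] upd' by simp
    finally show ?thesis by simp
  qed
  finally show ?thesis .
qed

text \<open>Every primitive tuple that counts has a partner j of i0 with gcd at least
  \<open>D\<close>, and their sum is nonzero by primitivity. For each j the two entries are merged
  and the fundamental lemma is applied with \<open>corr D\<close> at i0 and \<open>rc\<close>
  elsewhere; the factor n is the number of possible j.\<close>

lemma primitive_sum_le:
  assumes I: "finite I" "card I = n" "n \<ge> 3" and D: "D ^ (n - 1) * \<delta> < 1" "D \<ge> 1" and Q: "Q > 0"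
  shows "(\<Sum>x\<in>{x \<in> zsum I (torsion q). prim I x}. \<Prod>i\<in>I. rc (x i))
    \<le> real n * (sqrt (gain D Q) * sqrt (2 * \<delta>) ^ (n - 2) * Phi q ^ ex2 n)"
proof -
  let ?X = "torsion q"
  have finX: "finite ?X" by (rule finite_torsion[OF q0])
  have finZ: "finite (zsum I ?X)" by (rule finite_zsum[OF I(1) finX])
  obtain i0 where i0: "i0 \<in> I" using I by fastforce
  let ?f = "\<lambda>x. \<Prod>i\<in>I. rc (x i)"
  have f0: "?f x \<ge> 0" for x by (intro prod_nonneg) (simp add: rc_nonneg)
  let ?A = "\<lambda>j. {x \<in> zsum I ?X. x i0 + x j \<noteq> 0 \<and> D \<le> real (gcd (den (x i0)) (den (x j)))}"
  have "(\<Sum>x\<in>{x \<in> zsum I ?X. prim I x}. ?f x) = (\<Sum>x\<in>{x \<in> zsum I ?X. prim I x \<and> (\<forall>i\<in>I. x i \<in> S)}. ?f x)"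
  proof (rule sum.mono_neutral_right)
    show "\<forall>x\<in>{x \<in> zsum I ?X. prim I x} - {x \<in> zsum I ?X. prim I x \<and> (\<forall>i\<in>I. x i \<in> S)}. ?f x = 0"
      using I(1) by (auto simp: prod_zero_iff rc_def)
  qed (use finZ in auto)
  also have "\<dots> \<le> sum ?f (\<Union>j\<in>I - {i0}. ?A j)"
  proof (rule sum_mono2)
    show "finite (\<Union>j\<in>I - {i0}. ?A j)" using finZ I by auto
    show "{x \<in> zsum I ?X. prim I x \<and> (\<forall>i\<in>I. x i \<in> S)} \<subseteq> (\<Union>j\<in>I - {i0}. ?A j)"
    proof
      fix x assume "x \<in> {x \<in> zsum I ?X. prim I x \<and> (\<forall>i\<in>I. x i \<in> S)}"
      then have x: "x \<in> zsum I ?X" "prim I x" "\<And>i. i \<in> I \<Longrightarrow> x i \<in> S" by auto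
      obtain j where j: "j \<in> I - {i0}" "D \<le> real (gcd (den (x i0)) (den (x j)))"
        using exists_large_gcd[OF I(1) x(1,3) i0, of D] D I(2) by auto
      have "x i0 + x j \<notin> \<int>" using x(2)[unfolded prim_def, rule_format, OF i0, of j] j(1) by simp
      then have "x i0 + x j \<noteq> 0" by auto
      then show "x \<in> (\<Union>j\<in>I - {i0}. ?A j)" using x j by auto
    qed
  qed (use f0 in auto)
  also have "\<dots> \<le> (\<Sum>j\<in>I - {i0}. sum ?f (?A j))"
    using I finZ f0 by (intro sum_UN_le) auto
  also have "\<dots> \<le> (\<Sum>j\<in>I - {i0}. sqrt (gain D Q) * sqrt (2 * \<delta>) ^ (n - 2) * Phi q ^ ex2 n)"
  proof (rule sum_mono)
    fix j assume j: "j \<in> I - {i0}"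
    define K where "K = I - {i0, j}"
    have IK: "I = insert i0 (insert j K)" and ij: "i0 \<noteq> j" "i0 \<notin> K" "j \<notin> K" and finK: "finite K"
      using j i0 I by (auto simp: K_def)
    have cK: "card K = n - 2" using I IK ij finK by simp
    \<comment> \<open>The merged entry replaces two entries of weight 1, and 1 + 3 = (1 + 1)(1 + 1)
      keeps the product of the 1 + b_i at 2^n. The sum of the b_i is n + 1 rather than n, so the
      resulting exponent is \<open>ex2 n - 1\<close>; the power of \<open>Phi q\<close> gained pays
      for the factor \<open>Phi q\<close> in \<open>N i0\<close>.\<close>
    define b where "b = (\<lambda>i::nat. if i = i0 then 3 else 1 :: real)"
    define N where "N = (\<lambda>i::nat. if i = i0 then Phi q * sqrt (gain D Q) else sqrt (2 * \<delta>))"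
    define H where "H = (\<lambda>m::nat. if m = i0 then corr D else rc)"
    have P1: "Phi q \<ge> 1" by (rule Phi_ge_1[OF q0])
    have g0: "gain D Q \<ge> 0" by (rule gain_nonneg[OF D(2) Q])
    have m: "(\<Sum>J\<in>{J. J \<subseteq> insert i0 K \<and> card J \<ge> 2}. \<Prod>j\<in>J. b j) = real (ex2 n - 1)"
    proof -
      have "(\<Prod>i\<in>K. 1 + b i) = (\<Prod>i\<in>K. 2)" "(\<Sum>i\<in>K. b i) = (\<Sum>i\<in>K. 1)"
        by (rule prod.cong[OF refl], use ij in \<open>force simp: b_def\<close>)
           (rule sum.cong[OF refl], use ij in \<open>force simp: b_def\<close>)
      then have "(\<Prod>i\<in>K. 1 + b i) = 2 ^ (n - 2)" "(\<Sum>i\<in>K. b i) = real (n - 2)"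
        using cK by simp_all
      moreover have "finite (insert i0 K)" using finK by simp
      ultimately have "(\<Sum>J\<in>{J. J \<subseteq> insert i0 K \<and> card J \<ge> 2}. \<Prod>j\<in>J. b j) = 4 * 2 ^ (n - 2) - 1 - (3 + real (n - 2))"
        by (subst sum_prod_card_ge2) (use ij finK in \<open>auto simp: b_def\<close>)
      also have "4 * 2 ^ (n - 2) = (2 ^ n :: real)"
      proof -
        have "n - 2 + 2 = n" using I(3) by linarith
        then have "(2::real) ^ n = 2 ^ (n - 2) * 2 ^ 2" using power_add[of "2::real" "n - 2" 2] by presburger
        then show ?thesis by simp
      qed
      also have "2 ^ n - 1 - (3 + real (n - 2)) = real (ex2 n) - 1" using I(3) by (simp add: real_ex2 of_nat_diff)
      also have "\<dots> = real (ex2 n - 1)"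
      proof -
        have "ex2 n \<ge> 1" using ex2_step[of n] I(3) by simp
        then show ?thesis by (simp add: of_nat_diff)
      qed
      finally show ?thesis .
    qed
    have "sum ?f (?A j) = (\<Sum>x\<in>zsum (insert i0 K) ?X. \<Prod>m\<in>insert i0 K. H m (x m))"
      unfolding IK H_def by (rule merged_sum_eq[OF finK ij])
    also have "\<dots> \<le> (\<Prod>i\<in>insert i0 K. N i) * (\<Prod>p\<in>prime_factors q. 1 + (\<Sum>J\<in>{J. J \<subseteq> insert i0 K \<and> card J \<ge> 2}. \<Prod>j\<in>J. b j) / real p)"
    proof (rule fundamental_lemma[OF sqf])
      fix i d assume i: "i \<in> insert i0 K" and d: "d dvd q"
      show "real d * (\<Sum>x\<in>{x \<in> torsion q. den x = d}. (H i x)\<^sup>2) \<le> (N i)\<^sup>2 * b i ^ (2 * card (prime_factors d))"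
      proof (cases "i = i0")
        case True
        then show ?thesis using corr_second_moment[OF D(2) Q d] g0 by (simp add: H_def N_def b_def power_mult_distrib)
      next
        case False
        then show ?thesis using rc_second_moment[OF d] d0 by (simp add: H_def N_def b_def)
      qed
    qed (use finK P1 g0 d0 in \<open>auto simp: H_def N_def b_def corr_nonneg rc_nonneg\<close>)
    also have "\<dots> = (\<Prod>i\<in>insert i0 K. N i) * (\<Prod>p\<in>prime_factors q. 1 + real (ex2 n - 1) / real p)" unfolding m ..
    also have "\<dots> \<le> (\<Prod>i\<in>insert i0 K. N i) * Phi q ^ (ex2 n - 1)"
      using P1 g0 d0 by (intro mult_left_mono prod_prime_factors_le_Phi_power[OF sqf] prod_nonneg) (auto simp: N_def)
    also have "(\<Prod>i\<in>insert i0 K. N i) = Phi q * sqrt (gain D Q) * sqrt (2 * \<delta>) ^ (n - 2)"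
    proof -
      have "(\<Prod>i\<in>K. N i) = (\<Prod>i\<in>K. sqrt (2 * \<delta>))"
        by (rule prod.cong[OF refl]) (use ij in \<open>force simp: N_def\<close>)
      then have "(\<Prod>i\<in>K. N i) = sqrt (2 * \<delta>) ^ (n - 2)" using cK by simp
      then show ?thesis using ij finK by (simp add: N_def)
    qed
    also have "Phi q * sqrt (gain D Q) * sqrt (2 * \<delta>) ^ (n - 2) * Phi q ^ (ex2 n - 1)
       = sqrt (gain D Q) * sqrt (2 * \<delta>) ^ (n - 2) * Phi q ^ Suc (ex2 n - 1)" by simp
    also have "\<dots> \<le> sqrt (gain D Q) * sqrt (2 * \<delta>) ^ (n - 2) * Phi q ^ ex2 n"
    proof (intro mult_left_mono power_increasing)
      have "ex2 n \<ge> 1" using ex2_step[of n] I(3) by simp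
      then show "Suc (ex2 n - 1) \<le> ex2 n" by simp
    qed (use P1 g0 d0 in auto)
    finally show "sum ?f (?A j) \<le> sqrt (gain D Q) * sqrt (2 * \<delta>) ^ (n - 2) * Phi q ^ ex2 n" .
  qed
  also have "\<dots> = real (card (I - {i0})) * (sqrt (gain D Q) * sqrt (2 * \<delta>) ^ (n - 2) * Phi q ^ ex2 n)" by simp
  also have "\<dots> \<le> real n * (sqrt (gain D Q) * sqrt (2 * \<delta>) ^ (n - 2) * Phi q ^ ex2 n)"
  proof (intro mult_right_mono)
    show "real (card (I - {i0})) \<le> real n" using I i0 by (simp add: card_Diff_singleton)
    have "Phi q \<ge> 1" by (rule Phi_ge_1[OF q0])
    then show "0 \<le> sqrt (gain D Q) * sqrt (2 * \<delta>) ^ (n - 2) * Phi q ^ ex2 n"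
      using gain_nonneg[OF D(2) Q] d0 by simp
  qed
  finally show ?thesis .
qed

end

section \<open>Tuples without a unique matching\<close>

text \<open>Mirrors the case distinction for tuples without a unique matching: n for the primitive
  ones, and for each of at most n^2 pairs either the recursive case or one of at most n
  coincidences.\<close>

fun recur_const :: "nat \<Rightarrow> real" where
  "recur_const n = (if n = 0 then 0 else real n + (real n)\<^sup>2 * (recur_const (n - 2) + real n))"

declare recur_const.simps [simp del]

lemma recur_const_nonneg: "recur_const n \<ge> 0"
  by (induction n rule: recur_const.induct) (subst recur_const.simps, auto)

context small_torsion
begin

definition U :: "nat set \<Rightarrow> real" where
  "U I = (\<Sum>x\<in>{x \<in> zsum I (torsion q). card (compatible I x) \<noteq> 1}. \<Prod>i\<in>I. rc (x i))"

text \<open>The bound for \<open>Z\<close> with two entries, where a zero-sum tuple is the same as a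
  cancelling pair and \<open>ex2 2 = 1\<close>.\<close>

lemma rc_pair_sum_le:
  "(\<Sum>r\<in>{r \<in> torsion q \<times> torsion q. fst r + snd r \<in> \<int>}. rc (fst r) * rc (snd r)) \<le> 2 * \<delta> * Phi q"
proof -
  have finX: "finite (torsion q)" by (rule finite_torsion[OF q0])
  have "(\<Sum>x\<in>{x \<in> zsum {0, 1} (torsion q). x 0 + x 1 \<in> \<int> \<and> True}. \<Prod>m\<in>{0, 1}. rc (x m))
     = (\<Sum>x\<in>zsum {} (torsion q). \<Sum>r\<in>{r \<in> torsion q \<times> torsion q. fst r + snd r \<in> \<int> \<and> True}. rc (fst r) * rc (snd r) * (\<Prod>m\<in>{}. rc (x m)))"
    by (rule sum_zsum_pair) (use finX in auto)
  moreover have "{x \<in> zsum {0, 1} (torsion q). x 0 + x 1 \<in> \<int> \<and> True} = zsum {0, 1} (torsion q)"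
    by (auto simp: zsum_def)
  ultimately have "(\<Sum>r\<in>{r \<in> torsion q \<times> torsion q. fst r + snd r \<in> \<int>}. rc (fst r) * rc (snd r)) = Z {0, 1}"
    unfolding Z_def by (simp add: zsum_empty)
  also have "\<dots> \<le> sqrt (2 * \<delta>) ^ 2 * Phi q ^ 1"
  proof -
    have c: "card {0, 1::nat} = 2" "ex2 2 = 1" by (auto simp: ex2_def)
    show ?thesis using Z_le[of "{0, 1}"] unfolding c by simp
  qed
  finally show ?thesis using d0 by simp
qed

text \<open>Here \<theta> is the saving over the bound \<open>sqrt (2 * \<delta>) ^ n\<close> for
  all zero-sum tuples. One entry must be 0, where \<open>rc\<close> vanishes, and two entries always
  cancel, so only n \<ge> 3 needs the merged bound.\<close>

lemma primitive_sum_le':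
  assumes I: "finite I" "card I = n" "n \<ge> 1" and D: "n \<ge> 3 \<Longrightarrow> D ^ (n - 1) * \<delta> < 1" "D \<ge> 1" and Q: "Q > 0"
    and \<theta>: "sqrt (gain D Q) \<le> 2 * \<delta> * \<theta>" "\<theta> \<ge> 0"
  shows "(\<Sum>x\<in>{x \<in> zsum I (torsion q). prim I x}. \<Prod>i\<in>I. rc (x i)) \<le> real n * (\<theta> * sqrt (2 * \<delta>) ^ n * Phi q ^ ex2 n)"
proof -
  have P1: "Phi q \<ge> 1" by (rule Phi_ge_1[OF q0])
  have rhs0: "0 \<le> real n * (\<theta> * sqrt (2 * \<delta>) ^ n * Phi q ^ ex2 n)" using P1 d0 \<theta> by simp
  consider "n = 1" | "n = 2" | "n \<ge> 3" using I(3) by linarith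
  then show ?thesis
  proof cases
    case 1
    then obtain i where i: "I = {i}" using I by (auto simp: card_1_singleton_iff)
    have "rc (x i) = 0" if "x \<in> zsum {i} (torsion q)" for x
    proof -
      have "x i \<in> torsion q" "x i \<in> \<int>" using that by (auto simp: zsum_def)
      then have "x i = 0" using torsion_Ints_iff by blast
      then show ?thesis by (simp add: rc_def S_def)
    qed
    then have "(\<Sum>x\<in>{x \<in> zsum I (torsion q). prim I x}. \<Prod>i\<in>I. rc (x i)) = 0" unfolding i by simp
    then show ?thesis using rhs0 by simp
  next
    case 2
    then obtain i j where ij: "I = {i, j}" "i \<noteq> j" using I by (auto simp: card_2_iff)
    have "{x \<in> zsum I (torsion q). prim I x} = {}" using ij by (auto simp: zsum_def prim_def)
    then show ?thesis using rhs0 by (simp only: sum.empty)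
  next
    case 3
    have n2: "n - 2 + 2 = n" using 3 by linarith
    have "(\<Sum>x\<in>{x \<in> zsum I (torsion q). prim I x}. \<Prod>i\<in>I. rc (x i))
        \<le> real n * (sqrt (gain D Q) * sqrt (2 * \<delta>) ^ (n - 2) * Phi q ^ ex2 n)"
      by (rule primitive_sum_le[OF I(1,2) 3 D(1)[OF 3] D(2) Q])
    also have "\<dots> \<le> real n * ((2 * \<delta> * \<theta>) * sqrt (2 * \<delta>) ^ (n - 2) * Phi q ^ ex2 n)"
      using \<theta> P1 d0 by (intro mult_left_mono mult_right_mono) auto
    also have "(2 * \<delta> * \<theta>) * sqrt (2 * \<delta>) ^ (n - 2) = \<theta> * (sqrt (2 * \<delta>) ^ (n - 2) * sqrt (2 * \<delta>) ^ 2)"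
      using d0 by simp
    also have "sqrt (2 * \<delta>) ^ (n - 2) * sqrt (2 * \<delta>) ^ 2 = sqrt (2 * \<delta>) ^ n"
      unfolding power_add[symmetric] n2 ..
    finally show ?thesis .
  qed
qed

text \<open>Either the tuple is primitive, or it has a cancelling pair. Then removing the pair
  leaves a tuple that again lacks a unique matching, handled by induction, or some third entry
  repeats the value x_j. In each case the factor \<theta> is saved; for repetitions this is where
  \<delta> \<le> \<theta> enters.\<close>

lemma U_le:
  assumes "finite I" "card I = n" "n \<le> k" and D: "D ^ (k - 1) * \<delta> < 1" "D \<ge> 1" and Q: "Q > 0"
    and \<theta>: "sqrt (gain D Q) \<le> 2 * \<delta> * \<theta>" "\<delta> \<le> \<theta>"
  shows "U I \<le> recur_const n * (\<theta> * sqrt (2 * \<delta>) ^ n * Phi q ^ ex2 n)"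
  using assms(1-3)
proof (induction n arbitrary: I rule: less_induct)
  case (less n I)
  note I = less.prems
  let ?X = "torsion q"
  have P1: "Phi q \<ge> 1" by (rule Phi_ge_1[OF q0])
  have t0: "\<theta> \<ge> 0" using \<theta>(2) d0 by simp
  have finX: "finite ?X" by (rule finite_torsion[OF q0])
  have finZ: "finite (zsum I ?X)" by (rule finite_zsum[OF I(1) finX])
  let ?f = "\<lambda>x. \<Prod>i\<in>I. rc (x i)"
  have f0: "?f x \<ge> 0" for x by (intro prod_nonneg) (simp add: rc_nonneg)
  define B where "B = \<theta> * sqrt (2 * \<delta>) ^ n * Phi q ^ ex2 n"
  have B0: "B \<ge> 0" using t0 P1 d0 by (simp add: B_def)
  show ?case
  proof (cases "n = 0")
    case True
    then have "I = {}" using I by simp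
    then have "U I = 0" by (simp add: U_def compatible_empty)
    then show ?thesis using recur_const_nonneg[of n] B0 by (simp add: B_def)
  next
    case False
    define Pr where "Pr = {(i, j). i \<in> I \<and> j \<in> I \<and> i < j}"
    have Prsub: "Pr \<subseteq> I \<times> I" by (auto simp: Pr_def)
    have finPr: "finite Pr" using I(1) Prsub finite_subset by blast
    have cardPr: "real (card Pr) \<le> (real n)\<^sup>2"
    proof -
      have "card Pr \<le> card (I \<times> I)" using Prsub I(1) by (intro card_mono) auto
      also have "\<dots> = n\<^sup>2" using I(2) by (simp add: card_cartesian_product power2_eq_square)
      finally show ?thesis by (metis of_nat_le_iff of_nat_power)
    qed
    define A1 where "A1 p = {x \<in> zsum I ?X. x (fst p) + x (snd p) \<in> \<int> \<and> card (compatible (I - {fst p, snd p}) x) \<noteq> 1}" for p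
    define A2 where "A2 p l = {x \<in> zsum I ?X. x (fst p) + x (snd p) \<in> \<int> \<and> x l = x (snd p)}" for p l
    let ?P0 = "{x \<in> zsum I ?X. prim I x}"
    have finA: "finite (A1 p)" "finite (A2 p l)" for p l using finZ by (auto simp: A1_def A2_def)
    have cover: "{x \<in> zsum I ?X. card (compatible I x) \<noteq> 1}
        \<subseteq> ?P0 \<union> ((\<Union>p\<in>Pr. A1 p) \<union> (\<Union>p\<in>Pr. \<Union>l\<in>I - {fst p, snd p}. A2 p l))"
    proof
      fix x assume x: "x \<in> {x \<in> zsum I ?X. card (compatible I x) \<noteq> 1}"
      then have xm: "\<And>m. m \<in> I \<Longrightarrow> x m \<in> ?X" by (auto simp: zsum_def)
      show "x \<in> ?P0 \<union> ((\<Union>p\<in>Pr. A1 p) \<union> (\<Union>p\<in>Pr. \<Union>l\<in>I - {fst p, snd p}. A2 p l))"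
      proof (cases "prim I x")
        case True then show ?thesis using x by simp
      next
        case False
        then obtain a b where ab: "a \<in> I" "b \<in> I" "a \<noteq> b" "x a + x b \<in> \<int>" by (auto simp: prim_def)
        define i j where "i = min a b" and "j = max a b"
        have ij: "i \<in> I" "j \<in> I" "i < j" "x i + x j \<in> \<int>" using ab by (auto simp: i_def j_def min_def max_def add.commute)
        then have pr: "(i, j) \<in> Pr" by (simp add: Pr_def)
        have "card (compatible (I - {i, j}) x) \<noteq> 1 \<or> (\<exists>l\<in>I - {i, j}. x l = x j)"
          by (rule not_unique_matching_cases[OF I(1) xm ij]) (use x in auto)
        then show ?thesis
        proof
          assume "card (compatible (I - {i, j}) x) \<noteq> 1"
          then have "x \<in> A1 (i, j)" using x ij by (simp add: A1_def)
          then show ?thesis using pr by blast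
        next
          assume "\<exists>l\<in>I - {i, j}. x l = x j"
          then obtain l where l: "l \<in> I - {i, j}" "x l = x j" by blast
          then have "x \<in> A2 (i, j) l" using x ij by (simp add: A2_def)
          then have "x \<in> (\<Union>l\<in>I - {fst (i, j), snd (i, j)}. A2 (i, j) l)" using l(1) by auto
          then show ?thesis using pr by blast
        qed
      qed
    qed
    have union: "sum ?f (A' \<union> B') \<le> sum ?f A' + sum ?f B'" if "finite A'" "finite B'" for A' B'
      using that f0 by (subst sum_Un) (auto intro!: sum_nonneg)
    have "U I \<le> sum ?f (?P0 \<union> ((\<Union>p\<in>Pr. A1 p) \<union> (\<Union>p\<in>Pr. \<Union>l\<in>I - {fst p, snd p}. A2 p l)))"
      unfolding U_def by (rule sum_mono2[OF _ cover f0]) (use finZ finA finPr I(1) in auto)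
    also have "\<dots> \<le> sum ?f ?P0 + sum ?f ((\<Union>p\<in>Pr. A1 p) \<union> (\<Union>p\<in>Pr. \<Union>l\<in>I - {fst p, snd p}. A2 p l))"
      by (rule union) (use finZ finA finPr I(1) in auto)
    also have "\<dots> \<le> sum ?f ?P0 + (sum ?f (\<Union>p\<in>Pr. A1 p) + sum ?f (\<Union>p\<in>Pr. \<Union>l\<in>I - {fst p, snd p}. A2 p l))"
      by (intro add_left_mono union) (use finZ finA finPr I(1) in auto)
    also have "\<dots> \<le> sum ?f ?P0 + ((\<Sum>p\<in>Pr. sum ?f (A1 p)) + (\<Sum>p\<in>Pr. sum ?f (\<Union>l\<in>I - {fst p, snd p}. A2 p l)))"
      by (intro add_left_mono add_mono sum_UN_le) (use finA finPr I(1) f0 in auto)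
    also have "\<dots> \<le> sum ?f ?P0 + ((\<Sum>p\<in>Pr. sum ?f (A1 p)) + (\<Sum>p\<in>Pr. \<Sum>l\<in>I - {fst p, snd p}. sum ?f (A2 p l)))"
      by (intro add_left_mono sum_mono sum_UN_le) (use finA finPr I(1) f0 in auto)
    also have "\<dots> \<le> real n * B + ((\<Sum>p\<in>Pr. recur_const (n - 2) * B) + (\<Sum>p\<in>Pr. \<Sum>l\<in>I - {fst p, snd p}. B))"
    proof (intro add_mono sum_mono)
      have "D ^ (n - 1) * \<delta> < 1"
      proof -
        have "D ^ (n - 1) * \<delta> \<le> D ^ (k - 1) * \<delta>" using I(3) D(2) d0 by (intro mult_right_mono power_increasing) auto
        then show ?thesis using D(1) by linarith
      qed
      then show "sum ?f ?P0 \<le> real n * B"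
        unfolding B_def using False by (intro primitive_sum_le'[OF I(1,2) _ _ D(2) Q \<theta>(1) t0]) auto
    next
      fix p assume "p \<in> Pr"
      then obtain i j where p: "p = (i, j)" "i \<in> I" "j \<in> I" "i < j" by (auto simp: Pr_def)
      define K where "K = I - {i, j}"
      have IK: "I = insert i (insert j K)" and ij: "i \<noteq> j" "i \<notin> K" "j \<notin> K" and finK: "finite K"
        using p I(1) by (auto simp: K_def)
      have n2: "n \<ge> 2" and cK: "card K = n - 2" using I(2) IK ij finK by auto
      have n22: "n - 2 + 2 = n" using n2 by linarith
      have e2: "ex2 (n - 2) + 1 \<le> ex2 n" by (rule ex2_step[OF n2])
      have Pe: "Phi q ^ ex2 (n - 2) * Phi q \<le> Phi q ^ ex2 n"
        using power_increasing[OF e2 P1] by (simp add: mult.commute)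
      have sq: "sqrt (2 * \<delta>) ^ (n - 2) * (2 * \<delta>) = sqrt (2 * \<delta>) ^ n"
      proof -
        have "sqrt (2 * \<delta>) ^ (n - 2) * sqrt (2 * \<delta>) ^ 2 = sqrt (2 * \<delta>) ^ n" unfolding power_add[symmetric] n22 ..
        then show ?thesis using d0 by simp
      qed
      have fx0: "(\<Prod>m\<in>K. rc (x m)) \<ge> 0" for x by (intro prod_nonneg) (simp add: rc_nonneg)
      let ?R = "{r \<in> ?X \<times> ?X. fst r + snd r \<in> \<int>}"
      have finR: "finite ?R" by (rule finite_subset[of _ "?X \<times> ?X"]) (use finX in auto)
      {
        have "sum ?f (A1 p) = (\<Sum>x\<in>{x \<in> zsum (insert i (insert j K)) ?X. x i + x j \<in> \<int> \<and> card (compatible K x) \<noteq> 1}. \<Prod>m\<in>insert i (insert j K). rc (x m))"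
          unfolding A1_def p(1) fst_conv snd_conv K_def[symmetric] using IK by simp
        also have "\<dots> = (\<Sum>x\<in>zsum K ?X. \<Sum>r\<in>{r \<in> ?X \<times> ?X. fst r + snd r \<in> \<int> \<and> card (compatible K (x(j := snd r, i := fst r))) \<noteq> 1}.
            rc (fst r) * rc (snd r) * (\<Prod>m\<in>K. rc (x m)))"
          by (rule sum_zsum_pair[OF finK finX ij])
        also have "\<dots> = (\<Sum>x\<in>zsum K ?X. if card (compatible K x) \<noteq> 1 then (\<Sum>r\<in>?R. rc (fst r) * rc (snd r)) * (\<Prod>m\<in>K. rc (x m)) else 0)"
        proof (rule sum.cong[OF refl])
          fix x
          have cc: "compatible K (x(j := v, i := u)) = compatible K x" for u v
            using ij by (intro compatible_cong) auto
          show "(\<Sum>r\<in>{r \<in> ?X \<times> ?X. fst r + snd r \<in> \<int> \<and> card (compatible K (x(j := snd r, i := fst r))) \<noteq> 1}.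
            rc (fst r) * rc (snd r) * (\<Prod>m\<in>K. rc (x m)))
            = (if card (compatible K x) \<noteq> 1 then (\<Sum>r\<in>?R. rc (fst r) * rc (snd r)) * (\<Prod>m\<in>K. rc (x m)) else 0)"
            unfolding cc by (auto simp: sum_distrib_right)
        qed
        also have "\<dots> = (\<Sum>x\<in>{x \<in> zsum K ?X. card (compatible K x) \<noteq> 1}. (\<Sum>r\<in>?R. rc (fst r) * rc (snd r)) * (\<Prod>m\<in>K. rc (x m)))"
          by (rule sum.inter_filter[symmetric]) (rule finite_zsum[OF finK finX])
        also have "\<dots> = (\<Sum>r\<in>?R. rc (fst r) * rc (snd r)) * U K" by (simp add: U_def sum_distrib_left)
        also have "\<dots> \<le> (2 * \<delta> * Phi q) * (recur_const (n - 2) * (\<theta> * sqrt (2 * \<delta>) ^ (n - 2) * Phi q ^ ex2 (n - 2)))"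
        proof (intro mult_mono)
          show "(\<Sum>r\<in>?R. rc (fst r) * rc (snd r)) \<le> 2 * \<delta> * Phi q" by (rule rc_pair_sum_le)
          show "U K \<le> recur_const (n - 2) * (\<theta> * sqrt (2 * \<delta>) ^ (n - 2) * Phi q ^ ex2 (n - 2))"
            using n2 I(3) by (intro less.IH[OF _ finK cK]) auto
          show "0 \<le> U K" unfolding U_def by (intro sum_nonneg fx0)
        qed (use d0 P1 in auto)
        also have "\<dots> = recur_const (n - 2) * (\<theta> * (sqrt (2 * \<delta>) ^ (n - 2) * (2 * \<delta>)) * (Phi q ^ ex2 (n - 2) * Phi q))"
          by (simp add: mult_ac)
        also have "\<dots> \<le> recur_const (n - 2) * B"
          unfolding B_def sq using Pe t0 d0 by (intro mult_left_mono recur_const_nonneg) auto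
        finally show "sum ?f (A1 p) \<le> recur_const (n - 2) * B" .
      }
      fix l assume "l \<in> I - {fst p, snd p}"
      then have l: "l \<in> K" using p by (simp add: K_def)
      have "sum ?f (A2 p l) = (\<Sum>x\<in>{x \<in> zsum (insert i (insert j K)) ?X. x i + x j \<in> \<int> \<and> x l = x j}. \<Prod>m\<in>insert i (insert j K). rc (x m))"
        unfolding A2_def p(1) fst_conv snd_conv using IK by simp
      also have "\<dots> = (\<Sum>x\<in>zsum K ?X. \<Sum>r\<in>{r \<in> ?X \<times> ?X. fst r + snd r \<in> \<int> \<and> (x(j := snd r, i := fst r)) l = (x(j := snd r, i := fst r)) j}.
          rc (fst r) * rc (snd r) * (\<Prod>m\<in>K. rc (x m)))"
        by (rule sum_zsum_pair[OF finK finX ij])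
      \<comment> \<open>The entry x_l fixes both members of the pair, x_j = x_l and x_i = -x_l, so
        the pair contributes at most \<delta>^2 instead of the 2 \<delta> of a free cancelling
        pair.\<close>
      also have "\<dots> \<le> (\<Sum>x\<in>zsum K ?X. \<delta>\<^sup>2 * (\<Prod>m\<in>K. rc (x m)))"
      proof (rule sum_mono)
        fix x
        let ?r = "(cen (- x l), x l)"
        let ?T = "{r \<in> ?X \<times> ?X. fst r + snd r \<in> \<int> \<and> (x(j := snd r, i := fst r)) l = (x(j := snd r, i := fst r)) j}"
        have sub: "?T \<subseteq> {?r}"
        proof
          fix r assume r: "r \<in> ?T"
          have lij: "l \<noteq> i" "l \<noteq> j" using l ij by auto
          then have s: "snd r = x l" using r ij by auto
          have "fst r \<in> ?X" "fst r - (- x l) \<in> \<int>" using r s by auto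
          then have "fst r = cen (- x l)" using cen_cong cen_torsion by metis
          then show "r \<in> {?r}" using s by (simp add: prod_eq_iff)
        qed
        have "(\<Sum>r\<in>?T. rc (fst r) * rc (snd r) * (\<Prod>m\<in>K. rc (x m))) \<le> (\<Sum>r\<in>{?r}. rc (fst r) * rc (snd r) * (\<Prod>m\<in>K. rc (x m)))"
          using fx0 rc_nonneg by (intro sum_mono2 sub) auto
        also have "\<dots> = rc (cen (- x l)) * rc (x l) * (\<Prod>m\<in>K. rc (x m))" by simp
        also have "\<dots> \<le> (\<delta> * \<delta>) * (\<Prod>m\<in>K. rc (x m))"
          using rc_le rc_nonneg d0 fx0 by (intro mult_right_mono mult_mono) auto
        finally show "(\<Sum>r\<in>?T. rc (fst r) * rc (snd r) * (\<Prod>m\<in>K. rc (x m))) \<le> \<delta>\<^sup>2 * (\<Prod>m\<in>K. rc (x m))"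
          by (simp add: power2_eq_square)
      qed
      also have "\<dots> = \<delta>\<^sup>2 * Z K" by (simp add: Z_def sum_distrib_left)
      also have "\<dots> \<le> \<delta>\<^sup>2 * (sqrt (2 * \<delta>) ^ (n - 2) * Phi q ^ ex2 (n - 2))"
        using Z_le[OF finK] cK by (intro mult_left_mono) auto
      also have "\<dots> \<le> (\<theta> * (2 * \<delta>)) * (sqrt (2 * \<delta>) ^ (n - 2) * Phi q ^ ex2 n)"
      proof (intro mult_mono)
        have "\<delta> * \<delta> \<le> \<theta> * (2 * \<delta>)" using \<theta>(2) d0 t0 by (intro mult_mono) auto
        then show "\<delta>\<^sup>2 \<le> \<theta> * (2 * \<delta>)" by (simp add: power2_eq_square)
        show "Phi q ^ ex2 (n - 2) \<le> Phi q ^ ex2 n" using e2 P1 by (intro power_increasing) auto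
      qed (use t0 d0 P1 in auto)
      also have "\<dots> = \<theta> * (sqrt (2 * \<delta>) ^ (n - 2) * (2 * \<delta>)) * Phi q ^ ex2 n" by (simp add: mult_ac)
      also have "\<dots> = B" unfolding B_def sq ..
      finally show "sum ?f (A2 p l) \<le> B" .
    qed
    also have "\<dots> \<le> real n * B + ((real n)\<^sup>2 * (recur_const (n - 2) * B) + (real n)\<^sup>2 * (real n * B))"
    proof (intro add_mono order_refl)
      show "(\<Sum>p\<in>Pr. recur_const (n - 2) * B) \<le> (real n)\<^sup>2 * (recur_const (n - 2) * B)"
        using cardPr B0 recur_const_nonneg[of "n - 2"] by (simp add: mult_right_mono)
      have "(\<Sum>p\<in>Pr. \<Sum>l\<in>I - {fst p, snd p}. B) \<le> (\<Sum>p\<in>Pr. real n * B)"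
      proof (rule sum_mono)
        fix p
        have "card (I - {fst p, snd p}) \<le> n" using I by (metis card_Diff_subset_Int card_mono Diff_subset)
        then show "(\<Sum>l\<in>I - {fst p, snd p}. B) \<le> real n * B" using B0 by (simp add: mult_right_mono)
      qed
      also have "\<dots> \<le> (real n)\<^sup>2 * (real n * B)" using cardPr B0 by (simp add: mult_right_mono)
      finally show "(\<Sum>p\<in>Pr. \<Sum>l\<in>I - {fst p, snd p}. B) \<le> (real n)\<^sup>2 * (real n * B)" .
    qed
    also have "\<dots> \<le> recur_const n * B"
      using False by (subst recur_const.simps) (simp add: algebra_simps)
    finally show ?thesis by (simp add: B_def)
  qed
qed

end

section \<open>Exponential sums with smooth weights\<close>

lemma ee_add: "ee (x + y) = ee x * ee y"
  by (simp add: ee_def exp_add[symmetric] algebra_simps)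

lemma norm_ee [simp]: "norm (ee x) = 1"
proof -
  have "ee x = exp (\<i> * of_real (2 * pi * x))" by (simp add: ee_def mult_ac)
  then show ?thesis by (simp only: norm_exp_i_times)
qed

lemma ee_of_int: "ee (of_int n) = 1"
proof -
  have "ee (of_int n) = exp (of_int (2 * n) * (of_real pi * \<i>))" by (simp add: ee_def mult_ac)
  also have "\<dots> = 1" by (simp add: exp_eq_1 )
  finally show ?thesis .
qed

text \<open>The left side of |e(\<alpha>) - 1| = 2 |sin(\<pi> \<alpha>)| is bounded below crudely:
  by the mean value theorem for |\<alpha>| \<le> 1/4 and by monotonicity of the sine beyond.\<close>

lemma norm_ee_minus_1_ge:
  assumes "\<bar>\<alpha>\<bar> \<le> 1/2" shows "\<bar>\<alpha>\<bar> \<le> norm (ee \<alpha> - 1)"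
proof -
  let ?y = "pi * \<bar>\<alpha>\<bar>"
  have "ee \<alpha> = exp (\<i> * of_real (2 * pi * \<alpha>))" by (simp add: ee_def mult_ac)
  then have "norm (ee \<alpha> - 1) = 2 * \<bar>sin (2 * pi * \<alpha> / 2)\<bar>" by (simp only: dist_exp_i_1)
  also have "\<bar>sin (2 * pi * \<alpha> / 2)\<bar> = \<bar>sin ?y\<bar>"
    by (cases "\<alpha> \<ge> 0") auto
  finally have eq: "norm (ee \<alpha> - 1) = 2 * \<bar>sin ?y\<bar>" .
  have pi2: "pi \<ge> 2" using pi_ge_two .
  have y2: "?y \<le> pi / 2" using assms by simp
  have s2: "sqrt 2 \<ge> (1::real)" by simp
  show ?thesis
  proof (cases "\<bar>\<alpha>\<bar> \<le> 1/4")
    case True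
    show ?thesis
    proof (cases "\<alpha> = 0")
      case False
      then have y0: "0 < ?y" by simp
      have y4: "?y \<le> pi / 4" using True by simp
      obtain z where z: "0 < z" "z < ?y" "sin ?y - sin 0 = (?y - 0) * cos z"
        using MVT2[OF y0, of sin cos] by (auto intro: DERIV_sin)
      have "cos (pi / 4) \<le> cos z" by (intro cos_monotone_0_pi_le) (use z(1,2) y4 pi2 in linarith)+
      then have "1 / 2 \<le> cos z" using s2 unfolding cos_45 by linarith
      then have "?y * (1 / 2) \<le> ?y * cos z" using y0 by (intro mult_left_mono) auto
      then have "?y \<le> 2 * sin ?y" using z(3) by simp
      moreover have "\<bar>\<alpha>\<bar> \<le> ?y" using pi2 mult_right_mono[of 1 pi "\<bar>\<alpha>\<bar>"] by simp
      ultimately show ?thesis unfolding eq by linarith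
    qed simp
  next
    case False
    then have "sin (pi / 4) \<le> sin ?y" using y2 by (intro sin_monotone_2pi_le) auto
    then have "1 \<le> 2 * sin ?y" using s2 unfolding sin_45 by linarith
    then show ?thesis unfolding eq using assms by linarith
  qed
qed

text \<open>The support is closed and avoids 0, so f and all its one-sided derivatives vanish near 0
  and continuing them by 0 stays differentiable. Compactness gives a common support for all
  derivatives and a bound for each.\<close>

lemma smooth_zero_extension:
  assumes sm: "smooth_halfline f" and co: "compact (supp_halfline f)" and su: "supp_halfline f \<subseteq> {0<..}"
  obtains D :: "nat \<Rightarrow> real \<Rightarrow> complex" and B :: real and K :: "nat \<Rightarrow> real"
  where "B \<ge> 0" "D 0 = zero_ext f" "\<And>n x. (D n has_vector_derivative D (Suc n) x) (at x)"
    "\<And>n x. x < 0 \<or> x > B \<Longrightarrow> D n x = 0" "\<And>n x. norm (D n x) \<le> K n" "\<And>n. K n \<ge> 0"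
proof -
  obtain F where F0: "\<And>x. x \<ge> 0 \<Longrightarrow> F 0 x = f x"
    and F: "\<And>n x. x \<ge> 0 \<Longrightarrow> (F n has_vector_derivative F (Suc n) x) (at x within {0..})"
    using sm unfolding smooth_halfline_def by metis
  let ?S = "supp_halfline f"
  have fS: "f x = 0" if "x \<ge> 0" "x \<notin> ?S" for x
    using that closure_subset[of "{x. 0 \<le> x \<and> f x \<noteq> 0}"] by (auto simp: supp_halfline_def)
  obtain B where B: "B > 0" "\<And>x. x \<in> ?S \<Longrightarrow> norm x \<le> B" using compact_imp_bounded[OF co] bounded_pos by metis
  have "open (- ?S)" using co compact_imp_closed by blast
  moreover have "0 \<in> - ?S" using su by auto
  ultimately obtain e where e: "e > 0" "ball 0 e \<subseteq> - ?S" using openE by blast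
  \<comment> \<open>An open set containing a neighbourhood of 0 and everything beyond the support.
    Openness lets the vanishing of one derivative on its nonnegative part pass to the next.\<close>
  define V where "V = {x. x < e \<or> x > B}"
  have opV: "open V" unfolding V_def by (intro open_Collect_disj open_Collect_less) (auto intro: continuous_intros)
  have Fz: "F n x = 0" if "x \<ge> 0" "x \<in> V" for n x
    using that
  proof (induction n arbitrary: x)
    case 0
    have "x \<notin> ?S"
    proof (cases "x < e")
      case True
      then have "x \<in> ball 0 e" using 0 by (simp add: dist_norm)
      then show ?thesis using e(2) by blast
    next
      case False
      then have "norm x > B" using 0 by (simp add: V_def)
      then show ?thesis using B(2)[of x] by linarith
    qed
    then show ?case using F0 fS 0 by simp
  next
    case (Suc n)
    obtain d where d: "d > 0" "ball x d \<subseteq> V" using opV Suc.prems openE by blast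
    have "((\<lambda>_. 0) has_vector_derivative 0) (at x within {0..})" by (rule has_vector_derivative_const)
    then have z: "(F n has_vector_derivative 0) (at x within {0..})"
    proof (rule has_vector_derivative_transform_within[OF _ d(1)])
      fix x' assume "x' \<in> {0..}" "dist x' x < d"
      then have "x' \<in> V" using d(2) by (auto simp: dist_commute)
      then show "0 = F n x'" using Suc.IH \<open>x' \<in> {0..}\<close> by simp
    qed (use Suc.prems in simp)
    have "{0::real..} \<noteq> {y}" for y
    proof
      assume "{0..} = {y}"
      moreover have "0 \<in> {0::real..}" "1 \<in> {0::real..}" by simp_all
      ultimately have "0 = y" "1 = y" by simp_all
      then show False by simp
    qed
    then have "x islimpt {0..}"
      by (intro connected_imp_perfect) (simp_all add: Suc.prems)
    then have "at x within {0..} \<noteq> bot" by (simp add: trivial_limit_within)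
    from vector_derivative_unique_within[OF this F[OF Suc.prems(1)] z] show ?case .
  qed
  define D where "D = (\<lambda>n x. if x \<ge> 0 then F n x else 0)"
  have DV: "D n x = 0" if "x \<in> V" for n x using Fz that by (simp add: D_def)
  have Dd: "(D n has_vector_derivative D (Suc n) x) (at x)" for n x
  proof (cases "x \<in> V")
    case True
    have "((\<lambda>_. 0) has_vector_derivative 0) (at x)" by (rule has_vector_derivative_const)
    then have "(D n has_vector_derivative 0) (at x)"
      by (rule has_vector_derivative_transform_within_open[OF _ opV True]) (simp add: DV)
    then show ?thesis using DV[OF True] by simp
  next
    case False
    then have x: "x > 0" using e(1) by (simp add: V_def)
    have "(F n has_vector_derivative F (Suc n) x) (at x within {0..})" using F x by simp
    moreover have "at x within {0..} = at x" using x by (intro at_within_interior) (simp add: interior_Ici)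
    ultimately have "(F n has_vector_derivative F (Suc n) x) (at x)" by simp
    then have "(D n has_vector_derivative F (Suc n) x) (at x)"
      by (rule has_vector_derivative_transform_within_open[of _ _ _ "{0<..}"]) (use x in \<open>auto simp: D_def\<close>)
    then show ?thesis using x by (simp add: D_def)
  qed
  have supp: "D n x = 0" if "x < 0 \<or> x > B" for n x using that DV[of x n] by (auto simp: V_def D_def)
  have "\<exists>K\<ge>0. \<forall>x. norm (D n x) \<le> K" for n
  proof -
    have "continuous_on {0..B} (D n)"
      using Dd has_vector_derivative_continuous by (blast intro: continuous_at_imp_continuous_on)
    then have "bounded (D n ` {0..B})" using compact_continuous_image compact_imp_bounded by blast
    then obtain K where K: "K > 0" "\<And>y. y \<in> D n ` {0..B} \<Longrightarrow> norm y \<le> K" using bounded_pos by metis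
    have "norm (D n x) \<le> K" for x
      using K supp[of x n] by (cases "x < 0 \<or> x > B") auto
    then show ?thesis using K(1) by (intro exI[of _ K]) auto
  qed
  then obtain K where K: "\<And>n. K n \<ge> 0" "\<And>n x. norm (D n x) \<le> K n" by metis
  show ?thesis
  proof (rule that[of B D K])
    show "D 0 = zero_ext f" using F0 by (auto simp: D_def zero_ext_def)
  qed (use B(1) Dd supp K in auto)
qed

section \<open>Decay of the exponential sums by repeated differences\<close>

definition bdiff :: "real \<Rightarrow> (real \<Rightarrow> complex) \<Rightarrow> real \<Rightarrow> complex" where
  "bdiff \<eta> F x = F (x - \<eta>) - F x"

lemma bdiff_power_Suc: "(bdiff \<eta> ^^ Suc N) F x = (bdiff \<eta> ^^ N) F (x - \<eta>) - (bdiff \<eta> ^^ N) F x"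
  by (simp only: funpow.simps o_apply bdiff_def[of \<eta> "(bdiff \<eta> ^^ N) F" x])

lemma bdiff_power_derivative:
  assumes "\<And>n x. (D n has_vector_derivative D (Suc n) x) (at x)"
  shows "((bdiff \<eta> ^^ N) (D n) has_vector_derivative (bdiff \<eta> ^^ N) (D (Suc n)) x) (at x)"
proof (induction N arbitrary: x)
  case (Suc N)
  have shift: "((\<lambda>x. (bdiff \<eta> ^^ N) (D n) (x - \<eta>)) has_vector_derivative (bdiff \<eta> ^^ N) (D (Suc n)) (x - \<eta>)) (at x)"
  proof -
    have "((\<lambda>x. x - \<eta>) has_vector_derivative 1) (at x)"
      by (auto intro!: derivative_eq_intros)
    from vector_diff_chain_at[OF this Suc.IH[of "x - \<eta>"]] show ?thesis by (simp add: o_def)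
  qed
  have "(bdiff \<eta> ^^ Suc N) (D n) = (\<lambda>x. (bdiff \<eta> ^^ N) (D n) (x - \<eta>) - (bdiff \<eta> ^^ N) (D n) x)"
    by (simp only: fun_eq_iff bdiff_power_Suc) simp
  moreover have "(bdiff \<eta> ^^ Suc N) (D (Suc n)) x = (bdiff \<eta> ^^ N) (D (Suc n)) (x - \<eta>) - (bdiff \<eta> ^^ N) (D (Suc n)) x"
    by (rule bdiff_power_Suc)
  ultimately show ?case using has_vector_derivative_diff[OF shift Suc.IH] by (simp only:)
qed (use assms in simp)

text \<open>Each difference is traded for a factor \<eta> and one derivative by the mean value
  inequality.\<close>

lemma bdiff_power_bound:
  assumes D: "\<And>n x. (D n has_vector_derivative D (Suc n) x) (at x)" and K: "\<And>n x. norm (D n x) \<le> K n" and \<eta>: "\<eta> \<ge> 0"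
  shows "norm ((bdiff \<eta> ^^ N) (D n) x) \<le> \<eta> ^ N * K (n + N)"
proof (induction N arbitrary: n x)
  case (Suc N)
  let ?G = "(bdiff \<eta> ^^ N) (D n)"
  have "norm (?G (x - \<eta>) - ?G x) \<le> (\<eta> ^ N * K (Suc n + N)) * norm ((x - \<eta>) - x)"
  proof (rule differentiable_bound[where S = UNIV and f' = "\<lambda>x t. t *\<^sub>R (bdiff \<eta> ^^ N) (D (Suc n)) x"])
    fix y
    show "(?G has_derivative (\<lambda>t. t *\<^sub>R (bdiff \<eta> ^^ N) (D (Suc n)) y)) (at y within UNIV)"
      using bdiff_power_derivative[of D, OF D] by (simp add: has_vector_derivative_def)
    show "onorm (\<lambda>t. t *\<^sub>R (bdiff \<eta> ^^ N) (D (Suc n)) y) \<le> \<eta> ^ N * K (Suc n + N)"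
    proof (rule onorm_le)
      fix t :: real
      show "norm (t *\<^sub>R (bdiff \<eta> ^^ N) (D (Suc n)) y) \<le> \<eta> ^ N * K (Suc n + N) * norm t"
        using mult_left_mono[OF Suc.IH[of "Suc n" y], of "\<bar>t\<bar>"] by (simp add: mult_ac)
    qed
  qed auto
  then show ?case using \<eta> unfolding bdiff_power_Suc by (simp add: mult_ac)
qed (use K in simp)

lemma bdiff_power_support:
  assumes "\<And>x. x < 0 \<or> x > B \<Longrightarrow> F x = 0" "\<eta> \<ge> 0" "x < 0 \<or> x > B + real N * \<eta>"
  shows "(bdiff \<eta> ^^ N) F x = 0"
  using assms(3)
proof (induction N arbitrary: x)
  case (Suc N)
  then have "x - \<eta> < 0 \<or> x - \<eta> > B + real N * \<eta>" "x < 0 \<or> x > B + real N * \<eta>"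
    using assms(2) by (auto simp: algebra_simps)
  then show ?case using Suc.IH unfolding bdiff_power_Suc by simp
qed (use assms(1) in simp)

text \<open>\<open>Esum\<close> for a function already defined on the whole line, so that it can be
  applied to the iterated differences.\<close>

definition ES :: "(real \<Rightarrow> complex) \<Rightarrow> real \<Rightarrow> real \<Rightarrow> complex" where
  "ES F h \<alpha> = (\<Sum>\<^sub>\<infinity>m::int\<in>UNIV. F (of_int m / h) * ee (of_int m * \<alpha>))"

lemma ES_finite:
  assumes F: "\<And>x. x < 0 \<or> x > B \<Longrightarrow> F x = 0" and h: "h > 0" and B: "B \<ge> 0"
  shows "(\<lambda>m::int. F (of_int m / h) * ee (of_int m * \<alpha>)) summable_on UNIV"
    "\<And>M. (\<And>x. norm (F x) \<le> M) \<Longrightarrow> norm (ES F h \<alpha>) \<le> (B * h + 1) * M"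
proof -
  let ?g = "\<lambda>m::int. F (of_int m / h) * ee (of_int m * \<alpha>)"
  let ?T = "{m::int. 0 \<le> real_of_int m \<and> real_of_int m \<le> B * h}"
  have Bh: "0 \<le> B * h" using h B by simp
  have z: "?g m = 0" if "m \<notin> ?T" for m
  proof -
    have "real_of_int m / h < 0 \<or> real_of_int m / h > B" using that h by (auto simp: field_simps)
    then show ?thesis using F by simp
  qed
  note T = card_ints_interval[OF Bh]
  show "?g summable_on UNIV"
    by (rule finite_nonzero_values_imp_summable_on, rule finite_subset[OF _ T(1)]) (use z in blast)
  fix M assume M: "\<And>x. norm (F x) \<le> M"
  have M0: "M \<ge> 0" using M[of 0] norm_ge_zero order_trans by blast
  have "ES F h \<alpha> = infsum ?g ?T" unfolding ES_def by (rule infsum_cong_neutral) (use z in auto)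
  also have "\<dots> = sum ?g ?T" using T(1) by simp
  also have "norm \<dots> \<le> (\<Sum>m\<in>?T. M)" by (rule sum_norm_le) (simp add: norm_mult M)
  also have "\<dots> = real (card ?T) * M" by simp
  also have "\<dots> \<le> (B * h + 1) * M" using T(2) M0 by (intro mult_right_mono) auto
  finally show "norm (ES F h \<alpha>) \<le> (B * h + 1) * M" .
qed

text \<open>Summation by parts: a shift of F by one sampling step 1/h is absorbed by m \<mapsto> m -
  1 and multiplies the sum by e(\<alpha>).\<close>

lemma ES_bdiff:
  assumes F: "\<And>x. x < 0 \<or> x > B \<Longrightarrow> F x = 0" and h: "h > 0" and B: "B \<ge> 0"
  shows "ES (bdiff (1 / h) F) h \<alpha> = (ee \<alpha> - 1) * ES F h \<alpha>"
proof -
  let ?g = "\<lambda>m::int. F (of_int m / h) * ee (of_int m * \<alpha>)"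
  have sum1: "?g summable_on UNIV" by (rule ES_finite(1)[OF F h B])
  have bij: "bij_betw (\<lambda>m::int. m - 1) UNIV UNIV" by (rule bij_betwI[where g = "\<lambda>m. m + 1"]) auto
  have sum2: "(\<lambda>m. ?g (m - 1)) summable_on UNIV"
    using summable_on_reindex_bij_betw[OF bij, of ?g] sum1 by simp
  have s2: "infsum (\<lambda>m. ?g (m - 1)) UNIV = ES F h \<alpha>"
    unfolding ES_def by (rule infsum_reindex_bij_betw[OF bij])
  have "ES (bdiff (1 / h) F) h \<alpha> = infsum (\<lambda>m. ee \<alpha> * ?g (m - 1) + (- 1) * ?g m) UNIV"
    unfolding ES_def
  proof (rule infsum_cong)
    fix m :: int
    have "ee (of_int m * \<alpha>) = ee \<alpha> * ee (of_int (m - 1) * \<alpha>)"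
      unfolding ee_add[symmetric] by (simp add: algebra_simps)
    moreover have "real_of_int m / h - 1 / h = real_of_int (m - 1) / h" by (simp add: diff_divide_distrib)
    ultimately show "bdiff (1 / h) F (of_int m / h) * ee (of_int m * \<alpha>) = ee \<alpha> * ?g (m - 1) + (- 1) * ?g m"
      by (simp add: bdiff_def algebra_simps)
  qed
  also have "\<dots> = infsum (\<lambda>m. ee \<alpha> * ?g (m - 1)) UNIV + infsum (\<lambda>m. (- 1) * ?g m) UNIV"
    by (intro infsum_add summable_on_cmult_right sum1 sum2)
  also have "\<dots> = ee \<alpha> * ES F h \<alpha> + (- 1) * ES F h \<alpha>"
    unfolding infsum_cmult_right' s2 unfolding ES_def ..
  finally show ?thesis by (simp add: algebra_simps)
qed

lemma ES_bdiff_power: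
  assumes F: "\<And>x. x < 0 \<or> x > B \<Longrightarrow> F x = 0" and h: "h > 0" and B: "B \<ge> 0"
  shows "ES ((bdiff (1 / h) ^^ N) F) h \<alpha> = (ee \<alpha> - 1) ^ N * ES F h \<alpha>"
proof (induction N)
  case (Suc N)
  have "(bdiff (1 / h) ^^ N) F x = 0" if "x < 0 \<or> x > B + real N * (1 / h)" for x
    by (rule bdiff_power_support[OF F]) (use h that in auto)
  from ES_bdiff[OF this h] B h Suc show ?case by simp
qed simp

lemma Esum_eq_ES: "Esum f h \<alpha> = ES (zero_ext f) h \<alpha>"
  by (simp add: Esum_def ES_def)

lemma Esum_cong:
  assumes "\<alpha> - \<beta> \<in> \<int>" shows "Esum f h \<alpha> = Esum f h \<beta>"
proof -
  obtain n where n: "\<alpha> = \<beta> + of_int n" using assms by (auto elim!: Ints_cases simp: algebra_simps)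
  have "ee (of_int m * \<alpha>) = ee (of_int m * \<beta>)" for m :: int
    using ee_add[of "of_int m * \<beta>" "of_int (m * n)"] ee_of_int[of "m * n"] by (simp add: n algebra_simps)
  then show ?thesis by (simp add: Esum_def)
qed

text \<open>After N differences the sum is multiplied by (e(\<alpha>) - 1)^N, of absolute value at
  least |\<alpha>|^N, while its O(h) terms have become O(h^(-N)). The support grows by N/h, that is,
  by N terms, which h \<ge> 1 absorbs.\<close>

lemma Esum_bound:
  assumes sm: "smooth_halfline f" and co: "compact (supp_halfline f)" and su: "supp_halfline f \<subseteq> {0<..}"
  shows "\<exists>C\<ge>0. \<forall>h \<alpha>. h \<ge> 1 \<longrightarrow> \<bar>\<alpha>\<bar> \<le> 1/2 \<longrightarrow>
    norm (Esum f h \<alpha>) \<le> C * h \<and> (h * \<bar>\<alpha>\<bar>) ^ N * norm (Esum f h \<alpha>) \<le> C * h"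
proof -
  obtain D B K where D: "B \<ge> 0" "D 0 = zero_ext f" "\<And>n x. (D n has_vector_derivative D (Suc n) x) (at x)"
    "\<And>n x. x < 0 \<or> x > B \<Longrightarrow> D n x = 0" "\<And>n x. norm (D n x) \<le> K n" "\<And>n. K n \<ge> 0"
    using smooth_zero_extension[OF assms] by metis
  have supp: "\<And>x. x < 0 \<or> x > B \<Longrightarrow> D 0 x = 0" using D(4) by blast
  define C where "C = (B + 1) * K 0 + (B + real N + 1) * K N"
  have C0: "C \<ge> 0" using D(1,6) by (simp add: C_def)
  have "norm (Esum f h \<alpha>) \<le> C * h \<and> (h * \<bar>\<alpha>\<bar>) ^ N * norm (Esum f h \<alpha>) \<le> C * h"
    if h: "h \<ge> 1" and a: "\<bar>\<alpha>\<bar> \<le> 1/2" for h \<alpha>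
  proof
    have h0: "h > 0" using h by simp
    have E: "Esum f h \<alpha> = ES (D 0) h \<alpha>" unfolding Esum_eq_ES D(2) ..
    have "norm (ES (D 0) h \<alpha>) \<le> (B * h + 1) * K 0" by (rule ES_finite(2)[OF supp h0 D(1) D(5)])
    also have "\<dots> \<le> ((B + 1) * h) * K 0" using h D by (intro mult_right_mono) (auto simp: algebra_simps)
    also have "\<dots> \<le> C * h" unfolding C_def using h0 D by (simp add: algebra_simps)
    finally show "norm (Esum f h \<alpha>) \<le> C * h" unfolding E .
    let ?F = "(bdiff (1 / h) ^^ N) (D 0)"
    have suppF: "?F x = 0" if "x < 0 \<or> x > B + real N * (1 / h)" for x
      by (rule bdiff_power_support[OF supp]) (use h0 that in auto)
    have bdF: "norm (?F x) \<le> (1 / h) ^ N * K N" for x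
      using bdiff_power_bound[of D K "1 / h" N 0 x, OF D(3,5)] h0 by simp
    have "norm ((ee \<alpha> - 1) ^ N * ES (D 0) h \<alpha>) = norm (ES ?F h \<alpha>)"
      using ES_bdiff_power[OF supp h0 D(1), where N = N and \<alpha> = \<alpha>] by simp
    also have "\<dots> \<le> ((B + real N * (1 / h)) * h + 1) * ((1 / h) ^ N * K N)"
      by (rule ES_finite(2)[OF suppF h0 _ bdF]) (use D(1) h0 in auto)
    also have "\<dots> \<le> ((B + real N + 1) * h) * ((1 / h) ^ N * K N)"
    proof (intro mult_right_mono)
      have "(B + real N * (1 / h)) * h + 1 = B * h + real N + 1" using h0 by (simp add: algebra_simps)
      also have "\<dots> \<le> B * h + real N * h + 1 * h" using h mult_left_mono[OF h, of "real N"] by simp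
      finally show "(B + real N * (1 / h)) * h + 1 \<le> (B + real N + 1) * h" by (simp add: algebra_simps)
    qed (use h0 D in auto)
    finally have 1: "norm (ee \<alpha> - 1) ^ N * norm (ES (D 0) h \<alpha>) \<le> ((B + real N + 1) * h) * ((1 / h) ^ N * K N)"
      by (simp add: norm_mult norm_power)
    have "(h * \<bar>\<alpha>\<bar>) ^ N * norm (ES (D 0) h \<alpha>) \<le> h ^ N * (norm (ee \<alpha> - 1) ^ N * norm (ES (D 0) h \<alpha>))"
      unfolding power_mult_distrib mult.assoc using norm_ee_minus_1_ge[OF a] h0
      by (intro mult_left_mono mult_right_mono power_mono) auto
    also have "\<dots> \<le> h ^ N * (((B + real N + 1) * h) * ((1 / h) ^ N * K N))"
      using 1 h0 by (intro mult_left_mono) auto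
    also have "\<dots> = ((B + real N + 1) * K N) * h" using h0 by (simp add: power_one_over field_simps)
    also have "\<dots> \<le> C * h" unfolding C_def using h0 D by (intro mult_right_mono) auto
    finally show "(h * \<bar>\<alpha>\<bar>) ^ N * norm (Esum f h \<alpha>) \<le> C * h" unfolding E .
  qed
  then show ?thesis using C0 by blast
qed

section \<open>The sums over fractions as sums over zero-sum tuples\<close>

definition coef :: "real \<Rightarrow> (real \<Rightarrow> complex) \<Rightarrow> real \<Rightarrow> complex" where
  "coef h f x = of_int (moebius_mu (den x)) / of_nat (totient (den x)) * Esum f h x"

text \<open>A nonzero torsion class has a unique reduced fraction, its denominator being the order
  of the class; the condition 1 < d excludes exactly the class 0.\<close>

lemma reduced_fractions_bij:
  assumes q: "q > 0"
  shows "bij_betw (\<lambda>(d, a). cen (real a / real d))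
    {(d, a). 1 < d \<and> d dvd q \<and> 1 \<le> a \<and> a \<le> d \<and> coprime a d} (torsion q - {0})"
    (is "bij_betw ?F ?P ?Y")
  unfolding bij_betw_def
proof
  have lt: "a < d" if "1 < d" "a \<le> d" "coprime a d" for a d :: nat
    using that by (cases "a = d") auto
  have dF: "den (cen (real a / real d)) = d" if "1 < d" "coprime a d" for a d :: nat
    using den_fraction[of d a] that by simp
  show "inj_on ?F ?P"
  proof (rule inj_onI, clarify)
    fix d a d' a' :: nat
    assume A: "1 < d" "1 \<le> a" "a \<le> d" "coprime a d" and B: "1 < d'" "1 \<le> a'" "a' \<le> d'" "coprime a' d'"
      and eq: "cen (real a / real d) = cen (real a' / real d')"
    have d: "d = d'" using eq dF A B by metis
    have "(real a / real d - cen (real a / real d)) + (cen (real a' / real d') - real a' / real d') \<in> \<int>"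
      by (intro Ints_add cen_diff_Ints cen_diff_Ints')
    then have I: "real a / real d - real a' / real d \<in> \<int>" using eq d by simp
    then obtain n :: int where n: "real a / real d - real a' / real d = of_int n" by (auto elim: Ints_cases)
    have "real a / real d < 1" "real a' / real d < 1" using lt[of d a] lt[of d' a'] A B d by simp_all
    moreover have "real a / real d \<ge> 0" "real a' / real d \<ge> 0" by simp_all
    ultimately have "\<bar>real_of_int n\<bar> < 1" unfolding n[symmetric] by linarith
    then have "n = 0" by linarith
    then have "real a = real a'" using n A by (simp add: field_simps)
    then show "d = d' \<and> a = a'" using d by simp
  qed
  show "?F ` ?P = ?Y"
  proof (intro equalityI subsetI)
    fix x assume "x \<in> ?F ` ?P"
    then obtain d a where da: "x = cen (real a / real d)" "1 < d" "d dvd q" "coprime a d" by auto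
    obtain e where e: "q = d * e" using da by auto
    have "real q * (real a / real d) = real (e * a)" using e da by simp
    then have "real q * (real a / real d) \<in> \<int>" by (simp only:) simp
    then have x: "x \<in> torsion q" unfolding da(1) cen_in_torsion_iff .
    have "den x \<noteq> 1" using dF da by simp
    then show "x \<in> ?Y" using x by auto
  next
    fix x assume x: "x \<in> ?Y"
    define d where "d = den x"
    have d0: "d > 0" "d dvd q" using den_pos[OF q] den_dvd[OF q] x by (auto simp: d_def)
    have "d \<noteq> 1" using den_1_iff[OF q] x by (auto simp: d_def)
    with d0 have d1: "d > 1" by linarith
    have "real d * x \<in> \<int>" using den_mult_Ints[OF q] x torsion_Ints by (auto simp: d_def)
    then obtain n :: int where n: "real d * x = of_int n" by (auto elim: Ints_cases)
    \<comment> \<open>The residue of the numerator modulo d. It turns out coprime to d > 1, hence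
      nonzero, and so lies in the required range from 1 to d.\<close>
    define a where "a = nat (n mod int d)"
    have a: "int a = n mod int d" using d0 by (simp add: a_def)
    have "n = int d * (n div int d) + int a" unfolding a by simp
    then have "real_of_int n = real d * real_of_int (n div int d) + real a"
      by (metis of_int_add of_int_mult of_int_of_nat_eq)
    then have xa: "x = real_of_int (n div int d) + real a / real d" using n d0 by (simp add: field_simps)
    then have dif: "real a / real d - x \<in> \<int>" by simp
    have cx: "cen (real a / real d) = x" using cen_cong[OF dif] cen_torsion x by auto
    have cop: "coprime a d"
    proof -
      define g where "g = gcd a d"
      have g0: "g > 0" using d0 by (simp add: g_def)
      have ga: "a = g * (a div g)" "d = g * (d div g)" by (simp_all add: g_def)
      have "real (d div g) * (real a / real d) = real (a div g)"
      proof -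
        have "real a = real g * real (a div g)" "real d = real g * real (d div g)" using ga by (metis of_nat_mult)+
        moreover have "real (d div g) > 0" using ga d0 by (cases "d div g") auto
        ultimately show ?thesis using g0 by simp
      qed
      then have "real (d div g) * (real a / real d) \<in> \<int>" by simp
      moreover have "real d * (real a / real d) \<in> \<int>" using d0 by simp
      ultimately have "den (real a / real d) dvd d div g" using den_dvd_iff[OF d0(1)] by blast
      moreover have "den (real a / real d) = d" using den_cong[OF dif] by (simp add: d_def)
      ultimately have "d dvd d div g" by simp
      moreover have "d div g > 0" using ga d0 by (cases "d div g") auto
      ultimately have "d \<le> d div g" by (simp add: dvd_imp_le)
      then have "g * (d div g) \<le> 1 * (d div g)" using ga by simp
      then have "g \<le> 1" using \<open>d div g > 0\<close> by simp
      then have "g = 1" using g0 by simp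
      then show ?thesis by (simp add: g_def coprime_iff_gcd_eq_1)
    qed
    have "a \<noteq> 0" using cop d1 by (cases "a = 0") auto
    moreover have "a \<le> d"
    proof -
      have "n mod int d < int d" using d0 by simp
      then show ?thesis using a by simp
    qed
    ultimately have "(d, a) \<in> ?P" using d0 d1 cop by auto
    then show "x \<in> ?F ` ?P" using cx by force
  qed
qed

lemma Vk_eq_zsum:
  assumes q: "q > 0"
  shows "Vk k q h f = (\<Sum>x\<in>zsum {1..k} (torsion q - {0}). \<Prod>i\<in>{1..k}. coef h (f i) (x i))"
proof -
  let ?I = "{1..k}" and ?Y = "torsion q - {0}"
  define P where "P = {(d, a). 1 < d \<and> d dvd q \<and> 1 \<le> a \<and> a \<le> d \<and> coprime a d}"
  define F where "F = (\<lambda>(d, a). cen (real a / real d))"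
  define G where "G = inv_into P F"
  have bij: "bij_betw F P ?Y" unfolding F_def P_def by (rule reduced_fractions_bij[OF q])
  have GF: "G (F p) = p" if "p \<in> P" for p using bij_betw_inv_into_left[OF bij that] by (simp add: G_def)
  have FG: "F (G x) = x" if "x \<in> ?Y" for x using bij_betw_inv_into_right[OF bij that] by (simp add: G_def)
  have Gm: "G x \<in> P" if "x \<in> ?Y" for x using bij_betw_apply[OF bij_betw_inv_into[OF bij] that] by (simp add: G_def)
  have Fm: "F p \<in> ?Y" if "p \<in> P" for p using bij_betw_apply[OF bij that] .
  let ?Dv = "?I \<rightarrow>\<^sub>E {d. 1 < d \<and> d dvd q}"
  let ?A = "\<lambda>d. {a \<in> (\<Pi>\<^sub>E i\<in>?I. {1..d i}). (\<forall>i\<in>?I. coprime (a i) (d i)) \<and> (\<Sum>i\<in>?I. real (a i) / real (d i)) \<in> \<int>}"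
  let ?g = "\<lambda>d a. (\<Prod>i\<in>?I. of_int (moebius_mu (d i)) / of_nat (totient (d i)) * Esum (f i) h (real (a i) / real (d i)))"
  have finD: "finite {d. 1 < d \<and> d dvd q}" using q by (auto intro: finite_subset[OF _ finite_divisors_nat[OF q]])
  have "Vk k q h f = (\<Sum>d\<in>?Dv. \<Sum>a\<in>?A d. ?g d a)"
    unfolding Vk_def by (intro sum.cong refl) (simp only: sum_distrib_left prod.distrib)
  also have "\<dots> = (\<Sum>r\<in>Sigma ?Dv ?A. ?g (fst r) (snd r))"
  proof -
    have "finite ?Dv" using finD by (intro finite_PiE) auto
    moreover have "finite (?A d)" for d
      by (rule finite_subset[of _ "\<Pi>\<^sub>E i\<in>?I. {1..d i}"]) (auto intro!: finite_PiE)
    ultimately show ?thesis by (subst sum.Sigma) (auto simp: case_prod_beta)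
  qed
  also have "\<dots> = (\<Sum>x\<in>zsum ?I ?Y. \<Prod>i\<in>?I. coef h (f i) (x i))"
  proof (rule sum.reindex_bij_witness[where
      j = "\<lambda>r. \<lambda>i\<in>?I. F (fst r i, snd r i)" and i = "\<lambda>x. (\<lambda>i\<in>?I. fst (G (x i)), \<lambda>i\<in>?I. snd (G (x i)))"])
    fix r assume "r \<in> Sigma ?Dv ?A"
    then obtain d a where r: "r = (d, a)" and d: "d \<in> ?Dv" and a: "a \<in> ?A d" by auto
    have pm: "(d i, a i) \<in> P" if "i \<in> ?I" for i
    proof -
      have "1 < d i \<and> d i dvd q" using d that by (auto simp: PiE_iff)
      moreover have "a i \<in> {1..d i}" "coprime (a i) (d i)" using a that by (auto simp: PiE_iff)
      ultimately show ?thesis by (simp add: P_def)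
    qed
    have de: "d \<in> extensional ?I" "a \<in> extensional ?I" using d a by (auto simp: PiE_iff)
    show "(\<lambda>i\<in>?I. fst (G ((\<lambda>i\<in>?I. F (fst r i, snd r i)) i)), \<lambda>i\<in>?I. snd (G ((\<lambda>i\<in>?I. F (fst r i, snd r i)) i))) = r"
      unfolding r by (auto simp: GF[OF pm] extensional_arb[OF de(1)] extensional_arb[OF de(2)])
    have "(\<Sum>i\<in>?I. F (d i, a i)) - (\<Sum>i\<in>?I. real (a i) / real (d i)) \<in> \<int>"
      unfolding F_def prod.case by (rule sum_cen_Ints)
    then have "(\<Sum>i\<in>?I. F (d i, a i)) \<in> \<int>" using Ints_cong a by blast
    then show "(\<lambda>i\<in>?I. F (fst r i, snd r i)) \<in> zsum ?I ?Y"
      unfolding r zsum_def using Fm[OF pm] by auto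
    show "(\<Prod>i\<in>?I. coef h (f i) ((\<lambda>i\<in>?I. F (fst r i, snd r i)) i)) = ?g (fst r) (snd r)"
    proof (rule prod.cong[OF refl])
      fix i assume i: "i \<in> ?I"
      have p: "1 < d i" "coprime (a i) (d i)" using pm[OF i] by (auto simp: P_def)
      have "den (F (d i, a i)) = d i" using den_fraction[of "d i" "a i"] p by (simp add: F_def)
      moreover have "Esum (f i) h (F (d i, a i)) = Esum (f i) h (real (a i) / real (d i))"
        unfolding F_def prod.case by (rule Esum_cong[OF cen_diff_Ints'])
      ultimately show "coef h (f i) ((\<lambda>i\<in>?I. F (fst r i, snd r i)) i) =
          of_int (moebius_mu (fst r i)) / of_nat (totient (fst r i)) * Esum (f i) h (real (snd r i) / real (fst r i))"
        using i by (simp add: r coef_def)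
    qed
  next
    fix x assume x: "x \<in> zsum ?I ?Y"
    then have xm: "x i \<in> ?Y" if "i \<in> ?I" for i using that unfolding zsum_def by (auto simp: PiE_iff)
    have xe: "x \<in> extensional ?I" using x by (auto simp: zsum_def PiE_iff)
    show "(\<lambda>i\<in>?I. F (fst (\<lambda>i\<in>?I. fst (G (x i)), \<lambda>i\<in>?I. snd (G (x i))) i, snd (\<lambda>i\<in>?I. fst (G (x i)), \<lambda>i\<in>?I. snd (G (x i))) i)) = x"
      using FG[OF xm] extensional_arb[OF xe] by (auto simp: fun_eq_iff)
    have Gp: "1 < fst (G (x i)) \<and> fst (G (x i)) dvd q \<and> 1 \<le> snd (G (x i)) \<and> snd (G (x i)) \<le> fst (G (x i)) \<and> coprime (snd (G (x i))) (fst (G (x i)))"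
      if "i \<in> ?I" for i using Gm[OF xm[OF that]] by (simp add: P_def case_prod_beta)
    have "(\<Sum>i\<in>?I. x i) = (\<Sum>i\<in>?I. cen (real (snd (G (x i))) / real (fst (G (x i)))))"
    proof (rule sum.cong[OF refl])
      fix i assume "i \<in> ?I"
      then show "x i = cen (real (snd (G (x i))) / real (fst (G (x i))))"
        using FG[OF xm] by (simp add: F_def case_prod_beta)
    qed
    moreover have "(\<Sum>i\<in>?I. x i) \<in> \<int>" using x by (simp add: zsum_def)
    ultimately have "(\<Sum>i\<in>?I. real (snd (G (x i))) / real (fst (G (x i)))) \<in> \<int>"
      using Ints_cong[OF sum_cen_Ints[of "\<lambda>i. real (snd (G (x i))) / real (fst (G (x i)))" ?I]] by simp
    then show "(\<lambda>i\<in>?I. fst (G (x i)), \<lambda>i\<in>?I. snd (G (x i))) \<in> Sigma ?Dv ?A"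
      using Gp by auto
  qed
  finally show ?thesis .
qed

section \<open>The main term as a sum over compatible tuples\<close>

lemma V2_eq_pair_sum:
  assumes q: "q > 0"
  shows "V2 q h f g = (\<Sum>r\<in>{r \<in> (torsion q - {0}) \<times> (torsion q - {0}). fst r + snd r \<in> \<int>}. coef h f (fst r) * coef h g (snd r))"
proof -
  let ?Y = "torsion q - {0}"
  let ?c = "\<lambda>i::nat. coef h (if i = 1 then f else g)"
  have I: "{1..2} = {1, 2::nat}" by auto
  have "V2 q h f g = (\<Sum>x\<in>zsum {1, 2} ?Y. \<Prod>i\<in>{1, 2}. ?c i (x i))"
    unfolding V2_def Vk_eq_zsum[OF q] I by simp
  also have "zsum {1, 2} ?Y = {x \<in> zsum {1, 2} ?Y. x 1 + x 2 \<in> \<int> \<and> True}" by (auto simp: zsum_def)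
  also have "(\<Sum>x\<in>\<dots>. \<Prod>i\<in>{1, 2}. ?c i (x i)) =
      (\<Sum>x\<in>zsum {} ?Y. \<Sum>r\<in>{r \<in> ?Y \<times> ?Y. fst r + snd r \<in> \<int> \<and> True}. ?c 1 (fst r) * ?c 2 (snd r) * (\<Prod>m\<in>{}. ?c m (x m)))"
    by (rule sum_zsum_pair) (use finite_torsion[OF q] in auto)
  also have "\<dots> = (\<Sum>r\<in>{r \<in> ?Y \<times> ?Y. fst r + snd r \<in> \<int>}. coef h f (fst r) * coef h g (snd r))"
    by (simp add: zsum_empty)
  finally show ?thesis .
qed

text \<open>Induction over the pairs of the matching: a matched pair sums to an integer by itself,
  so its sum factors off and the rest of the tuple is compatible with the remaining pairs.\<close>

lemma prod_matching_eq_sum: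
  fixes c :: "nat \<Rightarrow> real \<Rightarrow> complex"
  assumes finY: "finite Y" and "finite I" "\<sigma> \<in> matchings_on I"
  shows "(\<Prod>p\<in>\<sigma>. \<Sum>r\<in>{r \<in> Y \<times> Y. fst r + snd r \<in> \<int>}. c (fst p) (fst r) * c (snd p) (snd r))
    = (\<Sum>x\<in>{x \<in> zsum I Y. \<forall>p\<in>\<sigma>. x (fst p) + x (snd p) \<in> \<int>}. \<Prod>i\<in>I. c i (x i))"
proof -
  have "finite \<sigma>"
    by (rule finite_subset[of _ "I \<times> I"]) (use assms in \<open>auto simp: matchings_on_def\<close>)
  then show ?thesis using assms(2,3)
  proof (induction \<sigma> arbitrary: I rule: finite_induct)
    case empty
    then have "I = {}" by (auto simp: matchings_on_def)
    then show ?case by (simp add: zsum_empty)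
  next
    case (insert p \<sigma>)
    obtain i j where p: "p = (i, j)" by (cases p)
    define K where "K = I - {i, j}"
    have ijI: "i \<in> I" "j \<in> I" "i < j" using matchings_on_D[OF insert.prems(2), of p] p by auto
    have IK: "I = insert i (insert j K)" and ij: "i \<noteq> j" "i \<notin> K" "j \<notin> K" and finK: "finite K"
      using ijI insert.prems(1) by (auto simp: K_def)
    have "insert p \<sigma> - {(i, j)} = \<sigma>" using insert.hyps p by auto
    then have \<sigma>: "\<sigma> \<in> matchings_on K" using matchings_on_remove[OF insert.prems(2), of i j] p by (simp add: K_def)
    let ?W = "\<lambda>p. \<Sum>r\<in>{r \<in> Y \<times> Y. fst r + snd r \<in> \<int>}. c (fst p) (fst r) * c (snd p) (snd r)"
    let ?P = "\<lambda>x. \<forall>p\<in>\<sigma>. x (fst p) + x (snd p) \<in> \<int>"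
    have Pupd: "?P (x(j := v, i := u)) \<longleftrightarrow> ?P x" for x u v
    proof (rule ball_cong[OF refl])
      fix p assume "p \<in> \<sigma>"
      then have "fst p \<in> K" "snd p \<in> K" using matchings_on_D[OF \<sigma>] by auto
      then have "fst p \<noteq> i" "fst p \<noteq> j" "snd p \<noteq> i" "snd p \<noteq> j" using ij by auto
      then show "(x(j := v, i := u)) (fst p) + (x(j := v, i := u)) (snd p) \<in> \<int> \<longleftrightarrow> x (fst p) + x (snd p) \<in> \<int>" by simp
    qed
    have "(\<Sum>x\<in>{x \<in> zsum I Y. \<forall>p\<in>insert p \<sigma>. x (fst p) + x (snd p) \<in> \<int>}. \<Prod>i\<in>I. c i (x i))
      = (\<Sum>x\<in>{x \<in> zsum (insert i (insert j K)) Y. x i + x j \<in> \<int> \<and> ?P x}. \<Prod>m\<in>insert i (insert j K). c m (x m))"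
      unfolding IK[symmetric] p by simp
    also have "\<dots> = (\<Sum>x\<in>zsum K Y. \<Sum>r\<in>{r \<in> Y \<times> Y. fst r + snd r \<in> \<int> \<and> ?P (x(j := snd r, i := fst r))}.
        c i (fst r) * c j (snd r) * (\<Prod>m\<in>K. c m (x m)))"
      by (rule sum_zsum_pair[OF finK finY ij])
    also have "\<dots> = (\<Sum>x\<in>zsum K Y. if ?P x then ?W p * (\<Prod>m\<in>K. c m (x m)) else 0)"
      unfolding Pupd
    proof (rule sum.cong[OF refl])
      fix x
      show "(\<Sum>r\<in>{r \<in> Y \<times> Y. fst r + snd r \<in> \<int> \<and> ?P x}. c i (fst r) * c j (snd r) * (\<Prod>m\<in>K. c m (x m)))
        = (if ?P x then ?W p * (\<Prod>m\<in>K. c m (x m)) else 0)"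
      proof -
        have aux: "(\<Sum>r\<in>{r \<in> Y \<times> Y. fst r + snd r \<in> \<int> \<and> b}. w r) = (if b then \<Sum>r\<in>{r \<in> Y \<times> Y. fst r + snd r \<in> \<int>}. w r else 0)"
          for b and w :: "real \<times> real \<Rightarrow> complex" by (cases b) simp_all
        show ?thesis unfolding aux p fst_conv snd_conv sum_distrib_right ..
      qed
    qed
    also have "\<dots> = (\<Sum>x\<in>{x \<in> zsum K Y. ?P x}. ?W p * (\<Prod>m\<in>K. c m (x m)))"
      by (rule sum.inter_filter[symmetric]) (rule finite_zsum[OF finK finY])
    also have "\<dots> = ?W p * (\<Prod>p\<in>\<sigma>. ?W p)"
      unfolding sum_distrib_left[symmetric] insert.IH[OF finK \<sigma>] ..
    finally show ?case using insert.hyps by simp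
  qed
qed

lemma matchings_eq: "matchings k = matchings_on {1..k}"
  by (simp add: matchings_def matchings_on_def)

text \<open>After interchanging the sums, the main term counts a tuple once for each compatible
  matching. The difference carries the coefficient 1 minus that number, which vanishes for exactly
  one compatible matching and never exceeds 1 plus the number of all matchings in absolute
  value.\<close>

lemma Vk_minus_main_bound:
  assumes q: "q > 0" and c: "\<And>i x. i \<in> {1..k} \<Longrightarrow> x \<in> torsion q - {0} \<Longrightarrow> norm (coef h (f i) x) \<le> g x" and g: "\<And>x. g x \<ge> 0"
  shows "norm (Vk k q h f - (\<Sum>\<sigma>\<in>matchings k. \<Prod>(i, j)\<in>\<sigma>. V2 q h (f i) (f j)))
    \<le> (1 + real (card (matchings k))) * (\<Sum>x\<in>{x \<in> zsum {1..k} (torsion q). card (compatible {1..k} x) \<noteq> 1}. \<Prod>i\<in>{1..k}. g (x i))"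
proof -
  let ?I = "{1..k}" and ?Y = "torsion q - {0}"
  have finY: "finite ?Y" and finX: "finite (torsion q)" using finite_torsion[OF q] by auto
  have finI: "finite ?I" by simp
  have finZ: "finite (zsum ?I ?Y)" "finite (zsum ?I (torsion q))" using finite_zsum[OF finI] finX finY by auto
  let ?c = "\<lambda>i. coef h (f i)"
  let ?p = "\<lambda>x. \<Prod>i\<in>?I. ?c i (x i)"
  let ?M = "matchings_on ?I"
  have finM: "finite ?M" by (rule finite_matchings_on[OF finI])
  have "(\<Sum>\<sigma>\<in>matchings k. \<Prod>(i, j)\<in>\<sigma>. V2 q h (f i) (f j))
     = (\<Sum>\<sigma>\<in>?M. \<Sum>x\<in>{x \<in> zsum ?I ?Y. \<forall>p\<in>\<sigma>. x (fst p) + x (snd p) \<in> \<int>}. ?p x)"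
    unfolding matchings_eq
  proof (rule sum.cong[OF refl])
    fix \<sigma> assume \<sigma>: "\<sigma> \<in> ?M"
    have "(\<Prod>(i, j)\<in>\<sigma>. V2 q h (f i) (f j)) = (\<Prod>p\<in>\<sigma>. \<Sum>r\<in>{r \<in> ?Y \<times> ?Y. fst r + snd r \<in> \<int>}. ?c (fst p) (fst r) * ?c (snd p) (snd r))"
      by (simp add: V2_eq_pair_sum[OF q] case_prod_beta)
    also have "\<dots> = (\<Sum>x\<in>{x \<in> zsum ?I ?Y. \<forall>p\<in>\<sigma>. x (fst p) + x (snd p) \<in> \<int>}. ?p x)"
      by (rule prod_matching_eq_sum[OF finY finI \<sigma>])
    finally show "(\<Prod>(i, j)\<in>\<sigma>. V2 q h (f i) (f j)) = \<dots>" .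
  qed
  also have "\<dots> = (\<Sum>\<sigma>\<in>?M. \<Sum>x\<in>zsum ?I ?Y. if \<forall>p\<in>\<sigma>. x (fst p) + x (snd p) \<in> \<int> then ?p x else 0)"
    using finZ by (intro sum.cong refl sum.inter_filter) auto
  also have "\<dots> = (\<Sum>x\<in>zsum ?I ?Y. \<Sum>\<sigma>\<in>?M. if \<forall>p\<in>\<sigma>. x (fst p) + x (snd p) \<in> \<int> then ?p x else 0)"
    by (rule sum.swap)
  also have "\<dots> = (\<Sum>x\<in>zsum ?I ?Y. of_nat (card (compatible ?I x)) * ?p x)"
  proof (rule sum.cong[OF refl])
    fix x
    have "(\<Sum>\<sigma>\<in>?M. if \<forall>p\<in>\<sigma>. x (fst p) + x (snd p) \<in> \<int> then ?p x else 0)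
      = (\<Sum>\<sigma>\<in>{\<sigma> \<in> ?M. \<forall>p\<in>\<sigma>. x (fst p) + x (snd p) \<in> \<int>}. ?p x)"
      by (rule sum.inter_filter[symmetric, OF finM])
    then show "(\<Sum>\<sigma>\<in>?M. if \<forall>p\<in>\<sigma>. x (fst p) + x (snd p) \<in> \<int> then ?p x else 0) = of_nat (card (compatible ?I x)) * ?p x"
      by (simp add: compatible_def)
  qed
  finally have "Vk k q h f - (\<Sum>\<sigma>\<in>matchings k. \<Prod>(i, j)\<in>\<sigma>. V2 q h (f i) (f j))
     = (\<Sum>x\<in>zsum ?I ?Y. (1 - of_nat (card (compatible ?I x))) * ?p x)"
    unfolding Vk_eq_zsum[OF q] by (simp only: sum_subtractf[symmetric] left_diff_distrib mult_1_left)
  also have "\<dots> = (\<Sum>x\<in>{x \<in> zsum ?I ?Y. card (compatible ?I x) \<noteq> 1}. (1 - of_nat (card (compatible ?I x))) * ?p x)"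
    by (rule sum.mono_neutral_right) (use finZ in auto)
  finally have "norm (Vk k q h f - (\<Sum>\<sigma>\<in>matchings k. \<Prod>(i, j)\<in>\<sigma>. V2 q h (f i) (f j)))
     = norm (\<Sum>x\<in>{x \<in> zsum ?I ?Y. card (compatible ?I x) \<noteq> 1}. (1 - of_nat (card (compatible ?I x))) * ?p x)"
    by (rule arg_cong)
  also have "\<dots> \<le> (\<Sum>x\<in>{x \<in> zsum ?I ?Y. card (compatible ?I x) \<noteq> 1}. (1 + real (card ?M)) * (\<Prod>i\<in>?I. g (x i)))"
  proof (rule sum_norm_le)
    fix x assume x: "x \<in> {x \<in> zsum ?I ?Y. card (compatible ?I x) \<noteq> 1}"
    have "norm (1 - of_nat (card (compatible ?I x)) :: complex) \<le> 1 + real (card (compatible ?I x))"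
      using norm_triangle_ineq4[of "1::complex" "of_nat (card (compatible ?I x))"] by simp
    also have "\<dots> \<le> 1 + real (card ?M)" using finM by (simp add: card_mono compatible_def)
    finally have 1: "norm (1 - of_nat (card (compatible ?I x)) :: complex) \<le> 1 + real (card ?M)" .
    have "norm (?p x) = (\<Prod>i\<in>?I. norm (?c i (x i)))" by (rule prod_norm[symmetric])
    also have "\<dots> \<le> (\<Prod>i\<in>?I. g (x i))"
    proof (rule prod_mono, rule conjI)
      fix i assume i: "i \<in> ?I"
      have "x i \<in> ?Y" using x i by (auto simp: zsum_def PiE_iff)
      then show "norm (?c i (x i)) \<le> g (x i)" using c i by blast
    qed simp
    finally show "norm ((1 - of_nat (card (compatible ?I x))) * ?p x) \<le> (1 + real (card ?M)) * (\<Prod>i\<in>?I. g (x i))"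
      unfolding norm_mult using 1 by (intro mult_mono) auto
  qed
  also have "\<dots> = (1 + real (card ?M)) * (\<Sum>x\<in>{x \<in> zsum ?I ?Y. card (compatible ?I x) \<noteq> 1}. \<Prod>i\<in>?I. g (x i))"
    by (simp only: sum_distrib_left)
  also have "\<dots> \<le> (1 + real (card ?M)) * (\<Sum>x\<in>{x \<in> zsum ?I (torsion q). card (compatible ?I x) \<noteq> 1}. \<Prod>i\<in>?I. g (x i))"
  proof (intro mult_left_mono sum_mono2)
    show "{x \<in> zsum ?I ?Y. card (compatible ?I x) \<noteq> 1} \<subseteq> {x \<in> zsum ?I (torsion q). card (compatible ?I x) \<noteq> 1}"
      by (auto simp: zsum_def PiE_iff)
  qed (use finZ g in \<open>auto intro: prod_nonneg\<close>)
  finally show ?thesis unfolding matchings_eq .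
qed

section \<open>The error term\<close>

context small_torsion
begin

text \<open>The counterpart of \<open>rc\<close> for classes beyond \<delta>, where the exponential
  sum is bounded and no factor h is attached.\<close>

definition rct :: "real \<Rightarrow> real" where
  "rct x = (if x \<in> torsion q \<and> x \<noteq> 0 \<and> \<delta> < \<bar>x\<bar> then 1 / real (den x) else 0)"

lemma rct_nonneg: "rct x \<ge> 0"
  by (simp add: rct_def)

lemma rct_second_moment:
  assumes "d dvd q"
  shows "real d * (\<Sum>x\<in>{x \<in> torsion q. den x = d}. (rct x)\<^sup>2) \<le> 1"
proof -
  have d: "d > 0" using assms q0 by (meson dvd_pos_nat)
  let ?A = "{x \<in> torsion q. den x = d \<and> x \<noteq> 0 \<and> \<delta> < \<bar>x\<bar>}"
  have "(\<Sum>x\<in>{x \<in> torsion q. den x = d}. (rct x)\<^sup>2) = (\<Sum>x\<in>?A. (rct x)\<^sup>2)"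
    by (rule sum.mono_neutral_right) (use finite_torsion[OF q0] in \<open>auto simp: rct_def\<close>)
  moreover have "real d * (\<Sum>x\<in>?A. (rct x)\<^sup>2) \<le> 1 * 1\<^sup>2"
  proof (rule sum_const_on_den[OF d])
    show "finite ?A" using finite_torsion[OF q0] by simp
    have "?A \<subseteq> torsion d - {0}" using in_torsion_den_dvd_iff[OF q0] by auto
    then have "card ?A \<le> card (torsion d - {0})" using finite_torsion[OF d] by (intro card_mono) auto
    then show "real (card ?A) \<le> 1 * real d" using card_torsion_nonzero[OF d] by simp
  qed (auto simp: rct_def)
  ultimately show ?thesis by simp
qed

text \<open>The two functions have disjoint supports, so squaring produces no cross term.\<close>

lemma rc_rct_second_moment:
  assumes "d dvd q" "h \<ge> 0"
  shows "real d * (\<Sum>x\<in>{x \<in> torsion q. den x = d}. (h * rc x + rct x)\<^sup>2) \<le> 2 * \<delta> * h\<^sup>2 + 1"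
proof -
  let ?T = "{x \<in> torsion q. den x = d}"
  have "(h * rc x + rct x)\<^sup>2 = h\<^sup>2 * (rc x)\<^sup>2 + (rct x)\<^sup>2" for x
    by (auto simp: rc_def rct_def S_def power_mult_distrib)
  then have "real d * (\<Sum>x\<in>?T. (h * rc x + rct x)\<^sup>2) = h\<^sup>2 * (real d * (\<Sum>x\<in>?T. (rc x)\<^sup>2)) + real d * (\<Sum>x\<in>?T. (rct x)\<^sup>2)"
    by (simp add: sum.distrib sum_distrib_left algebra_simps)
  also have "\<dots> \<le> h\<^sup>2 * (2 * \<delta>) + 1"
    using rc_second_moment[OF assms(1)] rct_second_moment[OF assms(1)] by (intro add_mono mult_left_mono) auto
  finally show ?thesis by (simp add: mult_ac)
qed

lemma bad_sum_le:
  assumes I: "finite I" "card I = n" and h: "h \<ge> 0"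
  shows "(\<Sum>x\<in>{x \<in> zsum I (torsion q). card (compatible I x) \<noteq> 1}. \<Prod>i\<in>I. (h * rc (x i) + rct (x i)))
    \<le> h ^ n * U I + real n * (sqrt (2 * \<delta> * h\<^sup>2 + 1) ^ (n - 1) * Phi q ^ ex2 n)"
proof -
  let ?X = "torsion q"
  define g where "g x = h * rc x + rct x" for x
  have g0: "g x \<ge> 0" for x using h rc_nonneg rct_nonneg by (simp add: g_def)
  have finZ: "finite (zsum I ?X)" by (rule finite_zsum[OF I(1) finite_torsion[OF q0]])
  let ?f = "\<lambda>x. \<Prod>i\<in>I. g (x i)"
  have f0: "?f x \<ge> 0" for x by (intro prod_nonneg) (simp add: g0)
  let ?bad = "{x \<in> zsum I ?X. card (compatible I x) \<noteq> 1}"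
  let ?A = "{x \<in> ?bad. \<forall>i\<in>I. x i \<in> S}"
  let ?B = "\<lambda>i. {x \<in> zsum I ?X. x i \<notin> S}"
  have "sum ?f ?bad \<le> sum ?f (?A \<union> (\<Union>i\<in>I. ?B i))"
    by (rule sum_mono2) (use finZ I f0 in auto)
  also have "\<dots> \<le> sum ?f ?A + sum ?f (\<Union>i\<in>I. ?B i)"
    using finZ I f0 by (subst sum_Un) (auto intro!: sum_nonneg)
  also have "\<dots> \<le> sum ?f ?A + (\<Sum>i\<in>I. sum ?f (?B i))"
    by (intro add_left_mono sum_UN_le) (use finZ I f0 in auto)
  also have "\<dots> \<le> h ^ n * U I + (\<Sum>i\<in>I. sqrt (2 * \<delta> * h\<^sup>2 + 1) ^ (n - 1) * Phi q ^ ex2 n)"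
  proof (intro add_mono sum_mono)
    have "sum ?f ?A = (\<Sum>x\<in>?A. h ^ n * (\<Prod>i\<in>I. rc (x i)))"
    proof (rule sum.cong[OF refl])
      fix x assume x: "x \<in> ?A"
      have "?f x = (\<Prod>i\<in>I. h * rc (x i))"
        using x by (intro prod.cong refl) (auto simp: g_def rct_def S_def)
      then show "?f x = h ^ n * (\<Prod>i\<in>I. rc (x i))" using I(2) by (simp add: prod.distrib)
    qed
    also have "\<dots> \<le> (\<Sum>x\<in>?bad. h ^ n * (\<Prod>i\<in>I. rc (x i)))"
      by (rule sum_mono2) (use finZ h rc_nonneg in \<open>auto intro!: mult_nonneg_nonneg prod_nonneg\<close>)
    also have "\<dots> = h ^ n * U I" by (simp only: U_def sum_distrib_left)
    finally show "sum ?f ?A \<le> h ^ n * U I" .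
  next
    fix i assume i: "i \<in> I"
    let ?H = "\<lambda>m. if m = i then rct else g"
    let ?N = "\<lambda>m. if m = i then 1 else sqrt (2 * \<delta> * h\<^sup>2 + 1)"
    have H0: "?H m x \<ge> 0" for m x using g0 rct_nonneg by simp
    have "sum ?f (?B i) = (\<Sum>x\<in>?B i. \<Prod>m\<in>I. ?H m (x m))"
      by (intro sum.cong prod.cong refl) (auto simp: g_def rc_def)
    also have "\<dots> \<le> (\<Sum>x\<in>zsum I ?X. \<Prod>m\<in>I. ?H m (x m))"
      using finZ H0 by (intro sum_mono2 prod_nonneg) auto
    also have "\<dots> \<le> (\<Prod>m\<in>I. ?N m) * Phi q ^ ex2 (card I)"
    proof (rule zsum_bound_unweighted[OF I(1) _ H0])
      fix m d assume "m \<in> I" and d: "d dvd q"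
      have "0 \<le> 2 * \<delta> * h\<^sup>2 + 1" using d0 by (intro add_nonneg_nonneg mult_nonneg_nonneg) auto
      then show "real d * (\<Sum>x\<in>{x \<in> torsion q. den x = d}. (?H m x)\<^sup>2) \<le> (?N m)\<^sup>2"
        using rct_second_moment[OF d] rc_rct_second_moment[OF d h] by (simp add: g_def)
    qed (use d0 in auto)
    also have "(\<Prod>m\<in>I. ?N m) = sqrt (2 * \<delta> * h\<^sup>2 + 1) ^ (n - 1)"
    proof -
      have "(\<Prod>m\<in>I. ?N m) = ?N i * (\<Prod>m\<in>I - {i}. ?N m)" by (rule prod.remove[OF I(1) i])
      also have "(\<Prod>m\<in>I - {i}. ?N m) = (\<Prod>m\<in>I - {i}. sqrt (2 * \<delta> * h\<^sup>2 + 1))" by (intro prod.cong) auto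
      finally show ?thesis using I i by (simp add: card_Diff_singleton)
    qed
    finally show "sum ?f (?B i) \<le> sqrt (2 * \<delta> * h\<^sup>2 + 1) ^ (n - 1) * Phi q ^ ex2 n" using I(2) by simp
  qed
  finally show ?thesis using I(2) by (simp add: g_def)
qed

end

section \<open>Choice of the parameters\<close>

text \<open>The values balance the main terms: Q = 1/(y \<delta>) makes \<delta>/Q equal to
  \<delta>^2 y, and then \<delta>^4 Q^2/D = \<delta>^2/(y^2 D) reaches the same size for D = 1/y^3.
  The terms add up to 84 \<delta>^2 y; 100 is used because it is a square.\<close>

lemma gain_le:
  assumes "small_torsion q \<delta>" and \<delta>: "\<delta> \<le> y\<^sup>2 / 2" "\<delta> \<le> y" and y: "0 < y" "y \<le> 1"
  shows "small_torsion.gain \<delta> (1 / y ^ 3) (1 / (y * \<delta>)) \<le> 100 * \<delta>\<^sup>2 * y"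
proof -
  interpret small_torsion q \<delta> by fact
  have s: "sqrt (2 * \<delta>) \<le> y" using \<delta>(1) y by (intro real_le_lsqrt) auto
  have "gain (1 / y ^ 3) (1 / (y * \<delta>)) = \<delta>\<^sup>2 * (16 * \<delta> + 8 * y ^ 3 + 8 * sqrt (2 * \<delta>) + 4 * y + 48 * y)"
    unfolding gain_def using y d0 by (simp add: field_simps power2_eq_square power3_eq_cube power4_eq_xxxx)
  also have "\<dots> \<le> \<delta>\<^sup>2 * (16 * y + 8 * y + 8 * y + 4 * y + 48 * y)"
  proof (intro mult_left_mono add_mono order_refl)
    have "y ^ 3 \<le> y ^ 1" using y by (intro power_decreasing) auto
    then show "y ^ 3 \<le> y" by simp
  qed (use \<delta> s in auto)
  also have "\<dots> \<le> 100 * \<delta>\<^sup>2 * y" using y by (simp add: algebra_simps)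
  finally show ?thesis .
qed

text \<open>The value of c makes D^(k-1) = h^(3c(k-1)) at most h^(1-\<epsilon>), and its saving is
  h^(-c/2). For \<epsilon> \<le> 1/42 this saves at least 41/(252k) in the exponent, while the
  excess of \<delta> over 1/h loses k \<epsilon>/2 = 1/(84k) = 3/(252k); more than 36/(252k) =
  1/(7k) is left. The last bound is for tuples with a large entry, which save half a power of
  h.\<close>

lemma exponent_bounds:
  fixes k :: nat
  assumes k: "k \<ge> 1" and \<epsilon>: "\<epsilon> = 1 / (42 * (real k)\<^sup>2)" and c: "c = (1 - \<epsilon>) / (3 * real k)"
  shows "0 < \<epsilon>" "\<epsilon> \<le> 1 / 42" "0 < c" "2 * c \<le> 1 - \<epsilon>" "3 * c * real (k - 1) \<le> 1 - \<epsilon>"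
    "- c / 2 + real k * (1 + \<epsilon>) / 2 \<le> real k / 2 - 1 / (7 * real k)"
    "real (k - 1) * (1 + \<epsilon>) / 2 \<le> real k / 2 - 1 / (7 * real k)"
proof -
  have k1: "real k \<ge> 1" using k by simp
  then have k2: "(real k)\<^sup>2 \<ge> 1" by (simp add: one_le_power)
  show e0: "0 < \<epsilon>" unfolding \<epsilon> using k1 by simp
  show e1: "\<epsilon> \<le> 1 / 42" unfolding \<epsilon> using k2 k1 by (intro divide_left_mono) auto
  show "0 < c" unfolding c using e1 k1 by simp
  have "2 * c = (1 - \<epsilon>) * (2 / (3 * real k))" unfolding c by simp
  also have "\<dots> \<le> (1 - \<epsilon>) * 1" using e1 k1 by (intro mult_left_mono) (auto simp: field_simps)
  finally show "2 * c \<le> 1 - \<epsilon>" by simp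
  have "3 * c * real (k - 1) = (1 - \<epsilon>) * (real (k - 1) / real k)" unfolding c using k1 by (simp add: field_simps)
  also have "\<dots> \<le> (1 - \<epsilon>) * 1" using e1 k1 by (intro mult_left_mono) (auto simp: field_simps)
  finally show "3 * c * real (k - 1) \<le> 1 - \<epsilon>" by simp
  have ke: "real k * \<epsilon> = 1 / (42 * real k)" unfolding \<epsilon> using k1 by (simp add: field_simps power2_eq_square)
  have "c / 2 \<ge> (1 - 1 / 42) / (6 * real k)" unfolding c using e1 k1 by (simp add: field_simps)
  moreover have "(1 - 1 / 42) / (6 * real k) \<ge> 1 / (7 * real k) + 1 / (84 * real k)" using k1 by (simp add: field_simps)
  moreover have half: "real k * (1 + \<epsilon>) / 2 = real k / 2 + 1 / (84 * real k)"
    using ke by (simp add: distrib_left add_divide_distrib)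
  ultimately show "- c / 2 + real k * (1 + \<epsilon>) / 2 \<le> real k / 2 - 1 / (7 * real k)" by linarith
  have "real (k - 1) * (1 + \<epsilon>) / 2 = (real k * (1 + \<epsilon>) - (1 + \<epsilon>)) / 2" using k by (simp add: of_nat_diff algebra_simps)
  also have "\<dots> = real k * (1 + \<epsilon>) / 2 - (1 + \<epsilon>) / 2" by (simp add: diff_divide_distrib)
  also have "\<dots> = real k / 2 + 1 / (84 * real k) - (1 + \<epsilon>) / 2" using half by simp
  also have "\<dots> \<le> real k / 2 - 1 / (7 * real k)"
  proof -
    have "1 / (84 * real k) + 1 / (7 * real k) \<le> 1 / 2" using k1 by (simp add: field_simps)
    also have "1 / 2 \<le> (1 + \<epsilon>) / 2" using e0 by simp
    finally show ?thesis by (simp only: diff_le_eq le_diff_eq add_diff_eq diff_add_eq add_ac add_le_cancel_left)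
  qed
  finally show "real (k - 1) * (1 + \<epsilon>) / 2 \<le> real k / 2 - 1 / (7 * real k)" .
qed

text \<open>Since 2 \<delta> h^2 is h^(1+\<epsilon>)/4, each entry costs about h^((1+\<epsilon>)/2).
  The tuples of small entries additionally save \<theta>, and those with a large entry save one of
  the k factors; the exponent inequalities absorb the excess due to \<epsilon>.\<close>

lemma bad_sum_final:
  fixes k q :: nat and h :: real
  assumes k: "k \<ge> 1" and q: "squarefree q" and h: "h \<ge> 3"
    and \<epsilon>: "\<epsilon> = 1 / (42 * (real k)\<^sup>2)" and \<delta>: "\<delta> = h powr (\<epsilon> - 1) / 8"
  shows "small_torsion q \<delta>"
    "(\<Sum>x\<in>{x \<in> zsum {1..k} (torsion q). card (compatible {1..k} x) \<noteq> 1}.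
        \<Prod>i\<in>{1..k}. (h * small_torsion.rc q \<delta> (x i) + small_torsion.rct q \<delta> (x i)))
      \<le> (5 * recur_const k + real k * 2 ^ k) * h powr (real k / 2 - 1 / (7 * real k)) * Phi q ^ ex2 k"
proof -
  define c where "c = (1 - \<epsilon>) / (3 * real k)"
  note ex = exponent_bounds[OF k \<epsilon> c_def]
  have h1: "h > 1" "h > 0" using h by auto
  have mono: "h powr a \<le> h powr b" if "a \<le> b" for a b using that h1 by (intro powr_mono) auto
  have \<delta>0: "\<delta> > 0" unfolding \<delta> using h1 by simp
  have \<delta>8: "\<delta> \<le> 1 / 8" unfolding \<delta> using mono[of "\<epsilon> - 1" 0] ex(2) h1 by simp
  show st: "small_torsion q \<delta>" using q \<delta>0 \<delta>8 by unfold_locales auto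
  interpret small_torsion q \<delta> by (rule st)
  \<comment> \<open>The scale of the saving: \<open>D\<close> and \<open>Q\<close> are powers of it,
    and the second moment falls below its usual size \<delta>^2 by a factor of order y.\<close>
  define y where "y = h powr (- c)"
  have y0: "0 < y" using h1 by (simp add: y_def)
  have y1: "y \<le> 1" using mono[of "- c" 0] ex(3) h1 by (simp add: y_def)
  have y2: "y\<^sup>2 = h powr (- 2 * c)" unfolding y_def using h1 by (simp add: powr_power)
  have \<delta>y: "\<delta> \<le> y\<^sup>2 / 2"
  proof -
    have "h powr (\<epsilon> - 1) \<le> h powr (- 2 * c)" using ex(4) by (intro mono) simp
    moreover have "0 \<le> h powr (- 2 * c)" by simp
    ultimately show ?thesis unfolding \<delta> y2 by linarith
  qed
  have \<delta>y': "\<delta> \<le> y"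
  proof -
    have "y\<^sup>2 \<le> y" using y0 y1 by (simp add: power2_eq_square)
    then show ?thesis using \<delta>y y0 by linarith
  qed
  define D Q where "D = 1 / y ^ 3" and "Q = 1 / (y * \<delta>)"
  have D1: "D \<ge> 1" unfolding D_def using y0 y1 by (simp add: power_le_one)
  have Q0: "Q > 0" unfolding Q_def using y0 \<delta>0 by simp
  have Dk: "D ^ (k - 1) * \<delta> < 1"
  proof -
    have "y ^ 3 = h powr (- (3 * c))" unfolding y_def using h1 by (simp add: powr_power)
    then have "D = h powr (3 * c)" unfolding D_def powr_minus_divide by simp
    then have "D ^ (k - 1) = h powr (3 * c * real (k - 1))" using h1 by (simp add: powr_power mult.commute)
    also have "\<dots> \<le> h powr (1 - \<epsilon>)" by (rule mono[OF ex(5)])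
    finally have "D ^ (k - 1) * \<delta> \<le> h powr (1 - \<epsilon>) * \<delta>" using \<delta>0 by (intro mult_right_mono) auto
    also have "\<dots> = 1 / 8" unfolding \<delta> using h1 by (simp add: powr_add[symmetric])
    finally show ?thesis by simp
  qed
  \<comment> \<open>Chosen so that 2 \<delta> \<theta> = 10 \<delta> sqrt y, the square root of the
    bound 100 \<delta>^2 y for \<open>gain\<close>.\<close>
  define \<theta> where "\<theta> = 5 * sqrt y"
  have g: "gain D Q \<le> 100 * \<delta>\<^sup>2 * y" unfolding D_def Q_def by (rule gain_le[OF st \<delta>y \<delta>y' y0 y1])
  have th1: "sqrt (gain D Q) \<le> 2 * \<delta> * \<theta>"
  proof -
    have "sqrt (gain D Q) \<le> sqrt (100 * \<delta>\<^sup>2 * y)" using g by simp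
    also have "\<dots> = sqrt ((10 * \<delta>)\<^sup>2) * sqrt y" unfolding real_sqrt_mult[symmetric] by (simp add: power_mult_distrib)
    also have "sqrt ((10 * \<delta>)\<^sup>2) = 10 * \<delta>" using \<delta>0 by (intro real_sqrt_unique) auto
    also have "10 * \<delta> * sqrt y = 2 * \<delta> * \<theta>" by (simp add: \<theta>_def)
    finally show ?thesis .
  qed
  have th2: "\<delta> \<le> \<theta>"
  proof -
    have "y \<le> sqrt y" using y0 y1 by (intro real_le_rsqrt) (auto simp: power2_eq_square mult_left_le)
    then show ?thesis using \<delta>y' y0 unfolding \<theta>_def by (smt (verit) real_sqrt_ge_zero)
  qed
  have sy: "sqrt y = h powr (- c / 2)" unfolding y_def using h1 by (simp add: powr_half_sqrt[symmetric] powr_powr)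
  have hd: "2 * \<delta> * h\<^sup>2 = h powr (1 + \<epsilon>) / 4"
  proof -
    have "h powr (\<epsilon> - 1) * h powr 2 = h powr (1 + \<epsilon>)" unfolding powr_add[symmetric] by (simp add: algebra_simps)
    then show ?thesis unfolding \<delta> using h1 by (simp add: powr_numeral)
  qed
  have P1: "Phi q \<ge> 1" by (rule Phi_ge_1[OF q0])
  let ?e = "real k / 2 - 1 / (7 * real k)"
  have main: "h ^ k * U {1..k} \<le> 5 * recur_const k * h powr ?e * Phi q ^ ex2 k"
  proof -
    have "U {1..k} \<le> recur_const k * (\<theta> * sqrt (2 * \<delta>) ^ k * Phi q ^ ex2 k)"
      by (rule U_le[OF _ _ order_refl Dk D1 Q0 th1 th2]) auto
    then have "h ^ k * U {1..k} \<le> h ^ k * (recur_const k * (\<theta> * sqrt (2 * \<delta>) ^ k * Phi q ^ ex2 k))"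
      using h1 by (intro mult_left_mono) auto
    also have "\<dots> = recur_const k * 5 * (sqrt y * (h * sqrt (2 * \<delta>)) ^ k) * Phi q ^ ex2 k"
      by (simp add: \<theta>_def power_mult_distrib)
    also have "\<dots> \<le> recur_const k * 5 * h powr ?e * Phi q ^ ex2 k"
    proof (intro mult_left_mono mult_right_mono)
      have "h * sqrt (2 * \<delta>) = sqrt (2 * \<delta> * h\<^sup>2)" using h1 by (simp add: real_sqrt_mult)
      also have "\<dots> \<le> sqrt (h powr (1 + \<epsilon>))" unfolding hd by simp
      also have "\<dots> = h powr ((1 + \<epsilon>) / 2)" by (simp add: powr_half_sqrt[symmetric] powr_powr)
      finally have "(h * sqrt (2 * \<delta>)) ^ k \<le> (h powr ((1 + \<epsilon>) / 2)) ^ k" using h1 \<delta>0 by (intro power_mono) auto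
      also have "\<dots> = h powr (real k * (1 + \<epsilon>) / 2)" using h1 by (simp add: powr_power mult_ac)
      finally have "sqrt y * (h * sqrt (2 * \<delta>)) ^ k \<le> h powr (- c / 2) * h powr (real k * (1 + \<epsilon>) / 2)"
        unfolding sy by (intro mult_left_mono) auto
      also have "\<dots> = h powr (- c / 2 + real k * (1 + \<epsilon>) / 2)" by (rule powr_add[symmetric])
      also have "\<dots> \<le> h powr ?e" by (rule mono[OF ex(6)])
      finally show "sqrt y * (h * sqrt (2 * \<delta>)) ^ k \<le> h powr ?e" .
    qed (use recur_const_nonneg P1 in auto)
    finally show ?thesis by (simp add: mult_ac)
  qed
  have tail: "sqrt (2 * \<delta> * h\<^sup>2 + 1) ^ (k - 1) \<le> 2 ^ k * h powr ?e"
  proof -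
    have "h powr 0 \<le> h powr (1 + \<epsilon>)" using ex(1) by (intro mono) auto
    then have "1 \<le> h powr (1 + \<epsilon>)" using h1 by simp
    then have "2 * \<delta> * h\<^sup>2 + 1 \<le> 2\<^sup>2 * h powr (1 + \<epsilon>)" unfolding hd by simp
    then have "sqrt (2 * \<delta> * h\<^sup>2 + 1) \<le> sqrt (2\<^sup>2 * h powr (1 + \<epsilon>))" by (rule real_sqrt_le_mono)
    also have "\<dots> = 2 * h powr ((1 + \<epsilon>) / 2)" unfolding real_sqrt_mult by (simp add: powr_half_sqrt[symmetric] powr_powr)
    finally have "sqrt (2 * \<delta> * h\<^sup>2 + 1) ^ (k - 1) \<le> (2 * h powr ((1 + \<epsilon>) / 2)) ^ (k - 1)"
      using \<delta>0 by (intro power_mono) auto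
    also have "\<dots> = 2 ^ (k - 1) * h powr (real (k - 1) * (1 + \<epsilon>) / 2)"
      unfolding power_mult_distrib using h1 by (simp add: powr_power mult_ac)
    also have "\<dots> \<le> 2 ^ k * h powr ?e"
      by (intro mult_mono power_increasing mono[OF ex(7)]) auto
    finally show ?thesis .
  qed
  have "(\<Sum>x\<in>{x \<in> zsum {1..k} (torsion q). card (compatible {1..k} x) \<noteq> 1}. \<Prod>i\<in>{1..k}. (h * rc (x i) + rct (x i)))
     \<le> h ^ k * U {1..k} + real k * (sqrt (2 * \<delta> * h\<^sup>2 + 1) ^ (k - 1) * Phi q ^ ex2 k)"
    by (rule bad_sum_le) (use h1 in auto)
  also have "\<dots> \<le> 5 * recur_const k * h powr ?e * Phi q ^ ex2 k + real k * (2 ^ k * h powr ?e * Phi q ^ ex2 k)"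
    using main tail P1 by (intro add_mono mult_left_mono mult_right_mono) auto
  also have "\<dots> = (5 * recur_const k + real k * 2 ^ k) * h powr ?e * Phi q ^ ex2 k"
    by (simp add: algebra_simps)
  finally show "(\<Sum>x\<in>{x \<in> zsum {1..k} (torsion q). card (compatible {1..k} x) \<noteq> 1}. \<Prod>i\<in>{1..k}. (h * rc (x i) + rct (x i))) \<le> \<dots>" .
qed

text \<open>On \<open>S\<close> the trivial bound C h is used. Beyond \<delta> the decay bound loses
  the factor (h \<delta>)^N = h/8^N, which cancels the h and leaves C 8^N. Replacing the totient of
  the denominator by the denominator costs \<open>Phi q\<close>, as \<open>Phi\<close> is monotone
  under divisibility.\<close>

lemma norm_coef_le:
  assumes st: "small_torsion q \<delta>" and h: "h > 0" and x: "x \<in> torsion q - {0}" and C: "C \<ge> 0"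
    and E1: "norm (Esum f h x) \<le> C * h" and E2: "(h * \<bar>x\<bar>) ^ N * norm (Esum f h x) \<le> C * h"
    and hN: "(h * \<delta>) ^ N = h / 8 ^ N"
  shows "norm (coef h f x) \<le> C * 8 ^ N * Phi q * (h * small_torsion.rc q \<delta> x + small_torsion.rct q \<delta> x)"
proof -
  interpret small_torsion q \<delta> by (rule st)
  have d: "den x > 0" "den x dvd q" using den_pos[OF q0] den_dvd[OF q0] x by auto
  have P1: "Phi q \<ge> 1" by (rule Phi_ge_1[OF q0])
  have tot: "1 / real (totient (den x)) \<le> Phi q / real (den x)"
  proof -
    have "Phi (den x) \<le> Phi q" by (rule Phi_mono_dvd[OF sqf d(2)])
    then have "Phi (den x) / real (den x) \<le> Phi q / real (den x)" by (rule divide_right_mono) simp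
    then show ?thesis using d(1) by (simp add: Phi_def)
  qed
  have mu: "\<bar>real_of_int (moebius_mu (den x))\<bar> \<le> 1" by (simp add: moebius_mu_def power_abs)
  have "norm (coef h f x) = \<bar>real_of_int (moebius_mu (den x))\<bar> * (1 / real (totient (den x)) * norm (Esum f h x))"
    by (simp add: coef_def norm_mult norm_divide)
  also have "\<dots> \<le> 1 * (Phi q / real (den x) * (C * 8 ^ N * (if x \<in> S then h else 1)))"
  proof (intro mult_mono mu tot)
    show "norm (Esum f h x) \<le> C * 8 ^ N * (if x \<in> S then h else 1)"
    proof (cases "x \<in> S")
      case True
      have "C * h * 1 \<le> C * h * 8 ^ N" using C h by (intro mult_left_mono) auto
      then show ?thesis using True E1 by (simp add: mult_ac)
    next
      case False
      then have "\<delta> \<le> \<bar>x\<bar>" using x by (auto simp: S_def)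
      then have "(h * \<delta>) ^ N \<le> (h * \<bar>x\<bar>) ^ N" using h d0 by (intro power_mono mult_left_mono) auto
      then have "(h / 8 ^ N) * norm (Esum f h x) \<le> (h * \<bar>x\<bar>) ^ N * norm (Esum f h x)"
        unfolding hN by (intro mult_right_mono) auto
      then have "(h / 8 ^ N) * norm (Esum f h x) \<le> C * h" using E2 by linarith
      then show ?thesis using False h by (simp add: field_simps)
    qed
  qed (use P1 in auto)
  also have "\<dots> = C * 8 ^ N * Phi q * ((if x \<in> S then h else 1) / real (den x))" by (simp add: mult_ac)
  also have "(if x \<in> S then h else 1) / real (den x) = h * rc x + rct x"
    using x by (auto simp: rc_def rct_def S_def)
  finally show ?thesis .
qed

theorem theorem1p3:
  fixes k :: nat and f :: "nat \<Rightarrow> real \<Rightarrow> complex"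
  assumes "k \<ge> 1"
    and "\<And>i. i \<in> {1..k} \<Longrightarrow> smooth_halfline (f i)"
    and "\<And>i. i \<in> {1..k} \<Longrightarrow> compact (supp_halfline (f i))"
    and "\<And>i. i \<in> {1..k} \<Longrightarrow> supp_halfline (f i) \<subseteq> {0<..}"
    and "\<And>i. i \<in> {1..k} \<Longrightarrow>
           (\<lambda>\<xi>. cmod (fourier (f i) \<xi>)) \<in> O[at_infinity](\<lambda>\<xi>. \<bar>\<xi>\<bar> powr (-2))"
  shows "\<exists>C::real. \<forall>(q::nat) (h::real). q \<ge> 1 \<longrightarrow> squarefree q \<longrightarrow> h \<ge> 3 \<longrightarrow>
           cmod (Vk k q h f - (\<Sum>\<sigma>\<in>matchings k. \<Prod>(i, j)\<in>\<sigma>. V2 q h (f i) (f j)))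
           \<le> C * (h powr (real k / 2 - 1 / (7 * real k)) *
                  (real q / real (totient q)) powr (2 ^ k + real k / 2))"
proof -
  \<comment> \<open>Equal to 1/\<epsilon>: as h \<delta> = h^\<epsilon>/8, its N-th power is exactly
    h/8^N, just enough to remove the factor h beyond \<delta>.\<close>
  define N where "N = 42 * k\<^sup>2"
  define \<epsilon> where "\<epsilon> = 1 / (42 * (real k)\<^sup>2)"
  have "\<forall>i\<in>{1..k}. \<exists>C\<ge>0. \<forall>h \<alpha>. h \<ge> 1 \<longrightarrow> \<bar>\<alpha>\<bar> \<le> 1/2 \<longrightarrow>
    norm (Esum (f i) h \<alpha>) \<le> C * h \<and> (h * \<bar>\<alpha>\<bar>) ^ N * norm (Esum (f i) h \<alpha>) \<le> C * h"
    using Esum_bound assms(2-4) by blast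
  then obtain Cf where Cf: "\<And>i. i \<in> {1..k} \<Longrightarrow> Cf i \<ge> 0"
    "\<And>i h \<alpha>. i \<in> {1..k} \<Longrightarrow> h \<ge> 1 \<Longrightarrow> \<bar>\<alpha>\<bar> \<le> 1/2 \<Longrightarrow>
      norm (Esum (f i) h \<alpha>) \<le> Cf i * h \<and> (h * \<bar>\<alpha>\<bar>) ^ N * norm (Esum (f i) h \<alpha>) \<le> Cf i * h"
    by metis
  define C where "C = (\<Sum>i\<in>{1..k}. Cf i)"
  have CC: "Cf i \<le> C" if "i \<in> {1..k}" for i
    unfolding C_def using that Cf(1) by (intro member_le_sum) auto
  have C0: "C \<ge> 0" unfolding C_def using Cf(1) by (rule sum_nonneg)
  define K where "K = (1 + real (card (matchings k))) * ((C * 8 ^ N) ^ k * (5 * recur_const k + real k * 2 ^ k))"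
  have K0: "K \<ge> 0" unfolding K_def using C0 recur_const_nonneg[of k] by simp
  show ?thesis
  proof (intro exI[of _ K] allI impI)
    fix q :: nat and h :: real
    assume q: "q \<ge> 1" "squarefree q" and h: "h \<ge> 3"
    define \<delta> where "\<delta> = h powr (\<epsilon> - 1) / 8"
    note bs = bad_sum_final[OF assms(1) q(2) h \<epsilon>_def \<delta>_def]
    let ?rc = "small_torsion.rc q \<delta>" and ?rct = "small_torsion.rct q \<delta>"
    let ?e = "real k / 2 - 1 / (7 * real k)"
    let ?B = "(5 * recur_const k + real k * 2 ^ k) * h powr ?e * Phi q ^ ex2 k"
    define A where "A = C * 8 ^ N * Phi q"
    have P1: "Phi q \<ge> 1" using q by (intro Phi_ge_1) auto
    have A0: "A \<ge> 0" unfolding A_def using C0 P1 by simp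
    have nn: "?rc x \<ge> 0" "?rct x \<ge> 0" for x
      using small_torsion.rc_nonneg[OF bs(1)] small_torsion.rct_nonneg[OF bs(1)] by auto
    have hN: "(h * \<delta>) ^ N = h / 8 ^ N"
    proof -
      have "h * h powr (\<epsilon> - 1) = h powr 1 * h powr (\<epsilon> - 1)" using h by simp
      also have "\<dots> = h powr \<epsilon>" unfolding powr_add[symmetric] by simp
      finally have "h * \<delta> = h powr \<epsilon> / 8" by (simp add: \<delta>_def)
      moreover have "(h powr \<epsilon>) ^ N = h"
      proof -
        have "\<epsilon> * real N = 1" using assms(1) by (simp add: \<epsilon>_def N_def)
        then show ?thesis using h by (simp add: powr_power mult.commute)
      qed
      ultimately show ?thesis by (simp only: power_divide)
    qed
    have c: "norm (coef h (f i) x) \<le> A * (h * ?rc x + ?rct x)" if i: "i \<in> {1..k}" and x: "x \<in> torsion q - {0}" for i x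
      unfolding A_def
    proof (rule norm_coef_le[OF bs(1) _ x C0 _ _ hN])
      have xb: "\<bar>x\<bar> \<le> 1/2" using x by (auto simp: torsion_def)
      have le: "Cf i * h \<le> C * h" using CC[OF i] h by (intro mult_right_mono) auto
      have "h \<ge> 1" using h by simp
      note E = Cf(2)[OF i this xb]
      show "norm (Esum (f i) h x) \<le> C * h" by (rule order_trans[OF conjunct1[OF E] le])
      show "(h * \<bar>x\<bar>) ^ N * norm (Esum (f i) h x) \<le> C * h" by (rule order_trans[OF conjunct2[OF E] le])
    qed (use h in auto)
    have "norm (Vk k q h f - (\<Sum>\<sigma>\<in>matchings k. \<Prod>(i, j)\<in>\<sigma>. V2 q h (f i) (f j)))
      \<le> (1 + real (card (matchings k))) * (\<Sum>x\<in>{x \<in> zsum {1..k} (torsion q). card (compatible {1..k} x) \<noteq> 1}. \<Prod>i\<in>{1..k}. A * (h * ?rc (x i) + ?rct (x i)))"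
      by (rule Vk_minus_main_bound) (use q c nn A0 h in auto)
    also have "\<dots> = (1 + real (card (matchings k))) * (A ^ k * (\<Sum>x\<in>{x \<in> zsum {1..k} (torsion q). card (compatible {1..k} x) \<noteq> 1}. \<Prod>i\<in>{1..k}. (h * ?rc (x i) + ?rct (x i))))"
      by (simp add: prod.distrib sum_distrib_left)
    also have "\<dots> \<le> (1 + real (card (matchings k))) * (A ^ k * ?B)"
      using A0 bs(2) by (intro mult_left_mono) auto
    also have "\<dots> = K * (h powr ?e * Phi q ^ (k + ex2 k))"
      by (simp add: K_def A_def power_mult_distrib power_add mult_ac)
    also have "\<dots> \<le> K * (h powr ?e * Phi q powr (2 ^ k + real k / 2))"
    proof (intro mult_left_mono K0)
      \<comment> \<open>The k coefficients give one power each and the zero-sum bound gives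
        \<open>ex2 k\<close>, in total 2^k - 1, which is below the exponent claimed.\<close>
      have "Phi q ^ (k + ex2 k) = Phi q powr real (k + ex2 k)" using P1 by (intro powr_realpow[symmetric]) simp
      also have "\<dots> \<le> Phi q powr (2 ^ k + real k / 2)"
        using P1 by (intro powr_mono) (auto simp: real_ex2)
      finally show "Phi q ^ (k + ex2 k) \<le> Phi q powr (2 ^ k + real k / 2)" .
    qed auto
    finally show "cmod (Vk k q h f - (\<Sum>\<sigma>\<in>matchings k. \<Prod>(i, j)\<in>\<sigma>. V2 q h (f i) (f j)))
           \<le> K * (h powr (real k / 2 - 1 / (7 * real k)) * (real q / real (totient q)) powr (2 ^ k + real k / 2))"
      by (simp add: Phi_def)
  qed
qed

end
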